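(* Fix a positive integer $r$. For $s\ge1$ and $0\le i\le rs-1$ let $m_{i,s}=\langle \psi^{(r^s)},\chi^{(rs-i,1^i)}\rangle$, and set $m_{rs,s}=0$. Let $N_{r,s}(x)=\sum_{i=0}^{rs}m_{i,s}x^i$ and $M_r(x,y)=\sum_{s\ge1}N_{r,s}(x)y^s$. The following are equivalent: (i) $N_{r,1}(x)$ is divisible by $x+1$; (ii) for every $s\ge1$, $N_{r,s}(x)$ is divisible by $x+1$; (iii) $r$ is not square-free. Further, in that case the power series $M_r(x,y)/(1+x)$ has non-negative integer coefficients.
   Context: $\chi^\lambda$ denotes the irreducible character of $S_n$ indexed by the partition $\lambda\vdash n$, and $\langle\cdot,\cdot\rangle$ is the usual inner product of class functions. Higher Lie character $\psi^{(r^s)}$ of $S_n$, $n=rs$: fix a permutation $\pi\in S_n$ that is a product of $s$ disjoint $r$-cycles $(a^{(l)}_1\,a^{(l)}_2\cdots a^{(l)}_r)$, $l=1,\dots,s$. Its centralizer is $C\cong Z_r\wr S_s$, with base group $Z_r^s$ generated by the individual cycles of $\pi$, and wreathing subgroup $S_s$ consisting of the permutations $a^{(l)}_t\mapsto a^{(\tau(l))}_t$ for $\tau\in S_s$. Let $\zeta$ be a faithful (primitive) linear character of $Z_r$, and let $\omega$ be the linear character of $C$ given by $\omega(z_1,\dots,z_s)=\prod_l\zeta(z_l)$ on the base group and trivial on the wreathing subgroup. Then $\psi^{(r^s)}=\mathrm{Ind}_C^{S_n}\omega$. An integer is square-free if no square of a prime divides it; $1$ is square-free. *)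

theory Defs
  imports
    "HOL-Computational_Algebra.Computational_Algebra"
    "HOL-Combinatorics.Permutations"
    "HOL-Library.Function_Algebras"
    "HOL-Algebra.Sym_Groups"
    "HOL-Algebra.Elementary_Groups"
begin

section \<open>Class functions of a finite group\<close>

definition char_inner ::
    "('a, 'm) monoid_scheme \<Rightarrow> ('a \<Rightarrow> complex) \<Rightarrow> ('a \<Rightarrow> complex) \<Rightarrow> complex" where
  "char_inner G \<phi> \<theta> = (\<Sum>g\<in>carrier G. \<phi> g * cnj (\<theta> g)) / of_nat (order G)"

definition induced_character ::
    "('a, 'm) monoid_scheme \<Rightarrow> 'a set \<Rightarrow> ('a \<Rightarrow> complex) \<Rightarrow> 'a \<Rightarrow> complex" where
  "induced_character G H \<phi> g =
     (\<Sum>x\<in>{x \<in> carrier G. inv\<^bsub>G\<^esub> x \<otimes>\<^bsub>G\<^esub> g \<otimes>\<^bsub>G\<^esub> x \<in> H}.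
        \<phi> (inv\<^bsub>G\<^esub> x \<otimes>\<^bsub>G\<^esub> g \<otimes>\<^bsub>G\<^esub> x)) / of_nat (card H)"

definition centralizer :: "('a, 'm) monoid_scheme \<Rightarrow> 'a \<Rightarrow> 'a set" where
  "centralizer G x = {g \<in> carrier G. g \<otimes>\<^bsub>G\<^esub> x = x \<otimes>\<^bsub>G\<^esub> g}"


section \<open>Irreducible characters of the symmetric group\<close>

definition fun_scale :: "complex \<Rightarrow> ('a \<Rightarrow> complex) \<Rightarrow> 'a \<Rightarrow> complex" where
  "fun_scale c v = (\<lambda>x. c * v x)"

global_interpretation fun_space: vector_space fun_scale
  by unfold_locales (auto simp: fun_scale_def fun_eq_iff algebra_simps)

definition trace_on :: "('a \<Rightarrow> complex) set \<Rightarrow> (('a \<Rightarrow> complex) \<Rightarrow> 'a \<Rightarrow> complex) \<Rightarrow> complex" where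
  "trace_on V f =
     (let B = (SOME B. fun_space.independent B \<and> fun_space.span B = V)
      in \<Sum>b\<in>B. fun_space.representation B (f b) b)"

text \<open>
  A partition \<open>\<mu>\<close> of \<open>n\<close> is the weakly decreasing list of its positive parts. The irreducible
  character indexed by \<open>\<mu>\<close> is the character of the Specht module over the complex numbers: the
  subspace of the permutation module on tabloids that is spanned by the polytabloids.
\<close>

definition cells :: "nat list \<Rightarrow> (nat \<times> nat) set" where
  "cells \<mu> = {(i, j). i < length \<mu> \<and> j < \<mu> ! i}"

definition is_tableau :: "nat list \<Rightarrow> (nat \<times> nat \<Rightarrow> nat) \<Rightarrow> bool" where
  "is_tableau \<mu> t \<longleftrightarrow> bij_betw t (cells \<mu>) {1..sum_list \<mu>}"

definition row_of :: "nat list \<Rightarrow> (nat \<times> nat \<Rightarrow> nat) \<Rightarrow> nat \<Rightarrow> nat set" where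
  "row_of \<mu> t i = t ` {c \<in> cells \<mu>. fst c = i}"

definition column_of :: "nat list \<Rightarrow> (nat \<times> nat \<Rightarrow> nat) \<Rightarrow> nat \<Rightarrow> nat set" where
  "column_of \<mu> t j = t ` {c \<in> cells \<mu>. snd c = j}"

definition column_stabilizer :: "nat list \<Rightarrow> (nat \<times> nat \<Rightarrow> nat) \<Rightarrow> (nat \<Rightarrow> nat) set" where
  "column_stabilizer \<mu> t =
     {q. q permutes {1..sum_list \<mu>} \<and> (\<forall>j. q ` column_of \<mu> t j = column_of \<mu> t j)}"

text \<open>
  The tabloid of a tableau \<open>t\<close> is encoded as the sequence \<open>row_of \<mu> t\<close> of its row sets, and an
  element of the permutation module as its coefficient function on such sequences.
\<close>

definition polytabloid :: "nat list \<Rightarrow> (nat \<times> nat \<Rightarrow> nat) \<Rightarrow> (nat \<Rightarrow> nat set) \<Rightarrow> complex" where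
  "polytabloid \<mu> t T =
     (\<Sum>q\<in>column_stabilizer \<mu> t. if row_of \<mu> (q \<circ> t) = T then of_int (sign q) else 0)"

definition specht_module :: "nat list \<Rightarrow> ((nat \<Rightarrow> nat set) \<Rightarrow> complex) set" where
  "specht_module \<mu> = fun_space.span {polytabloid \<mu> t |t. is_tableau \<mu> t}"

definition tabloid_action ::
    "(nat \<Rightarrow> nat) \<Rightarrow> ((nat \<Rightarrow> nat set) \<Rightarrow> complex) \<Rightarrow> (nat \<Rightarrow> nat set) \<Rightarrow> complex" where
  "tabloid_action g v = (\<lambda>T. v (\<lambda>i. inv_into UNIV g ` T i))"

definition irr_char :: "nat list \<Rightarrow> (nat \<Rightarrow> nat) \<Rightarrow> complex" where
  "irr_char \<mu> g = trace_on (specht_module \<mu>) (tabloid_action g)"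

definition hook :: "nat \<Rightarrow> nat \<Rightarrow> nat list" where
  "hook n i = (n - i) # replicate i 1"


section \<open>Higher Lie characters\<close>

definition complex_units :: "complex monoid" where
  "complex_units = \<lparr>carrier = UNIV - {0}, mult = (*), one = 1\<rparr>"

definition faithful_linear_character :: "nat \<Rightarrow> (int \<Rightarrow> complex) \<Rightarrow> bool" where
  "faithful_linear_character r \<zeta> \<longleftrightarrow>
     \<zeta> \<in> hom (integer_mod_group r) complex_units \<and> inj_on \<zeta> (carrier (integer_mod_group r))"

text \<open>
  \<open>a l t\<close>, for \<open>l < s\<close> and \<open>t < r\<close>, is the \<open>t\<close>-th entry of the \<open>l\<close>-th cycle, both counted from \<open>0\<close>.
\<close>

definition cycle_labelling :: "nat \<Rightarrow> nat \<Rightarrow> (nat \<Rightarrow> nat \<Rightarrow> nat) \<Rightarrow> bool" where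
  "cycle_labelling r s a \<longleftrightarrow> bij_betw (\<lambda>(l, t). a l t) ({..<s} \<times> {..<r}) {1..r * s}"

definition label_of :: "nat \<Rightarrow> nat \<Rightarrow> (nat \<Rightarrow> nat \<Rightarrow> nat) \<Rightarrow> nat \<Rightarrow> nat \<times> nat" where
  "label_of r s a = inv_into ({..<s} \<times> {..<r}) (\<lambda>(l, t). a l t)"

text \<open>The product over \<open>l\<close> of the \<open>z l\<close>-th power of the \<open>l\<close>-th cycle.\<close>

definition base_perm :: "nat \<Rightarrow> nat \<Rightarrow> (nat \<Rightarrow> nat \<Rightarrow> nat) \<Rightarrow> (nat \<Rightarrow> int) \<Rightarrow> nat \<Rightarrow> nat" where
  "base_perm r s a z x =
     (if x \<in> {1..r * s}
      then case label_of r s a x of (l, t) \<Rightarrow> a l (nat ((int t + z l) mod int r))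
      else x)"

definition wreathing_perm :: "nat \<Rightarrow> nat \<Rightarrow> (nat \<Rightarrow> nat \<Rightarrow> nat) \<Rightarrow> (nat \<Rightarrow> nat) \<Rightarrow> nat \<Rightarrow> nat" where
  "wreathing_perm r s a \<tau> x =
     (if x \<in> {1..r * s} then case label_of r s a x of (l, t) \<Rightarrow> a (\<tau> l) t else x)"

definition cycles_perm :: "nat \<Rightarrow> nat \<Rightarrow> (nat \<Rightarrow> nat \<Rightarrow> nat) \<Rightarrow> nat \<Rightarrow> nat" where
  "cycles_perm r s a = base_perm r s a (\<lambda>_. 1)"

definition wreath_character ::
    "nat \<Rightarrow> nat \<Rightarrow> (nat \<Rightarrow> nat \<Rightarrow> nat) \<Rightarrow> (int \<Rightarrow> complex) \<Rightarrow> (nat \<Rightarrow> nat) \<Rightarrow> complex" where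
  "wreath_character r s a \<zeta> g =
     (THE w. \<exists>z \<tau>. (\<forall>l<s. z l \<in> carrier (integer_mod_group r)) \<and> \<tau> permutes {..<s} \<and>
        g = base_perm r s a z \<circ> wreathing_perm r s a \<tau> \<and> w = (\<Prod>l<s. \<zeta> (z l)))"

text \<open>
  The description in \<open>wreath_character\<close> is well defined, it covers the whole centralizer, and the
  resulting function is multiplicative there.
\<close>

context
  fixes r s :: nat and a :: "nat \<Rightarrow> nat \<Rightarrow> nat"
  assumes r: "r \<ge> 1" and a: "cycle_labelling r s a"
begin

lemma labelling_inj:
  assumes "l < s" "t < r" "l' < s" "t' < r"
  shows "a l t = a l' t' \<longleftrightarrow> l = l' \<and> t = t'"
  using a assms unfolding cycle_labelling_def bij_betw_def
  by (auto dest: inj_onD[of _ _ "(l, t)" "(l', t')"])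

lemma labelling_range: "l < s \<Longrightarrow> t < r \<Longrightarrow> a l t \<in> {1..r * s}"
  using a unfolding cycle_labelling_def by (auto dest!: bij_betwE)

lemma labelling_surj:
  assumes "x \<in> {1..r * s}" obtains l t where "l < s" "t < r" "x = a l t"
proof -
  have "x \<in> (\<lambda>(l, t). a l t) ` ({..<s} \<times> {..<r})"
    using a assms unfolding cycle_labelling_def bij_betw_def by blast
  thus ?thesis using that by auto
qed

lemma label_of_eq: "l < s \<Longrightarrow> t < r \<Longrightarrow> label_of r s a (a l t) = (l, t)"
  using a inv_into_f_f[of "\<lambda>(l, t). a l t" "{..<s} \<times> {..<r}" "(l, t)"]
  by (simp add: cycle_labelling_def bij_betw_def label_of_def)

lemma base_perm_eq:
  "l < s \<Longrightarrow> t < r \<Longrightarrow> base_perm r s a z (a l t) = a l (nat ((int t + z l) mod int r))"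
  using labelling_range by (simp add: base_perm_def label_of_eq)

lemma wreathing_perm_eq: "l < s \<Longrightarrow> t < r \<Longrightarrow> wreathing_perm r s a \<tau> (a l t) = a (\<tau> l) t"
  using labelling_range by (simp add: wreathing_perm_def label_of_eq)

lemma shift_less: "nat (k mod int r) < r"
  using r by (simp add: nat_less_iff)

lemma base_wreathing_eq:
  assumes "\<tau> permutes {..<s}" "l < s" "t < r"
  shows "(base_perm r s a z \<circ> wreathing_perm r s a \<tau>) (a l t) =
    a (\<tau> l) (nat ((int t + z (\<tau> l)) mod int r))"
  using assms permutes_in_image[OF assms(1), of l] by (simp add: wreathing_perm_eq base_perm_eq)

lemma base_wreathing_outside:
  "x \<notin> {1..r * s} \<Longrightarrow> (base_perm r s a z \<circ> wreathing_perm r s a \<tau>) x = x"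
  by (auto simp: base_perm_def wreathing_perm_def)

lemma carrier_cyclic: "carrier (integer_mod_group r) = {0..<int r}"
  using r by (simp add: carrier_integer_mod_group)

lemma wreath_character_eq:
  assumes z: "\<forall>l<s. z l \<in> carrier (integer_mod_group r)" and \<tau>: "\<tau> permutes {..<s}"
  shows "wreath_character r s a \<zeta> (base_perm r s a z \<circ> wreathing_perm r s a \<tau>) =
    (\<Prod>l<s. \<zeta> (z l))"
  unfolding wreath_character_def
proof (rule the_equality)
  show "\<exists>z' \<tau>'. (\<forall>l<s. z' l \<in> carrier (integer_mod_group r)) \<and> \<tau>' permutes {..<s} \<and>
      base_perm r s a z \<circ> wreathing_perm r s a \<tau> = base_perm r s a z' \<circ> wreathing_perm r s a \<tau>' \<and>
      (\<Prod>l<s. \<zeta> (z l)) = (\<Prod>l<s. \<zeta> (z' l))"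
    using z \<tau> by blast
next
  fix w
  assume "\<exists>z' \<tau>'. (\<forall>l<s. z' l \<in> carrier (integer_mod_group r)) \<and> \<tau>' permutes {..<s} \<and>
      base_perm r s a z \<circ> wreathing_perm r s a \<tau> = base_perm r s a z' \<circ> wreathing_perm r s a \<tau>' \<and>
      w = (\<Prod>l<s. \<zeta> (z' l))"
  then obtain z' \<tau>' where z': "\<forall>l<s. z' l \<in> carrier (integer_mod_group r)"
    and \<tau>': "\<tau>' permutes {..<s}"
    and eq: "base_perm r s a z \<circ> wreathing_perm r s a \<tau> = base_perm r s a z' \<circ> wreathing_perm r s a \<tau>'"
    and w: "w = (\<Prod>l<s. \<zeta> (z' l))" by blast
  have "z m = z' m" if m: "m < s" for m
  proof -
    obtain l where l: "l < s" "m = \<tau> l"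
      using permutes_image[OF \<tau>] m by (auto simp: image_def set_eq_iff)
    have l': "\<tau>' l < s" using permutes_in_image[OF \<tau>', of l] l by simp
    have "a (\<tau> l) (nat ((z (\<tau> l)) mod int r)) = a (\<tau>' l) (nat ((z' (\<tau>' l)) mod int r))"
      using base_wreathing_eq[OF \<tau>, of l 0 z] base_wreathing_eq[OF \<tau>', of l 0 z'] l r eq by simp
    hence "\<tau> l = \<tau>' l" "nat ((z (\<tau> l)) mod int r) = nat ((z' (\<tau>' l)) mod int r)"
      using labelling_inj[of "\<tau> l" _ "\<tau>' l"] shift_less l m l' by auto
    moreover have "0 \<le> z m" "z m < int r" "0 \<le> z' m" "z' m < int r"
      using z z' m by (auto simp: carrier_cyclic)
    ultimately show ?thesis using l by simp
  qed
  thus "w = (\<Prod>l<s. \<zeta> (z l))" unfolding w by (intro prod.cong) auto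
qed

lemma cycles_perm_funpow:
  assumes "l < s" "t < r"
  shows "(cycles_perm r s a ^^ k) (a l t) = a l ((t + k) mod r)"
proof (induction k)
  case (Suc k)
  have "(cycles_perm r s a ^^ Suc k) (a l t) = cycles_perm r s a (a l ((t + k) mod r))"
    using Suc by simp
  also have "\<dots> = a l (nat ((int ((t + k) mod r) + 1) mod int r))"
    using assms r by (simp add: cycles_perm_def base_perm_eq)
  also have "nat ((int ((t + k) mod r) + 1) mod int r) = (t + Suc k) mod r"
    by (metis Suc_eq_plus1 add_Suc_right mod_Suc_eq nat_int of_nat_1 of_nat_add of_nat_mod)
  finally show ?case .
qed (use assms in auto)

lemma centralizer_decompose:
  assumes g: "g \<in> centralizer (sym_group (r * s)) (cycles_perm r s a)"
  obtains z \<tau> where "\<forall>l<s. z l \<in> carrier (integer_mod_group r)" "\<tau> permutes {..<s}"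
    "g = base_perm r s a z \<circ> wreathing_perm r s a \<tau>"
proof -
  let ?\<pi> = "cycles_perm r s a"
  have gp: "g permutes {1..r * s}" and comm: "g \<circ> ?\<pi> = ?\<pi> \<circ> g"
    using g by (auto simp: centralizer_def sym_group_def)
  have pow: "g ((?\<pi> ^^ k) x) = (?\<pi> ^^ k) (g x)" for k x
    using comm by (induction k) (auto simp: fun_eq_iff)
  have "\<exists>m c. m < s \<and> c < r \<and> g (a l 0) = a m c" if "l < s" for l
    using permutes_in_image[OF gp, of "a l 0"] labelling_range[OF that, of 0] r labelling_surj[of "g (a l 0)"]
    by auto metis
  then obtain \<sigma> c where \<sigma>c: "\<And>l. l < s \<Longrightarrow> \<sigma> l < s \<and> c l < r \<and> g (a l 0) = a (\<sigma> l) (c l)"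
    by metis
  have ga: "g (a l t) = a (\<sigma> l) ((c l + t) mod r)" if "l < s" "t < r" for l t
    using pow[of t "a l 0"] cycles_perm_funpow[of l 0 t] cycles_perm_funpow[of "\<sigma> l" "c l" t]
      \<sigma>c[of l] that r by simp
  have "inj_on \<sigma> {..<s}"
  proof
    fix l l' assume l: "l \<in> {..<s}" "l' \<in> {..<s}" and e: "\<sigma> l = \<sigma> l'"
    define t where "t = (c l' + (r - c l)) mod r"
    have "t < r" using r by (simp add: t_def)
    have "(c l + t) mod r = (c l + (c l' + (r - c l))) mod r"
      unfolding t_def by (rule mod_add_right_eq)
    also have "c l + (c l' + (r - c l)) = c l' + r" using \<sigma>c[of l] l by simp
    finally have "(c l + t) mod r = c l'" using \<sigma>c[of l'] l by simp
    hence "g (a l t) = g (a l' 0)" using ga[of l t] \<open>t < r\<close> l e \<sigma>c[of l'] by simp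
    hence "a l t = a l' 0" using permutes_inj[OF gp] by (auto dest: injD)
    thus "l = l'" using labelling_inj[of l t l' 0] l \<open>t < r\<close> r by simp
  qed
  moreover have "\<sigma> ` {..<s} \<subseteq> {..<s}" using \<sigma>c by auto
  ultimately have bij: "bij_betw \<sigma> {..<s} {..<s}"
    by (simp add: bij_betw_def endo_inj_surj)
  define \<tau> where "\<tau> l = (if l \<in> {..<s} then \<sigma> l else l)" for l
  have \<tau>: "\<tau> permutes {..<s}"
  proof (rule bij_imp_permutes)
    have "bij_betw \<tau> {..<s} {..<s} = bij_betw \<sigma> {..<s} {..<s}"
      by (rule bij_betw_cong) (simp add: \<tau>_def)
    thus "bij_betw \<tau> {..<s} {..<s}" using bij by simp
  qed (simp add: \<tau>_def)
  define z where "z m = int (c (inv_into UNIV \<tau> m))" for m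
  have z\<tau>: "z (\<tau> l) = int (c l)" for l
    using permutes_inj[OF \<tau>] by (simp add: z_def)
  have "g x = (base_perm r s a z \<circ> wreathing_perm r s a \<tau>) x" for x
  proof (cases "x \<in> {1..r * s}")
    case True
    then obtain l t where "l < s" "t < r" "x = a l t" by (rule labelling_surj)
    moreover have "nat ((int t + int (c l)) mod int r) = (c l + t) mod r"
      by (metis add.commute nat_int of_nat_add of_nat_mod)
    ultimately show ?thesis using ga[of l t] base_wreathing_eq[OF \<tau>, of l t z] z\<tau>[of l]
      by (simp add: \<tau>_def)
  next
    case False
    thus ?thesis using base_wreathing_outside[of x] gp by (simp add: permutes_not_in)
  qed
  moreover have "z m \<in> carrier (integer_mod_group r)" if "m < s" for m
  proof -
    have "inv_into UNIV \<tau> m < s" using permutes_in_image[OF permutes_inv[OF \<tau>], of m] that by simp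
    thus ?thesis using \<sigma>c by (simp add: z_def carrier_cyclic)
  qed
  ultimately show ?thesis using that[of z \<tau>] \<tau> by (simp add: fun_eq_iff)
qed

lemma wreath_character_mult:
  assumes \<zeta>: "faithful_linear_character r \<zeta>"
    and g: "g \<in> centralizer (sym_group (r * s)) (cycles_perm r s a)"
    and h: "h \<in> centralizer (sym_group (r * s)) (cycles_perm r s a)"
  shows "wreath_character r s a \<zeta> (g \<circ> h) = wreath_character r s a \<zeta> g * wreath_character r s a \<zeta> h"
proof -
  obtain z \<tau> where z: "\<forall>l<s. z l \<in> carrier (integer_mod_group r)" and \<tau>: "\<tau> permutes {..<s}"
    and g: "g = base_perm r s a z \<circ> wreathing_perm r s a \<tau>" using centralizer_decompose[OF g] .
  obtain z' \<tau>' where z': "\<forall>l<s. z' l \<in> carrier (integer_mod_group r)" and \<tau>': "\<tau>' permutes {..<s}"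
    and h: "h = base_perm r s a z' \<circ> wreathing_perm r s a \<tau>'" using centralizer_decompose[OF h] .
  define y where "y m = (z' (inv_into UNIV \<tau> m) + z m) mod int r" for m
  have y: "\<forall>l<s. y l \<in> carrier (integer_mod_group r)" using r by (simp add: y_def carrier_cyclic)
  have \<tau>\<tau>': "(\<tau> \<circ> \<tau>') permutes {..<s}" using \<tau> \<tau>' by (simp add: permutes_compose)
  have "(g \<circ> h) x = (base_perm r s a y \<circ> wreathing_perm r s a (\<tau> \<circ> \<tau>')) x" for x
  proof (cases "x \<in> {1..r * s}")
    case True
    then obtain l t where lt: "l < s" "t < r" "x = a l t" by (rule labelling_surj)
    have l': "\<tau>' l < s" using permutes_in_image[OF \<tau>', of l] lt by simp
    have "(g \<circ> h) x = g (a (\<tau>' l) (nat ((int t + z' (\<tau>' l)) mod int r)))"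
      using base_wreathing_eq[OF \<tau>' lt(1,2), of z'] by (simp add: h lt(3))
    also have "\<dots> = a (\<tau> (\<tau>' l)) (nat ((int t + z' (\<tau>' l) + z (\<tau> (\<tau>' l))) mod int r))"
      unfolding g base_wreathing_eq[OF \<tau> l' shift_less] using r by (simp add: mod_simps)
    also have "\<dots> = (base_perm r s a y \<circ> wreathing_perm r s a (\<tau> \<circ> \<tau>')) x"
      unfolding lt(3) base_wreathing_eq[OF \<tau>\<tau>' lt(1,2)] using permutes_inj[OF \<tau>]
      by (simp add: y_def mod_simps add.assoc)
    finally show ?thesis .
  next
    case False
    show ?thesis using base_wreathing_outside[OF False] by (simp add: g h)
  qed
  hence gh: "g \<circ> h = base_perm r s a y \<circ> wreathing_perm r s a (\<tau> \<circ> \<tau>')" by blast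
  have hom: "\<zeta> ((u + v) mod int r) = \<zeta> u * \<zeta> v"
    if "u \<in> carrier (integer_mod_group r)" "v \<in> carrier (integer_mod_group r)" for u v
    using hom_mult[of \<zeta> "integer_mod_group r" complex_units u v] \<zeta> that r
    by (simp add: faithful_linear_character_def complex_units_def mult_integer_mod_group)
  have inv_less: "inv_into UNIV \<tau> m < s" if "m < s" for m
    using permutes_in_image[OF permutes_inv[OF \<tau>], of m] that by simp
  have "(\<Prod>l<s. \<zeta> (y l)) = (\<Prod>l<s. \<zeta> (z' (inv_into UNIV \<tau> l)) * \<zeta> (z l))"
    by (rule prod.cong) (auto simp: y_def hom z z' inv_less)
  also have "\<dots> = (\<Prod>l<s. \<zeta> (z' (inv_into UNIV \<tau> l))) * (\<Prod>l<s. \<zeta> (z l))"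
    by (rule prod.distrib)
  also have "(\<Prod>l<s. \<zeta> (z' (inv_into UNIV \<tau> l))) = (\<Prod>l<s. \<zeta> (z' l))"
    using prod.permute[OF permutes_inv[OF \<tau>], of "\<lambda>l. \<zeta> (z' l)"] by (simp add: comp_def)
  finally show ?thesis
    unfolding gh wreath_character_eq[OF y \<tau>\<tau>'] unfolding g h
    unfolding wreath_character_eq[OF z \<tau>] wreath_character_eq[OF z' \<tau>'] by simp
qed

end

definition higher_lie_character ::
    "nat \<Rightarrow> nat \<Rightarrow> (nat \<Rightarrow> nat \<Rightarrow> nat) \<Rightarrow> (int \<Rightarrow> complex) \<Rightarrow> (nat \<Rightarrow> nat) \<Rightarrow> complex" where
  "higher_lie_character r s a \<zeta> =
     induced_character (sym_group (r * s)) (centralizer (sym_group (r * s)) (cycles_perm r s a))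
       (wreath_character r s a \<zeta>)"


section \<open>Hook multiplicities and their generating functions\<close>

definition hook_mult ::
    "nat \<Rightarrow> nat \<Rightarrow> (nat \<Rightarrow> nat \<Rightarrow> nat) \<Rightarrow> (int \<Rightarrow> complex) \<Rightarrow> nat \<Rightarrow> complex" where
  "hook_mult r s a \<zeta> i =
     (if i < r * s
      then char_inner (sym_group (r * s)) (higher_lie_character r s a \<zeta>) (irr_char (hook (r * s) i))
      else 0)"

definition hook_poly ::
    "nat \<Rightarrow> nat \<Rightarrow> (nat \<Rightarrow> nat \<Rightarrow> nat) \<Rightarrow> (int \<Rightarrow> complex) \<Rightarrow> complex poly" where
  "hook_poly r s a \<zeta> = (\<Sum>i\<le>r * s. monom (hook_mult r s a \<zeta> i) i)"

text \<open>
  Power series in \<open>x\<close> and \<open>y\<close> are power series in \<open>y\<close> whose coefficients are power series in \<open>x\<close>.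
\<close>

definition hook_series ::
    "nat \<Rightarrow> (nat \<Rightarrow> nat \<Rightarrow> nat \<Rightarrow> nat) \<Rightarrow> (int \<Rightarrow> complex) \<Rightarrow> complex fps fps" where
  "hook_series r a \<zeta> =
     Abs_fps (\<lambda>s. if s \<ge> 1 then fps_of_poly (hook_poly r s (a s) \<zeta>) else 0)"

end

theory Submission
  imports Defs
begin

text \<open>
  Write \<open>n = r s\<close>. For \<open>g\<close> in \<open>S\<^sub>n\<close>, \<open>(1 + x)\<close> times the sum of \<open>\<chi>\<^bsup>(n-i,1^i)\<^esup>(g) x\<^sup>i\<close> over \<open>i\<close> equals
  \<open>det (1 + x g)\<close>, so by Frobenius reciprocity \<open>(1 + x) N\<^bsub>r,s\<^esub>(x)\<close> is the graded multiplicity of the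
  linear character of the centralizer in the exterior algebra of \<open>\<complex>\<^sup>n\<close>. Diagonalising the base group by
  a discrete Fourier transform in each block identifies this with the coefficient of \<open>y\<^sup>s\<close> in
  \<open>\<Prod>\<^sub>K F\<^bsub>|K|\<^esub>\<close>, where \<open>K\<close> runs over the subsets of \<open>\<int>/r\<close> with sum \<open>-1\<close>, and \<open>F\<^sub>j\<close> is
  \<open>1/(1 - x\<^sup>j y)\<close> for even and \<open>1 + x\<^sup>j y\<close> for odd \<open>j\<close>.

  If \<open>r\<close> is not square-free, take \<open>0 < b < r\<close> divisible by all primes dividing \<open>r\<close>. Multiplying sets of
  size \<open>i\<close> by the unit \<open>1 + i b\<close>, and adding or removing the elements \<open>0\<close> and \<open>-b\<close>, groups the sets \<open>K\<close>
  into quadruples of sizes \<open>j, j+1, j+1, j+2\<close>. The factor of each quadruple is \<open>1 + (1 + x)\<^sup>2 h\<close> with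
  non-negative integer \<open>h\<close>, hence so is the product.

  If \<open>r\<close> is square-free, \<open>N\<^bsub>r,1\<^esub>(-1)\<close> is a non-zero multiple of the sum of the primitive \<open>r\<close>-th roots
  of unity, which is \<open>\<mu>(r) \<noteq> 0\<close>.
\<close>

section \<open>Leibniz determinants over finite index sets\<close>

text \<open>The determinant identity already uses up one factor 1 + x, so divisibility of N by 1 + x
  means divisibility of the y^s coefficient of the product by (1 + x)^2. Hence the form 1 + (1 +
  x)^2 h, which is closed under multiplication and also keeps track of non-negativity. The sum -1
  comes from averaging over the base group: a set K contributes w^(z sum K) and the linear character
  another w^z. The quadruples need a second element besides 0 that can be added without leaving the
  family. Adding -b changes the sum, so the required sum has to move with the size: prescribing -(1
  + i b) at size i does this, and rescaling by 1 + i b leads there from -1. These numbers are units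
  because b is divisible by the primes of r, and such b with 0 < b < r exists only if r has a square
  factor. On the character side, the irreducible characters are traces on Specht modules taken in an
  arbitrarily chosen basis; for hooks the trace is recomputed from the polytabloids with corner
  entry 1, with evaluations at tabloids as dual coordinates.\<close>

definition ldet :: "'b set \<Rightarrow> ('b \<Rightarrow> 'b \<Rightarrow> 'a::comm_ring_1) \<Rightarrow> 'a" where
  "ldet S M = (\<Sum>p | p permutes S. of_int (sign p) * (\<Prod>i\<in>S. M i (p i)))"

lemma ldet_cong:
  assumes "\<And>i j. i \<in> S \<Longrightarrow> j \<in> S \<Longrightarrow> M i j = M' i j"
  shows "ldet S M = ldet S M'"
  unfolding ldet_def
  by (intro sum.cong prod.cong arg_cong2[of _ _ _ _ "(*)"] refl)
    (use assms in \<open>auto simp: permutes_in_image\<close>)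

lemma prod_row:
  assumes "finite S" "k \<in> S"
  shows "(\<Prod>i\<in>S. if i = k then f i else g i) = f k * (\<Prod>i\<in>S - {k}. g i)"
  using assms by (subst prod.remove[of S k]) (auto intro!: arg_cong2[of _ _ _ _ "(*)"] prod.cong)

lemma ldet_row_scale:
  assumes "finite S" "k \<in> S"
  shows "ldet S (\<lambda>i j. if i = k then c * u j else M i j) =
    c * ldet S (\<lambda>i j. if i = k then u j else M i j)"
  unfolding ldet_def sum_distrib_left
  by (intro sum.cong refl) (use assms in \<open>simp add: prod_row mult_ac\<close>)

lemma ldet_row_sum:
  assumes "finite S" "k \<in> S"
  shows "ldet S (\<lambda>i j. if i = k then (\<Sum>m\<in>T. u m j) else M i j) =
    (\<Sum>m\<in>T. ldet S (\<lambda>i j. if i = k then u m j else M i j))"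
proof -
  have "ldet S (\<lambda>i j. if i = k then (\<Sum>m\<in>T. u m j) else M i j) =
    (\<Sum>p | p permutes S. \<Sum>m\<in>T. of_int (sign p) * (\<Prod>i\<in>S. if i = k then u m (p i) else M i (p i)))"
    unfolding ldet_def
    by (intro sum.cong refl)
      (use assms in \<open>simp add: prod_row sum_distrib_left sum_distrib_right mult_ac\<close>)
  thus ?thesis unfolding ldet_def by (subst sum.swap) simp
qed

lemma ldet_permute_rows:
  assumes "finite S" "f permutes S"
  shows "ldet S (\<lambda>i. M (f i)) = of_int (sign f) * ldet S M"
proof -
  have "ldet S (\<lambda>i. M (f i)) =
      (\<Sum>p | p permutes S. of_int (sign (p \<circ> f)) * (\<Prod>i\<in>S. M (f i) ((p \<circ> f) i)))"
    unfolding ldet_def by (rule sum_permutations_compose_right[OF assms(2)])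
  also have "\<dots> = (\<Sum>p | p permutes S. of_int (sign f) * (of_int (sign p) * (\<Prod>i\<in>S. M i (p i))))"
  proof (intro sum.cong refl)
    fix p assume "p \<in> {p. p permutes S}"
    hence "sign (p \<circ> f) = sign p * sign f"
      using assms by (auto intro!: sign_compose permutes_imp_permutation)
    moreover have "(\<Prod>i\<in>S. M (f i) ((p \<circ> f) i)) = (\<Prod>i\<in>S. M i (p i))"
      using prod.permute[OF assms(2), of "\<lambda>i. M i (p i)"] by (simp add: comp_def)
    ultimately show "of_int (sign (p \<circ> f)) * (\<Prod>i\<in>S. M (f i) ((p \<circ> f) i)) =
        of_int (sign f) * (of_int (sign p) * (\<Prod>i\<in>S. M i (p i)))"
      by (simp add: mult_ac)
  qed
  finally show ?thesis unfolding ldet_def by (simp add: sum_distrib_left)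
qed

lemma ldet_permute_columns:
  assumes "finite S" "f permutes S"
  shows "ldet S (\<lambda>i j. M i (f j)) = of_int (sign f) * ldet S M"
proof -
  have "ldet S M = (\<Sum>p | p permutes S. of_int (sign (f \<circ> p)) * (\<Prod>i\<in>S. M i ((f \<circ> p) i)))"
    unfolding ldet_def by (rule setum_permutations_compose_left[OF assms(2)])
  also have "\<dots> = (\<Sum>p | p permutes S. of_int (sign f) * (of_int (sign p) * (\<Prod>i\<in>S. M i (f (p i)))))"
  proof (intro sum.cong refl)
    fix p assume "p \<in> {p. p permutes S}"
    hence "sign (f \<circ> p) = sign f * sign p"
      using assms by (auto intro!: sign_compose permutes_imp_permutation)
    thus "of_int (sign (f \<circ> p)) * (\<Prod>i\<in>S. M i ((f \<circ> p) i)) =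
        of_int (sign f) * (of_int (sign p) * (\<Prod>i\<in>S. M i (f (p i))))"
      by (simp add: mult_ac)
  qed
  also have "\<dots> = of_int (sign f) * ldet S (\<lambda>i j. M i (f j))"
    by (simp add: ldet_def sum_distrib_left)
  finally have "of_int (sign f) * ldet S M = of_int (sign f * sign f) * ldet S (\<lambda>i j. M i (f j))"
    by (simp only: of_int_mult mult.assoc)
  thus ?thesis by simp
qed

text \<open>Swapping the two rows fixes the matrix but negates the determinant; in characteristic 0
  this leaves only 0.\<close>

lemma ldet_equal_rows:
  fixes M :: "'b \<Rightarrow> 'b \<Rightarrow> 'a :: {idom, ring_char_0}"
  assumes "finite S" "i \<in> S" "j \<in> S" "i \<noteq> j" "M i = M j"
  shows "ldet S M = 0"
proof -
  have "(\<lambda>k. M (transpose i j k)) = M"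
    using assms(5) by (auto simp: transpose_def fun_eq_iff)
  hence "ldet S M = - ldet S M"
    using ldet_permute_rows[OF assms(1) permutes_swap_id[OF assms(2,3)], of M] assms(4)
    by (simp add: sign_swap_id)
  thus ?thesis by simp
qed

text \<open>Expanding the product of row sums chooses an intermediate index \<open>f i\<close> for
  every row. A non-injective \<open>f\<close> repeats a row of \<open>B\<close> and contributes 0;
  an injective one is a permutation of \<open>S\<close> and contributes its sign times the
  determinant of \<open>B\<close>.\<close>

lemma ldet_mult:
  fixes A B :: "'b \<Rightarrow> 'b \<Rightarrow> 'a :: {idom, ring_char_0}"
  assumes "finite S"
  shows "ldet S (\<lambda>i j. \<Sum>k\<in>S. A i k * B k j) = ldet S A * ldet S B"
proof -
  have "ldet S (\<lambda>i j. \<Sum>k\<in>S. A i k * B k j) =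
     (\<Sum>p | p permutes S. \<Sum>f\<in>S \<rightarrow>\<^sub>E S. of_int (sign p) * (\<Prod>i\<in>S. A i (f i) * B (f i) (p i)))"
    unfolding ldet_def using assms by (simp add: prod.distrib prod_sum_PiE sum_distrib_left)
  also have "\<dots> = (\<Sum>f\<in>S \<rightarrow>\<^sub>E S. (\<Prod>i\<in>S. A i (f i)) * ldet S (\<lambda>i. B (f i)))"
    unfolding ldet_def by (subst sum.swap) (simp add: prod.distrib sum_distrib_left mult_ac)
  also have "\<dots> = (\<Sum>f | f \<in> S \<rightarrow>\<^sub>E S \<and> inj_on f S. (\<Prod>i\<in>S. A i (f i)) * ldet S (\<lambda>i. B (f i)))"
  proof (intro sum.mono_neutral_right ballI)
    fix f assume "f \<in> (S \<rightarrow>\<^sub>E S) - {f. f \<in> S \<rightarrow>\<^sub>E S \<and> inj_on f S}"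
    then obtain i j where "i \<in> S" "j \<in> S" "i \<noteq> j" "f i = f j" by (auto simp: inj_on_def)
    thus "(\<Prod>i\<in>S. A i (f i)) * ldet S (\<lambda>i. B (f i)) = 0"
      using ldet_equal_rows[OF assms, of i j "\<lambda>i. B (f i)"] by simp
  qed (auto intro: finite_PiE assms)
  also have "\<dots> = (\<Sum>p | p permutes S. (\<Prod>i\<in>S. A i (p i)) * ldet S (\<lambda>i. B (p i)))"
  \<comment> \<open>An extensional map is \<open>undefined\<close> off \<open>S\<close>, a
    permutation is the identity there; \<open>restrict\<close> and \<open>restrict_id\<close>
    convert between the two conventions.\<close>
  proof (rule sum.reindex_bij_witness[where i="\<lambda>p. restrict p S" and j="\<lambda>f. restrict_id f S"])
    fix f assume f: "f \<in> {f. f \<in> S \<rightarrow>\<^sub>E S \<and> inj_on f S}"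
    show "restrict (restrict_id f S) S = f"
      using f by (auto simp: restrict_id_def fun_eq_iff restrict_def PiE_def extensional_def)
    have "bij_betw f S S"
      using f assms endo_inj_surj[of S f] by (auto simp: bij_betw_def)
    thus "restrict_id f S \<in> {p. p permutes S}" by (auto intro: permutes_restrict_id)
    show "(\<Prod>i\<in>S. A i (restrict_id f S i)) * ldet S (\<lambda>i. B (restrict_id f S i)) =
        (\<Prod>i\<in>S. A i (f i)) * ldet S (\<lambda>i. B (f i))"
      by (intro arg_cong2[of _ _ _ _ "(*)"] prod.cong ldet_cong) auto
  next
    fix p assume "p \<in> {p. p permutes S}"
    hence p: "p permutes S" by simp
    show "restrict_id (restrict p S) S = p"
      using p by (auto simp: restrict_id_def fun_eq_iff permutes_not_in)
    show "restrict p S \<in> {f. f \<in> S \<rightarrow>\<^sub>E S \<and> inj_on f S}"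
      using p by (auto simp: permutes_in_image inj_on_restrict_eq permutes_inj_on)
  qed
  also have "\<dots> = (\<Sum>p | p permutes S. of_int (sign p) * (\<Prod>i\<in>S. A i (p i)) * ldet S B)"
    by (intro sum.cong refl) (use assms in \<open>simp add: ldet_permute_rows mult_ac\<close>)
  finally show ?thesis unfolding ldet_def[of S A] by (simp add: sum_distrib_right)
qed

lemma ldet_scalar:
  assumes "finite S"
  shows "ldet S (\<lambda>i j. if i = j then c else 0) = c ^ card S"
proof -
  have "(\<Prod>i\<in>S. if i = p i then c else 0) = (if p = id then c ^ card S else 0)"
    if "p permutes S" for p
  proof (cases "p = id")
    case False
    then obtain i where "p i \<noteq> i" by (auto simp: fun_eq_iff)
    with that have "i \<in> S" by (auto simp: permutes_def)
    thus ?thesis using False \<open>p i \<noteq> i\<close> assms by (auto intro!: prod_zero bexI[of _ i])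
  qed simp
  hence "ldet S (\<lambda>i j. if i = j then c else 0) =
      (\<Sum>p | p permutes S. if p = id then c ^ card S else 0)"
    unfolding ldet_def by (intro sum.cong) auto
  also have "\<dots> = c ^ card S" using assms by (simp add: sum.delta finite_permutations)
  finally show ?thesis .
qed

lemma inv_restrict_id:
  assumes "bij h" "h ` A = A"
  shows "inv' (restrict_id h A) = restrict_id (inv' h) A"
proof (rule inv_unique_comp)
  have inv: "inv' h x \<in> A \<longleftrightarrow> x \<in> A" for x
    using assms by (metis bij_inv_eq_iff image_iff)
  have fwd: "h x \<in> A \<longleftrightarrow> x \<in> A" for x
    using assms by (metis bij_is_inj inj_image_mem_iff)
  show "restrict_id h A \<circ> restrict_id (inv' h) A = id"
    using assms inv by (auto simp: restrict_id_def fun_eq_iff bij_is_surj surj_f_inv_f)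
  show "restrict_id (inv' h) A \<circ> restrict_id h A = id"
    using assms fwd by (auto simp: restrict_id_def fun_eq_iff bij_is_inj)
qed

lemma restrict_id_permutes:
  assumes "h permutes S" "h ` A = A"
  shows "restrict_id h A permutes A"
  using assms by (intro permutes_restrict_id) (auto simp: bij_betw_def permutes_inj_on)

lemma sign_restrict_id_inv:
  assumes "finite S" "h permutes S" "A \<subseteq> S" "h ` A = A"
  shows "sign (restrict_id (inv' h) A) = sign (restrict_id h A)"
proof -
  have "permutation (restrict_id h A)"
    using restrict_id_permutes[OF assms(2,4)] assms by (meson finite_subset permutes_imp_permutation)
  thus ?thesis
    using inv_restrict_id[OF permutes_bij[OF assms(2)] assms(4)] sign_inverse by metis
qed

lemma prod_of_bool:
  "finite S \<Longrightarrow> (\<Prod>i\<in>S. of_bool (P i)) = (of_bool (\<forall>i\<in>S. P i) :: 'a::comm_semiring_1)"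
  by (induction S rule: finite_induct) auto

text \<open>Expansion into principal minors: \<open>A\<close> is the set of rows in which the second
  summand is taken. Only the permutation that is the inverse of \<open>h\<close> on \<open>A\<close>
  and the identity elsewhere survives, and it exists exactly when \<open>h\<close> preserves
  \<open>A\<close>. With all \<open>c i\<close> equal to x this is the graded trace of
  \<open>h\<close> on the exterior algebra.\<close>

lemma ldet_one_plus_monomial:
  assumes S: "finite S" and h: "h permutes S"
  shows "ldet S (\<lambda>i j. of_bool (j = i) + c i * of_bool (h j = i)) =
    (\<Sum>A | A \<subseteq> S \<and> h ` A = A. of_int (sign (restrict_id h A)) * (\<Prod>i\<in>A. c i))"
proof -
  let ?C = "\<lambda>A p. (\<forall>i\<in>A. h (p i) = i) \<and> (\<forall>i\<in>S - A. p i = i)"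
  have C: "{p. p permutes S \<and> ?C A p} = (if h ` A = A then {restrict_id (inv' h) A} else {})"
    if A: "A \<subseteq> S" for A
  proof -
    have *: "h ` A = A \<and> p = restrict_id (inv' h) A" if p: "p permutes S" "?C A p" for p
    proof -
      have "p ` (S - A) = S - A" using p by auto
      moreover have "p ` S = S" using p permutes_image by blast
      ultimately have "p ` A = A"
        using A image_set_diff[OF permutes_inj[OF p(1)], of S A] image_mono[OF A, of p] by auto
      moreover have "h ` p ` A = A" using p by (simp add: image_image)
      ultimately have 1: "h ` A = A" by simp
      have "p x = restrict_id (inv' h) A x" for x
        using p permutes_inv_eq[OF h, of x "p x"] permutes_not_in[OF p(1), of x]
        by (cases "x \<in> A"; cases "x \<in> S") auto
      thus ?thesis using 1 by auto
    qed
    have "restrict_id (inv' h) A permutes S" if hA: "h ` A = A"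
    proof -
      have "bij_betw (inv' h) A A"
        using hA bij_betw_subset[OF permutes_bij[OF h], of A A] permutes_inj[OF h]
          inj_imp_bij_betw_inv[of h A] by simp
      thus ?thesis using A permutes_subset permutes_restrict_id by blast
    qed
    moreover have "?C A (restrict_id (inv' h) A)"
      using permutes_inverses[OF h] by auto
    ultimately have "p permutes S \<and> ?C A p \<longleftrightarrow> h ` A = A \<and> p = restrict_id (inv' h) A" for p
      using *[of p] by blast
    thus ?thesis by (simp split: if_split)
  qed
  have "ldet S (\<lambda>i j. of_bool (j = i) + c i * of_bool (h j = i)) =
    (\<Sum>p | p permutes S. of_int (sign p) *
       (\<Sum>A\<in>Pow S. (\<Prod>i\<in>A. c i * of_bool (h (p i) = i)) * (\<Prod>i\<in>S - A. of_bool (p i = i))))"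
    unfolding ldet_def
    by (intro sum.cong arg_cong2[of _ _ _ _ "(*)"] refl trans[OF _ prod_add[OF S]])
      (simp add: add.commute)
  also have "\<dots> = (\<Sum>A\<in>Pow S. \<Sum>p | p permutes S.
      if ?C A p then of_int (sign p) * (\<Prod>i\<in>A. c i) else 0)"
    unfolding sum_distrib_left
    by (subst sum.swap, intro sum.cong refl)
      (use S in \<open>auto simp: prod.distrib prod_of_bool finite_subset\<close>)
  also have "\<dots> = (\<Sum>A\<in>Pow S. \<Sum>p | p permutes S \<and> ?C A p. of_int (sign p) * (\<Prod>i\<in>A. c i))"
    by (rule sum.cong[OF refl], subst sum.inter_filter[symmetric]) (use S in \<open>auto simp: finite_permutations\<close>)
  also have "\<dots> = (\<Sum>A\<in>Pow S. if h ` A = A then of_int (sign (restrict_id h A)) * (\<Prod>i\<in>A. c i) else 0)"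
    by (rule sum.cong[OF refl]) (use C sign_restrict_id_inv[OF S h] in auto)
  also have "\<dots> = (\<Sum>A | A \<subseteq> S \<and> h ` A = A. of_int (sign (restrict_id h A)) * (\<Prod>i\<in>A. c i))"
    by (subst sum.inter_filter[symmetric]) (use S in \<open>auto simp: Pow_def\<close>)
  finally show ?thesis .
qed

section \<open>Hook characters\<close>

lemma sum_fun_apply: "(\<Sum>i\<in>I. f i) x = (\<Sum>i\<in>I. f i x)"
  by (induction I rule: infinite_finite_induct) auto

text \<open>Evaluation at the points \<open>p i\<close> reads off coordinates with respect to the
  \<open>e i\<close>. Expanding \<open>f b\<close> in the \<open>e i\<close> and exchanging the sums
  moves the trace from the unknown basis chosen in \<open>trace_on\<close> to this explicit
  family.\<close>

lemma trace_on_dual_family: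
  assumes I: "finite I" and V: "V = fun_space.span (e ` I)"
    and coord: "\<And>v. v \<in> V \<Longrightarrow> v = (\<Sum>i\<in>I. fun_scale (v (p i)) (e i))"
    and f: "Vector_Spaces.linear fun_scale fun_scale f" and fV: "\<And>v. v \<in> V \<Longrightarrow> f v \<in> V"
  shows "trace_on V f = (\<Sum>i\<in>I. f (e i) (p i))"
proof -
  interpret f: Vector_Spaces.linear fun_scale fun_scale f by (rule f)
  define B where "B = (SOME B. fun_space.independent B \<and> fun_space.span B = V)"
  \<comment> \<open>The choice made by \<open>trace_on\<close> has the intended properties only once
    some basis is known to exist.\<close>
  obtain B0 where "B0 \<subseteq> V" "fun_space.independent B0" "V \<subseteq> fun_space.span B0"
    using fun_space.basis_exists by metis
  hence "fun_space.independent B0 \<and> fun_space.span B0 = V"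
    using V fun_space.span_minimal fun_space.subspace_span by blast
  hence B: "fun_space.independent B" "fun_space.span B = V"
    unfolding B_def by (metis (mono_tags, lifting) someI)+
  have BV: "b \<in> V" if "b \<in> B" for b using B(2) fun_space.span_base that by blast
  have finB: "finite B"
    using fun_space.independent_span_bound[of "e ` I" B] I B V fun_space.span_superset by auto
  have eV: "e i \<in> V" if "i \<in> I" for i using V fun_space.span_base that by blast
  let ?R = "fun_space.representation B"
  have "?R (f b) b = (\<Sum>i\<in>I. f b (p i) * ?R (e i) b)" if b: "b \<in> B" for b
  proof -
    have "?R (f b) b = ?R (\<Sum>i\<in>I. fun_scale (f b (p i)) (e i)) b"
      using coord[OF fV[OF BV[OF b]]] by simp
    also have "\<dots> = (\<Sum>i\<in>I. ?R (fun_scale (f b (p i)) (e i)) b)"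
      using B eV by (subst fun_space.representation_sum) (auto intro: fun_space.span_scale)
    also have "\<dots> = (\<Sum>i\<in>I. f b (p i) * ?R (e i) b)"
      using B eV by (intro sum.cong refl, subst fun_space.representation_scale) auto
    finally show ?thesis .
  qed
  hence "trace_on V f = (\<Sum>b\<in>B. \<Sum>i\<in>I. f b (p i) * ?R (e i) b)"
    unfolding trace_on_def B_def[symmetric] Let_def by (intro sum.cong) auto
  also have "\<dots> = (\<Sum>i\<in>I. \<Sum>b\<in>B. f b (p i) * ?R (e i) b)" by (rule sum.swap)
  also have "\<dots> = (\<Sum>i\<in>I. f (e i) (p i))"
  proof (intro sum.cong refl)
    fix i assume i: "i \<in> I"
    have "e i = (\<Sum>b\<in>B. fun_scale (?R (e i) b) b)"
      using fun_space.sum_representation_eq[OF B(1), of "e i" B] eV[OF i] B(2) finB by auto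
    hence "f (e i) = (\<Sum>b\<in>B. fun_scale (?R (e i) b) (f b))"
      by (metis (mono_tags, lifting) f.scale f.sum sum.cong)
    thus "(\<Sum>b\<in>B. f b (p i) * ?R (e i) b) = f (e i) (p i)"
      by (simp add: sum_fun_apply fun_scale_def mult.commute)
  qed
  finally show ?thesis .
qed

section \<open>Tabloids and polytabloids of hook shape\<close>

lemma tabloid_action_linear: "Vector_Spaces.linear fun_scale fun_scale (tabloid_action g)"
  by unfold_locales (auto simp: tabloid_action_def fun_scale_def fun_eq_iff algebra_simps)

text \<open>A tabloid of hook shape is determined by the entries \<open>b 1, ..., b i\<close> of its
  leg; row 0 is the complement. The formula is also applied to non-injective \<open>b\<close>, where
  the resulting sequence of rows is not a tabloid.\<close>

definition hook_tabloid :: "nat \<Rightarrow> nat \<Rightarrow> (nat \<Rightarrow> nat) \<Rightarrow> nat \<Rightarrow> nat set" where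
  "hook_tabloid n i b k = (if k = 0 then {1..n} - b ` {1..i} else if k \<le> i then {b k} else {})"

text \<open>This is the coefficient, at the tabloid with leg \<open>b\<close>, of the polytabloid
  whose first column is \<open>c 0, ..., c i\<close>. The image of the corner entry
  \<open>c 0\<close> is unconstrained, since it lies in the first row.\<close>

definition column_poly :: "nat \<Rightarrow> (nat \<Rightarrow> nat) \<Rightarrow> (nat \<Rightarrow> nat) \<Rightarrow> complex" where
  "column_poly i c b =
     (\<Sum>q | q permutes c ` {..i}. if \<forall>k\<in>{1..i}. q (c k) = b k then of_int (sign q) else 0)"

lemma hook_tabloid_eq_iff:
  "hook_tabloid n i b = hook_tabloid n i b' \<longleftrightarrow> (\<forall>k\<in>{1..i}. b k = b' k)"
proof
  assume eq: "hook_tabloid n i b = hook_tabloid n i b'"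
  show "\<forall>k\<in>{1..i}. b k = b' k"
  proof
    fix k assume "k \<in> {1..i}"
    thus "b k = b' k" using fun_cong[OF eq, of k] by (simp add: hook_tabloid_def)
  qed
next
  assume "\<forall>k\<in>{1..i}. b k = b' k"
  thus "hook_tabloid n i b = hook_tabloid n i b'"
    by (auto simp: hook_tabloid_def fun_eq_iff)
qed

lemma nth_hook: "k < Suc i \<Longrightarrow> hook n i ! k = (if k = 0 then n - i else 1)"
  by (cases k) (auto simp: hook_def)

lemma cells_hook: "cells (hook n i) = {(0, j) |j. j < n - i} \<union> {(k, 0) |k. k \<in> {1..i}}"
proof -
  have "length (hook n i) = Suc i" by (simp add: hook_def)
  thus ?thesis by (auto simp: cells_def nth_hook split: if_splits)
qed

lemma sum_list_hook: "i < n \<Longrightarrow> sum_list (hook n i) = n"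
  by (simp add: hook_def sum_list_replicate)

context
  fixes n i :: nat
  assumes i: "i < n"
begin

lemma hook_tableau_column:
  assumes "is_tableau (hook n i) t"
  shows "inj_on (\<lambda>k. t (k, 0)) {..i}" "(\<lambda>k. t (k, 0)) ` {..i} \<subseteq> {1..n}"
    "column_of (hook n i) t 0 = (\<lambda>k. t (k, 0)) ` {..i}"
proof -
  have t: "inj_on t (cells (hook n i))" "t ` cells (hook n i) = {1..n}"
    using assms i by (auto simp: is_tableau_def bij_betw_def sum_list_hook)
  have mem: "(k, 0) \<in> cells (hook n i)" if "k \<le> i" for k using that i by (auto simp: cells_hook)
  show "inj_on (\<lambda>k. t (k, 0)) {..i}"
    using t(1) mem by (auto simp: inj_on_def)
  show "(\<lambda>k. t (k, 0)) ` {..i} \<subseteq> {1..n}" using mem t(2) by blast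
  have "{c \<in> cells (hook n i). snd c = 0} = (\<lambda>k. (k, 0)) ` {..i}"
    using i by (auto simp: cells_hook image_def)
  thus "column_of (hook n i) t 0 = (\<lambda>k. t (k, 0)) ` {..i}"
    by (simp add: column_of_def image_image)
qed

text \<open>Beyond the first, every column of a hook has at most one cell, so a column-preserving
  permutation fixes all entries outside the first column.\<close>

lemma hook_column_stabilizer:
  assumes t: "is_tableau (hook n i) t"
  shows "column_stabilizer (hook n i) t = {q. q permutes (\<lambda>k. t (k, 0)) ` {..i}}"
proof -
  let ?c = "(\<lambda>k. t (k, 0)) ` {..i}"
  have col: "column_of (hook n i) t j = (if j < n - i then {t (0, j)} else {})" if "j > 0" for j
    using that i by (auto simp: column_of_def cells_hook)
  have im: "t ` cells (hook n i) = {1..n}"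
    using t i by (auto simp: is_tableau_def bij_betw_def sum_list_hook)
  have inj: "inj_on t (cells (hook n i))"
    using t by (auto simp: is_tableau_def bij_betw_def)
  have "q permutes ?c" if q: "q permutes {1..n}"
    and st: "\<And>j. q ` column_of (hook n i) t j = column_of (hook n i) t j" for q
  proof -
    have "q x = x" if "x \<in> {1..n}" "x \<notin> ?c" for x
    proof -
      obtain k j where "(k, j) \<in> cells (hook n i)" "x = t (k, j)" using im \<open>x \<in> {1..n}\<close> by force
      moreover have "j \<noteq> 0" using calculation \<open>x \<notin> ?c\<close> i by (auto simp: cells_hook)
      ultimately show ?thesis using st[of j] col[of j] by (auto simp: cells_hook)
    qed
    thus ?thesis by (intro permutes_superset[OF q]) auto
  qed
  moreover have "q permutes {1..n}" "q ` column_of (hook n i) t j = column_of (hook n i) t j"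
    if q: "q permutes ?c" for q j
  proof -
    show "q permutes {1..n}" using q hook_tableau_column(2)[OF t] by (rule permutes_subset)
    show "q ` column_of (hook n i) t j = column_of (hook n i) t j"
    proof (cases "j = 0")
      case True
      thus ?thesis using hook_tableau_column(3)[OF t] permutes_image[OF q] by simp
    next
      case False
      have "t (0, j) \<notin> ?c" if "j < n - i"
      proof
        assume "t (0, j) \<in> ?c"
        then obtain k where "k \<le> i" "t (0, j) = t (k, 0)" by auto
        moreover have "(k, 0) \<in> cells (hook n i)" "(0, j) \<in> cells (hook n i)"
          using \<open>k \<le> i\<close> that i by (auto simp: cells_hook)
        ultimately show False using inj False by (auto simp: inj_on_def)
      qed
      thus ?thesis using False col[of j] permutes_not_in[OF q] by auto
    qed
  qed
  ultimately show ?thesis unfolding column_stabilizer_def sum_list_hook[OF i] by blast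
qed

lemma hook_row_of:
  assumes t: "is_tableau (hook n i) t"
  shows "row_of (hook n i) t = hook_tabloid n i (\<lambda>k. t (k, 0))"
proof
  fix k
  have im: "t ` cells (hook n i) = {1..n}" and inj: "inj_on t (cells (hook n i))"
    using t i by (auto simp: is_tableau_def bij_betw_def sum_list_hook)
  show "row_of (hook n i) t k = hook_tabloid n i (\<lambda>k. t (k, 0)) k"
  proof (cases "k = 0")
    case True
    have "{c \<in> cells (hook n i). fst c = 0} = cells (hook n i) - (\<lambda>k. (k, 0)) ` {1..i}"
      by (auto simp: cells_hook)
    moreover have "(\<lambda>k. (k, 0)) ` {1..i} \<subseteq> cells (hook n i)" by (auto simp: cells_hook)
    ultimately have "row_of (hook n i) t 0 = t ` cells (hook n i) - t ` (\<lambda>k. (k, 0)) ` {1..i}"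
      unfolding row_of_def using inj_on_image_set_diff[OF inj] by (metis Diff_subset)
    thus ?thesis using True im by (simp add: hook_tabloid_def image_image)
  next
    case False
    hence "{c \<in> cells (hook n i). fst c = k} = (if k \<le> i then {(k, 0)} else {})"
      by (auto simp: cells_hook)
    thus ?thesis using False by (auto simp: row_of_def hook_tabloid_def)
  qed
qed

lemma is_tableau_compose:
  assumes "is_tableau (hook n i) t" "g permutes {1..n}"
  shows "is_tableau (hook n i) (g \<circ> t)"
  using bij_betw_trans[OF _ permutes_imp_bij[OF assms(2)]] assms(1) i
  by (simp add: is_tableau_def sum_list_hook)

text \<open>A hook tabloid is known from its leg, so the coefficient only records how column
  permutations move the leg. Permuted tableaux are again tableaux, which confines the support to
  legs with distinct entries in \<open>{1..n}\<close>.\<close>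

lemma polytabloid_hook:
  assumes t: "is_tableau (hook n i) t"
  shows "polytabloid (hook n i) t (hook_tabloid n i b) = column_poly i (\<lambda>k. t (k, 0)) b"
    and "(\<And>b. inj_on b {1..i} \<Longrightarrow> b ` {1..i} \<subseteq> {1..n} \<Longrightarrow> T \<noteq> hook_tabloid n i b) \<Longrightarrow>
      polytabloid (hook n i) t T = 0"
proof -
  have row: "row_of (hook n i) (q \<circ> t) = hook_tabloid n i (\<lambda>k. q (t (k, 0)))"
    if "q \<in> column_stabilizer (hook n i) t" for q
    using that hook_row_of[OF is_tableau_compose[OF t, of q]] i
    by (simp add: column_stabilizer_def sum_list_hook)
  show "polytabloid (hook n i) t (hook_tabloid n i b) = column_poly i (\<lambda>k. t (k, 0)) b"
    unfolding polytabloid_def column_poly_def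
    by (rule sum.cong) (auto simp: hook_column_stabilizer[OF t] row hook_tabloid_eq_iff)
  assume T: "\<And>b. inj_on b {1..i} \<Longrightarrow> b ` {1..i} \<subseteq> {1..n} \<Longrightarrow> T \<noteq> hook_tabloid n i b"
  have "row_of (hook n i) (q \<circ> t) \<noteq> T" if q: "q \<in> column_stabilizer (hook n i) t" for q
  proof -
    have "is_tableau (hook n i) (q \<circ> t)"
      using q i is_tableau_compose[OF t] by (simp add: column_stabilizer_def sum_list_hook)
    from hook_tableau_column(1,2)[OF this]
    have "inj_on (\<lambda>k. q (t (k, 0))) {1..i}" "(\<lambda>k. q (t (k, 0))) ` {1..i} \<subseteq> {1..n}"
      by (auto simp: inj_on_def)
    from T[OF this] show ?thesis using row[OF q] by simp
  qed
  thus "polytabloid (hook n i) t T = 0" unfolding polytabloid_def by (intro sum.neutral) auto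
qed

lemma ex_tableau_with_column:
  assumes c: "inj_on c {..i}" "c ` {..i} \<subseteq> {1..n}"
  obtains t where "is_tableau (hook n i) t" "\<And>k. k \<le> i \<Longrightarrow> t (k, 0) = c k"
proof -
  have "card {1..<n - i} = card ({1..n} - c ` {..i})"
    using c i by (simp add: card_Diff_subset card_image)
  then obtain f where f: "bij_betw f {1..<n - i} ({1..n} - c ` {..i})"
    using finite_same_card_bij[of "{1..<n - i}" "{1..n} - c ` {..i}"] by auto
  define t where "t = (\<lambda>(k, j). if j = 0 then c k else f j)"
  have "bij_betw t ((\<lambda>k. (k, 0)) ` {..i} \<union> (\<lambda>j. (0, j)) ` {1..<n - i})
      (c ` {..i} \<union> ({1..n} - c ` {..i}))"
  proof (rule bij_betw_combine)
    show "bij_betw t ((\<lambda>k. (k, 0)) ` {..i}) (c ` {..i})"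
      using c by (auto simp: bij_betw_def inj_on_def t_def image_image)
    have "t ` (\<lambda>j. (0, j)) ` {1..<n - i} = f ` {1..<n - i}"
      unfolding image_image by (rule image_cong) (auto simp: t_def)
    thus "bij_betw t ((\<lambda>j. (0, j)) ` {1..<n - i}) ({1..n} - c ` {..i})"
      using f by (auto simp: bij_betw_def inj_on_def t_def)
  qed auto
  moreover have "(\<lambda>k. (k, 0)) ` {..i} \<union> (\<lambda>j. (0, j)) ` {1..<n - i} = cells (hook n i)"
    using i by (auto simp: cells_hook image_def)
  moreover have "c ` {..i} \<union> ({1..n} - c ` {..i}) = {1..n}" using c by auto
  ultimately have "is_tableau (hook n i) t" using i by (simp add: is_tableau_def sum_list_hook)
  thus ?thesis by (rule that) (simp add: t_def)
qed

end

lemma column_poly_cong: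
  assumes "\<And>k. k \<le> i \<Longrightarrow> c k = c' k" "\<And>k. k \<in> {1..i} \<Longrightarrow> b k = b' k"
  shows "column_poly i c b = column_poly i c' b'"
proof -
  have "c ` {..i} = c' ` {..i}" using assms(1) by (intro image_cong) auto
  thus ?thesis unfolding column_poly_def
    by (intro sum.cong) (use assms in auto)
qed

text \<open>If the leg lies in the column, \<open>p\<close> acts inside the column group and
  \<open>q\<close> is replaced by \<open>p\<close> after \<open>q\<close>. Otherwise no column
  permutation reaches the leg and both sides vanish.\<close>

lemma column_poly_permute:
  assumes p: "p permutes b ` {1..i}"
  shows "column_poly i c (p \<circ> b) = of_int (sign p) * column_poly i c b"
proof (cases "b ` {1..i} \<subseteq> c ` {..i}")
  case True
  hence p': "p permutes c ` {..i}" using p permutes_subset by blast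
  have "column_poly i c (p \<circ> b) = (\<Sum>q | q permutes c ` {..i}.
      if \<forall>k\<in>{1..i}. (p \<circ> q) (c k) = (p \<circ> b) k then of_int (sign (p \<circ> q)) else 0)"
    unfolding column_poly_def by (rule setum_permutations_compose_left[OF p'])
  also have "\<dots> = (\<Sum>q | q permutes c ` {..i}.
      of_int (sign p) * (if \<forall>k\<in>{1..i}. q (c k) = b k then of_int (sign q) else 0))"
  proof (intro sum.cong refl)
    fix q assume "q \<in> {q. q permutes c ` {..i}}"
    hence "sign (p \<circ> q) = sign p * sign q"
      using p' by (auto intro!: sign_compose permutes_imp_permutation[of "c ` {..i}"])
    moreover have "p x = p y \<longleftrightarrow> x = y" for x y using permutes_inj[OF p'] by (auto dest: injD)
    ultimately show "(if \<forall>k\<in>{1..i}. (p \<circ> q) (c k) = (p \<circ> b) k then of_int (sign (p \<circ> q)) else 0) =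
      (of_int (sign p) * (if \<forall>k\<in>{1..i}. q (c k) = b k then of_int (sign q) else 0) :: complex)"
      by auto
  qed
  finally show ?thesis by (simp add: column_poly_def sum_distrib_left)
next
  case False
  have *: "column_poly i c b' = 0" if "b' ` {1..i} = b ` {1..i}" for b'
  proof -
    have "\<not> (\<forall>k\<in>{1..i}. q (c k) = b' k)" if q: "q permutes c ` {..i}" for q
    proof
      assume "\<forall>k\<in>{1..i}. q (c k) = b' k"
      hence "b' ` {1..i} = q ` c ` {1..i}" by (force simp: image_image)
      also have "\<dots> \<subseteq> q ` c ` {..i}" by (intro image_mono) auto
      finally show False using permutes_image[OF q] False \<open>b' ` {1..i} = b ` {1..i}\<close> by simp
    qed
    thus ?thesis unfolding column_poly_def by (intro sum.neutral) auto
  qed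
  show ?thesis using *[of b] *[of "p \<circ> b"] permutes_image[OF p] by (simp add: image_image)
qed

text \<open>The sum over all fillings of one row vanishes because the transposition of \<open>c 0\<close> and \<open>c 1\<close>
  pairs off its terms.\<close>

lemma column_poly_contract:
  assumes c: "inj_on c {..i}" "c ` {..i} \<subseteq> {1..n}" and i: "i \<ge> 1"
  shows "(\<Sum>x=1..n. column_poly i c (b(1 := x))) = 0"
proof -
  let ?P = "{q. q permutes c ` {..i}}" and ?t = "transpose (c 0) (c 1)"
  let ?g = "\<lambda>q. if \<forall>k\<in>{2..i}. q (c k) = b k then of_int (sign q) else 0 :: complex"
  have "(\<Sum>x=1..n. column_poly i c (b(1 := x))) = (\<Sum>q\<in>?P. \<Sum>x=1..n.
      if \<forall>k\<in>{1..i}. q (c k) = (b(1 := x)) k then of_int (sign q) else 0)"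
    unfolding column_poly_def by (rule sum.swap)
  also have "\<dots> = (\<Sum>q\<in>?P. \<Sum>x=1..n. if q (c 1) = x then ?g q else 0)"
  proof (intro sum.cong refl)
    fix q x
    have "{1..i} = insert 1 {2..i}" using i by auto
    thus "(if \<forall>k\<in>{1..i}. q (c k) = (b(1 := x)) k then of_int (sign q) else 0) =
      (if q (c 1) = x then ?g q else 0)" by auto
  qed
  also have "\<dots> = (\<Sum>q\<in>?P. ?g q)"
  proof (intro sum.cong refl)
    fix q assume "q \<in> ?P"
    hence "q (c 1) \<in> {1..n}" using c(2) i permutes_in_image[of q "c ` {..i}" "c 1"] by auto
    thus "(\<Sum>x=1..n. if q (c 1) = x then ?g q else 0) = ?g q" by (simp add: sum.delta)
  qed
  finally have 1: "(\<Sum>x=1..n. column_poly i c (b(1 := x))) = (\<Sum>q\<in>?P. ?g q)" .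
  have t: "?t permutes c ` {..i}" using i by (intro permutes_swap_id) auto
  have ne: "c 0 \<noteq> c 1" using c(1) i by (auto simp: inj_on_def)
  have "(\<Sum>q\<in>?P. ?g q) = (\<Sum>q\<in>?P. ?g (q \<circ> ?t))"
    by (rule sum_permutations_compose_right[OF t])
  also have "\<dots> = (\<Sum>q\<in>?P. - ?g q)"
  proof (intro sum.cong refl)
    fix q assume "q \<in> ?P"
    hence "sign (q \<circ> ?t) = - sign q"
      using t ne sign_compose[of q ?t] permutes_imp_permutation[of "c ` {..i}"] by (auto simp: sign_swap_id)
    moreover have "?t (c k) = c k" if "k \<in> {2..i}" for k
    proof -
      have "c k \<noteq> c 0" "c k \<noteq> c 1" using that inj_onD[OF c(1), of k] i by force+
      thus ?thesis by simp
    qed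
    ultimately show "?g (q \<circ> ?t) = - ?g q" by auto
  qed
  finally have "(\<Sum>q\<in>?P. ?g q) = - (\<Sum>q\<in>?P. ?g q)" by (simp add: sum_negf)
  hence "(\<Sum>q\<in>?P. ?g q) = 0" by simp
  thus ?thesis using 1 by simp
qed

lemma ex_permutes_between:
  assumes f: "bij_betw f K B" and g: "bij_betw g K B"
  obtains p where "p permutes B" "\<And>k. k \<in> K \<Longrightarrow> p (f k) = g k"
proof
  have "bij_betw (g \<circ> inv_into K f) B B"
    using bij_betw_inv_into[OF f] g by (rule bij_betw_trans)
  thus "restrict_id (g \<circ> inv_into K f) B permutes B" by (rule permutes_restrict_id)
  show "restrict_id (g \<circ> inv_into K f) B (f k) = g k" if "k \<in> K" for k
    using f that bij_betwE[OF f] by (auto simp: bij_betw_inv_into_left)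
qed

lemma bij_betw_map_permutation:
  assumes "inj_on f A"
  shows "bij_betw (map_permutation A f) {p. p permutes A} {q. q permutes f ` A}"
proof -
  have "map_permutation A f = (\<lambda>p x. if x \<in> f ` A then f (p (inv_into A f x)) else x)"
    by (simp add: map_permutation_def restrict_id_def fun_eq_iff)
  thus ?thesis using bij_betw_permutations[of f A "f ` A"] assms by (simp add: bij_betw_def)
qed

lemma image_fun_upd_0: "(f(0 := x)) ` {..i} = insert x (f ` {1..i})" for i :: nat
proof -
  have "{..i} = insert 0 {1..i}" by auto
  hence "(f(0 := x)) ` {..i} = insert x ((f(0 := x)) ` {1..i})"
    by (simp only: image_insert fun_upd_same)
  also have "(f(0 := x)) ` {1..i} = f ` {1..i}" by (intro image_cong) auto
  finally show ?thesis .
qed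

text \<open>Transport along \<open>g\<close> identifies the column groups of the two columns and
  preserves signs. This is the equivariance of polytabloids at the level of coefficients.\<close>

lemma column_poly_compose:
  assumes g: "bij g"
  shows "column_poly i (g \<circ> c) b = column_poly i c (inv' g \<circ> b)"
proof -
  let ?C = "c ` {..i}"
  have inj: "inj_on g ?C" using g bij_is_inj inj_on_subset by blast
  have "column_poly i (g \<circ> c) b = (\<Sum>q | q permutes g ` ?C.
      if \<forall>k\<in>{1..i}. q (g (c k)) = b k then of_int (sign q) else 0)"
    by (simp add: column_poly_def image_comp)
  also have "\<dots> = (\<Sum>p | p permutes ?C. if \<forall>k\<in>{1..i}. map_permutation ?C g p (g (c k)) = b k
      then of_int (sign (map_permutation ?C g p)) else 0)"
    by (rule sum.reindex_bij_betw[OF bij_betw_map_permutation[OF inj], symmetric])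
  also have "\<dots> = (\<Sum>p | p permutes ?C. if \<forall>k\<in>{1..i}. p (c k) = (inv' g \<circ> b) k
      then of_int (sign p) else 0)"
  proof (intro sum.cong refl)
    fix p assume p: "p \<in> {p. p permutes ?C}"
    have "map_permutation ?C g p (g (c k)) = b k \<longleftrightarrow> p (c k) = (inv' g \<circ> b) k"
      if "k \<in> {1..i}" for k
      using that map_permutation_apply[OF inj, of "c k" p] bij_inv_eq_iff[OF g] by auto
    thus "(if \<forall>k\<in>{1..i}. map_permutation ?C g p (g (c k)) = b k
      then of_int (sign (map_permutation ?C g p)) else 0 :: complex) =
      (if \<forall>k\<in>{1..i}. p (c k) = (inv' g \<circ> b) k then of_int (sign p) else 0)"
      using p sign_map_permutation[OF inj] by simp
  qed
  finally show ?thesis by (simp add: column_poly_def)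
qed

lemma inv_image_hook_tabloid:
  assumes g: "g permutes {1..n}"
  shows "(\<lambda>k. inv' g ` hook_tabloid n i b k) = hook_tabloid n i (inv' g \<circ> b)"
proof -
  have "inv' g ` {1..n} = {1..n}" "inj (inv' g)"
    using permutes_image[OF permutes_inv[OF g]] permutes_inj[OF permutes_inv[OF g]] by auto
  thus ?thesis by (auto simp: hook_tabloid_def fun_eq_iff image_set_diff image_comp)
qed

text \<open>The hook Specht module, characterised inside the space of functions on tabloids: the functions
  antisymmetric in the rows below the first whose sum over the fillings of one such row vanishes.\<close>

definition hook_relations :: "nat \<Rightarrow> nat \<Rightarrow> ((nat \<Rightarrow> nat set) \<Rightarrow> complex) \<Rightarrow> bool" where
  "hook_relations n i v \<longleftrightarrow>
     (\<forall>T. (\<forall>b. inj_on b {1..i} \<longrightarrow> b ` {1..i} \<subseteq> {1..n} \<longrightarrow> T \<noteq> hook_tabloid n i b) \<longrightarrow> v T = 0) \<and>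
     (\<forall>b p. p permutes b ` {1..i} \<longrightarrow>
        v (hook_tabloid n i (p \<circ> b)) = of_int (sign p) * v (hook_tabloid n i b)) \<and>
     (i \<ge> 1 \<longrightarrow> (\<forall>b. (\<Sum>x=1..n. v (hook_tabloid n i (b(1 := x)))) = 0))"

lemma subspace_hook_relations: "fun_space.subspace {v. hook_relations n i v}"
  by (auto simp: fun_space.subspace_def hook_relations_def fun_scale_def algebra_simps sum.distrib
      simp flip: sum_distrib_left)

context
  fixes n i :: nat
  assumes i: "i < n"
begin

lemma specht_hook_relations:
  assumes "v \<in> specht_module (hook n i)"
  shows "hook_relations n i v"
proof -
  have "hook_relations n i (polytabloid (hook n i) t)" if t: "is_tableau (hook n i) t" for t
    unfolding hook_relations_def polytabloid_hook(1)[OF i t]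
    using column_poly_permute polytabloid_hook(2)[OF i t]
      column_poly_contract[OF hook_tableau_column(1,2)[OF i t]] by blast
  thus ?thesis
    using assms fun_space.span_induct[OF _ subspace_hook_relations, of v _ n i]
    unfolding specht_module_def by blast
qed

text \<open>The relations determine a function by its values at legs avoiding 1. Antisymmetry
  reduces such a leg to the chosen ordering \<open>b B\<close> of its entries. If 1 occurs in the
  leg, antisymmetry moves it to position 1, and the vanishing sum over that position expresses the
  value through legs without 1.\<close>

lemma hook_relations_eq_0:
  assumes v: "hook_relations n i v"
    and b: "\<And>B. B \<subseteq> {2..n} \<Longrightarrow> card B = i \<Longrightarrow> bij_betw (b B) {1..i} B"
    and 0: "\<And>B. B \<subseteq> {2..n} \<Longrightarrow> card B = i \<Longrightarrow> v (hook_tabloid n i (b B)) = 0"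
  shows "v = 0"
proof -
  have supp: "v T = 0"
    if "\<And>b. inj_on b {1..i} \<Longrightarrow> b ` {1..i} \<subseteq> {1..n} \<Longrightarrow> T \<noteq> hook_tabloid n i b" for T
    using v that unfolding hook_relations_def by blast
  have perm: "v (hook_tabloid n i (p \<circ> d)) = of_int (sign p) * v (hook_tabloid n i d)"
    if "p permutes d ` {1..i}" for p d
    using v that unfolding hook_relations_def by blast
  \<comment> \<open>Repeated entries have to be covered as well, because the entry summed over later
    may coincide with another leg entry; such a \<open>d\<close> gives no tabloid, so
    \<open>v\<close> vanishes there by its support condition.\<close>
  have Z: "v (hook_tabloid n i d) = 0" if d: "d ` {1..i} \<subseteq> {2..n}" for d
  proof (cases "inj_on d {1..i}")
    case True
    let ?B = "d ` {1..i}"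
    have card: "card ?B = i" using True by (simp add: card_image)
    obtain p where p: "p permutes ?B" "\<And>k. k \<in> {1..i} \<Longrightarrow> p (b ?B k) = d k"
      using ex_permutes_between[OF b[OF d card], of d] True by (auto simp: bij_betw_def)
    have "hook_tabloid n i d = hook_tabloid n i (p \<circ> b ?B)"
      using p(2) by (simp add: hook_tabloid_eq_iff)
    moreover have "b ?B ` {1..i} = ?B" using b[OF d card] by (simp add: bij_betw_def)
    ultimately show ?thesis using perm[of p "b ?B"] p(1) 0[OF d card] by simp
  next
    case False
    hence "hook_tabloid n i d \<noteq> hook_tabloid n i d'" if "inj_on d' {1..i}" for d'
      using that inj_on_cong[of "{1..i}" d d'] unfolding hook_tabloid_eq_iff by blast
    thus ?thesis by (intro supp) auto
  qed
  have "v (hook_tabloid n i d) = 0" if d: "inj_on d {1..i}" "d ` {1..i} \<subseteq> {1..n}" for d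
  proof (cases "1 \<in> d ` {1..i}")
    case False
    have "d ` {1..i} \<subseteq> {2..n}"
    proof
      fix x assume "x \<in> d ` {1..i}"
      hence "x \<in> {1..n}" "x \<noteq> 1" using d False by blast+
      thus "x \<in> {2..n}" by auto
    qed
    thus ?thesis by (rule Z)
  next
    case True
    then obtain k where k: "k \<in> {1..i}" "d k = 1" by force
    hence i1: "i \<ge> 1" by auto
    define p where "p = transpose (d 1) (d k)"
    define d' where "d' = p \<circ> d"
    have p: "p permutes d ` {1..i}"
      unfolding p_def by (intro permutes_swap_id imageI) (use k i1 in auto)
    have d'1: "d' 1 = 1" using k by (simp add: d'_def p_def)
    have d': "inj_on d' {1..i}" "d' ` {1..i} \<subseteq> {1..n}"
      using d p permutes_inj_on[OF p] permutes_image[OF p]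
      by (auto simp: d'_def intro: comp_inj_on simp flip: image_image)
    have "v (hook_tabloid n i (d'(1 := x))) = 0" if x: "x \<in> {1..n} - {1}" for x
    proof (rule Z)
      have "d' j \<in> {2..n}" if "j \<in> {2..i}" for j
      proof -
        have "d' j \<noteq> d' 1" using inj_onD[OF d'(1), of j 1] that by auto
        moreover have "d' j \<in> {1..n}" by (rule subsetD[OF d'(2) imageI]) (use that in auto)
        ultimately show ?thesis using d'1 by auto
      qed
      thus "(d'(1 := x)) ` {1..i} \<subseteq> {2..n}" using x by (auto simp: image_subset_iff)
    qed
    hence "(\<Sum>x\<in>{1..n} - {1}. v (hook_tabloid n i (d'(1 := x)))) = 0" by (intro sum.neutral) auto
    moreover have "(\<Sum>x=1..n. v (hook_tabloid n i (d'(1 := x)))) = 0"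
      using v i1 unfolding hook_relations_def by blast
    ultimately have "v (hook_tabloid n i (d'(1 := 1))) = 0"
      using i sum.remove[of "{1..n}" 1 "\<lambda>x. v (hook_tabloid n i (d'(1 := x)))"] by simp
    moreover have "d'(1 := 1) = d'" using d'1 by auto
    ultimately show ?thesis using perm[OF p] unfolding d'_def by simp
  qed
  hence "v T = 0" for T using supp[of T] by metis
  thus ?thesis by (simp add: fun_eq_iff)
qed

text \<open>A contributing \<open>q\<close> maps \<open>B\<close> onto \<open>B'\<close>, which
  avoids 1 and lies in \<open>insert 1 B\<close>. Equal cardinality forces \<open>B = B'\<close>,
  then \<open>q\<close> fixes \<open>B\<close> pointwise and hence also 1. So the matrix of these
  coefficients is the identity, with no triangularity argument.\<close>

lemma column_poly_dual:
  assumes B: "B \<subseteq> {2..n}" "bij_betw b {1..i} B" and B': "B' \<subseteq> {2..n}" "bij_betw b' {1..i} B'"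
    and eq: "B = B' \<Longrightarrow> b = b'"
  shows "column_poly i (b(0 := 1)) b' = of_bool (B = B')"
proof -
  have im: "(b(0 := 1)) ` {..i} = insert 1 B"
    unfolding image_fun_upd_0 using B by (simp add: bij_betw_def)
  have key: "q = id \<and> B = B'" if q: "q permutes insert 1 B" and qb: "\<forall>k\<in>{1..i}. q ((b(0 := 1)) k) = b' k" for q
  proof -
    have "(\<lambda>k. q (b k)) ` {1..i} = b' ` {1..i}" using qb by (intro image_cong) auto
    hence "B' = q ` B" using B(2) B'(2) by (auto simp: bij_betw_def image_image)
    hence "B' \<subseteq> insert 1 B" using permutes_image[OF q] by blast
    hence "B' \<subseteq> B" using B' by auto
    moreover have "card B' = card B" using B(2) B'(2) by (metis bij_betw_same_card)
    ultimately have "B' = B" using B(1) by (meson card_subset_eq finite_atLeastAtMost finite_subset)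
    moreover have "q x = x" if "x \<in> B" for x
    proof -
      have "x \<in> b ` {1..i}" using B(2) that by (simp add: bij_betw_def)
      then obtain k where "k \<in> {1..i}" "x = b k" by blast
      thus ?thesis using qb eq calculation by auto
    qed
    hence "q permutes {1}" by (intro permutes_superset[OF q]) auto
    ultimately show ?thesis by simp
  qed
  have "(if \<forall>k\<in>{1..i}. q ((b(0 := 1)) k) = b' k then of_int (sign q) else 0) =
      (if q = id then of_bool (B = B') else 0 :: complex)" if q: "q permutes insert 1 B" for q
  proof (cases "\<forall>k\<in>{1..i}. q ((b(0 := 1)) k) = b' k")
    case True
    thus ?thesis using key[OF q True] by simp
  next
    case False
    thus ?thesis using eq by auto
  qed
  hence "column_poly i (b(0 := 1)) b' =
      (\<Sum>q | q permutes insert 1 B. if q = id then of_bool (B = B') else 0)"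
    unfolding column_poly_def im by (intro sum.cong) auto
  moreover have "finite B" using B finite_subset by blast
  ultimately show ?thesis by (simp add: finite_permutations permutes_id)
qed

text \<open>The polytabloids with corner entry 1, one for each leg set \<open>B\<close>, have the
  evaluations at the tabloids with leg \<open>B\<close> as dual coordinates, so the trace is the sum
  of diagonal coefficients. Each inner sum has at most one term, as \<open>q\<close> is the inverse
  of \<open>g\<close> on \<open>B\<close> and 1 takes the value left over.\<close>

lemma irr_char_hook:
  assumes g: "g permutes {1..n}"
  shows "irr_char (hook n i) g = (\<Sum>B | B \<subseteq> {2..n} \<and> card B = i.
    \<Sum>q | q permutes insert 1 B \<and> (\<forall>x\<in>B. g (q x) = x). of_int (sign q))"
proof -
  let ?I = "{B. B \<subseteq> {2..n} \<and> card B = i}" and ?\<mu> = "hook n i"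
  have finI: "finite ?I" by simp
  have "\<exists>b. bij_betw b {1..i} B" if "B \<in> ?I" for B
    using that finite_same_card_bij[of "{1..i}" B] finite_subset[of B "{2..n}"] by auto
  then obtain b where b: "\<And>B. B \<in> ?I \<Longrightarrow> bij_betw (b B) {1..i} B" by metis
  define c where "c B = (b B)(0 := 1)" for B
  have im: "c B ` {..i} = insert 1 B" if "B \<in> ?I" for B
    unfolding c_def image_fun_upd_0 using b[OF that] by (simp add: bij_betw_def)
  have "\<exists>t. is_tableau ?\<mu> t \<and> (\<forall>k\<le>i. t (k, 0) = c B k)" if B: "B \<in> ?I" for B
  proof -
    have "1 \<notin> B" using B by auto
    hence "card (insert 1 B) = Suc i" using B finite_subset[of B "{2..n}"] by auto
    hence "inj_on (c B) {..i}" using im[OF B] by (intro eq_card_imp_inj_on) auto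
    moreover have "c B ` {..i} \<subseteq> {1..n}" using im[OF B] B i by auto
    ultimately show ?thesis by (rule ex_tableau_with_column[OF i]) blast
  qed
  hence "\<exists>t. \<forall>B\<in>?I. is_tableau ?\<mu> (t B) \<and> (\<forall>k\<le>i. t B (k, 0) = c B k)"
    by (intro bchoice ballI)
  then obtain t where t: "\<And>B. B \<in> ?I \<Longrightarrow> is_tableau ?\<mu> (t B)"
    and tc: "\<And>B k. B \<in> ?I \<Longrightarrow> k \<le> i \<Longrightarrow> t B (k, 0) = c B k" by blast
  define e where "e B = polytabloid ?\<mu> (t B)" for B
  define p where "p B = hook_tabloid n i (b B)" for B
  have e_tab: "e B (hook_tabloid n i d) = column_poly i (c B) d" if "B \<in> ?I" for B d
    unfolding e_def polytabloid_hook(1)[OF i t[OF that]]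
    by (rule column_poly_cong) (auto simp: tc[OF that])
  have ep: "e B (p B') = of_bool (B = B')" if "B \<in> ?I" "B' \<in> ?I" for B B'
    unfolding p_def e_tab[OF that(1)] c_def using that b[OF that(1)] b[OF that(2)]
    by (intro column_poly_dual) auto
  have eV: "e B \<in> specht_module ?\<mu>" if "B \<in> ?I" for B
    unfolding e_def specht_module_def by (rule fun_space.span_base) (use t[OF that] in auto)
  \<comment> \<open>The difference of both sides lies in the Specht module, hence satisfies the
    relations, and it vanishes at all the dual points; the relations then force it to be 0.\<close>
  have coord: "v = (\<Sum>B\<in>?I. fun_scale (v (p B)) (e B))" if v: "v \<in> specht_module ?\<mu>" for v
  proof -
    let ?w = "v - (\<Sum>B\<in>?I. fun_scale (v (p B)) (e B))"
    have "?w \<in> specht_module ?\<mu>"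
      using v eV unfolding specht_module_def
      by (intro fun_space.span_diff fun_space.span_sum fun_space.span_scale) auto
    moreover have "?w (p B') = 0" if B': "B' \<in> ?I" for B'
    proof -
      have "(\<Sum>B\<in>?I. fun_scale (v (p B)) (e B)) (p B') = (\<Sum>B\<in>?I. if B = B' then v (p B) else 0)"
        unfolding sum_fun_apply by (intro sum.cong refl) (use ep B' in \<open>auto simp: fun_scale_def\<close>)
      also have "\<dots> = v (p B')" using finI B' by (simp add: sum.delta)
      finally show ?thesis by simp
    qed
    ultimately have "?w = 0"
      using b by (intro hook_relations_eq_0[of _ b] specht_hook_relations) (auto simp: p_def)
    thus ?thesis by simp
  qed
  have V: "specht_module ?\<mu> = fun_space.span (e ` ?I)"
  proof
    show "specht_module ?\<mu> \<subseteq> fun_space.span (e ` ?I)"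
    proof
      fix v assume v: "v \<in> specht_module ?\<mu>"
      have "(\<Sum>B\<in>?I. fun_scale (v (p B)) (e B)) \<in> fun_space.span (e ` ?I)"
        by (intro fun_space.span_sum fun_space.span_scale fun_space.span_base imageI)
      thus "v \<in> fun_space.span (e ` ?I)" using coord[OF v] by simp
    qed
    show "fun_space.span (e ` ?I) \<subseteq> specht_module ?\<mu>"
      using eV unfolding specht_module_def by (intro fun_space.span_minimal) auto
  qed
  have act: "tabloid_action g (polytabloid ?\<mu> u) = polytabloid ?\<mu> (g \<circ> u)" if u: "is_tableau ?\<mu> u" for u
  proof
    fix T
    note gu = is_tableau_compose[OF i u g]
    show "tabloid_action g (polytabloid ?\<mu> u) T = polytabloid ?\<mu> (g \<circ> u) T"
    proof (cases "\<exists>d. inj_on d {1..i} \<and> d ` {1..i} \<subseteq> {1..n} \<and> T = hook_tabloid n i d")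
      case True
      then obtain d where T: "T = hook_tabloid n i d" by blast
      show ?thesis
        unfolding T tabloid_action_def inv_image_hook_tabloid[OF g]
          polytabloid_hook(1)[OF i u] polytabloid_hook(1)[OF i gu]
        using column_poly_compose[OF permutes_bij[OF g], of i "\<lambda>k. u (k, 0)" d]
        by (simp add: comp_def)
    next
      case False
      hence "polytabloid ?\<mu> (g \<circ> u) T = 0" by (intro polytabloid_hook(2)[OF i gu]) auto
      moreover have "polytabloid ?\<mu> u (\<lambda>k. inv' g ` T k) = 0"
      proof (rule polytabloid_hook(2)[OF i u], rule notI)
        fix d assume d: "inj_on d {1..i}" "d ` {1..i} \<subseteq> {1..n}"
          and eq: "(\<lambda>k. inv' g ` T k) = hook_tabloid n i d"
        have "T = (\<lambda>k. g ` inv' g ` T k)"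
          using permutes_inverses[OF g] by (simp add: image_image)
        also have "\<dots> = (\<lambda>k. inv' (inv' g) ` hook_tabloid n i d k)"
          using fun_cong[OF eq] inv_inv_eq[OF permutes_bij[OF g]] by simp
        also have "\<dots> = hook_tabloid n i (g \<circ> d)"
          using inv_image_hook_tabloid[OF permutes_inv[OF g]] inv_inv_eq[OF permutes_bij[OF g]] by simp
        finally have "T = hook_tabloid n i (g \<circ> d)" .
        moreover have "inj_on (g \<circ> d) {1..i}"
          using d(1) permutes_inj_on[OF g] by (rule comp_inj_on)
        moreover have "(g \<circ> d) ` {1..i} \<subseteq> {1..n}"
          using d(2) permutes_image[OF g] by (simp flip: image_comp) blast
        ultimately show False using False by blast
      qed
      ultimately show ?thesis by (simp add: tabloid_action_def)
    qed
  qed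
  interpret act: Vector_Spaces.linear fun_scale fun_scale "tabloid_action g"
    by (rule tabloid_action_linear)
  have fV: "tabloid_action g v \<in> specht_module ?\<mu>" if "v \<in> specht_module ?\<mu>" for v
  proof -
    have "tabloid_action g v \<in> tabloid_action g ` fun_space.span {polytabloid ?\<mu> u |u. is_tableau ?\<mu> u}"
      using that by (simp add: specht_module_def)
    also have "\<dots> = fun_space.span (tabloid_action g ` {polytabloid ?\<mu> u |u. is_tableau ?\<mu> u})"
      by (rule act.span_image[symmetric])
    also have "\<dots> \<subseteq> specht_module ?\<mu>" unfolding specht_module_def
      using act is_tableau_compose[OF i _ g] by (intro fun_space.span_mono) auto
    finally show ?thesis .
  qed
  have "irr_char ?\<mu> g = (\<Sum>B\<in>?I. tabloid_action g (e B) (p B))"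
    unfolding irr_char_def
    by (rule trace_on_dual_family[OF finI V coord tabloid_action_linear fV])
  also have "\<dots> = (\<Sum>B\<in>?I. \<Sum>q | q permutes insert 1 B \<and> (\<forall>x\<in>B. g (q x) = x). of_int (sign q))"
  proof (intro sum.cong[OF refl])
    fix B assume B: "B \<in> ?I"
    hence fin: "finite B" using finite_subset[of B "{2..n}"] by auto
    have "tabloid_action g (e B) (p B) = column_poly i (c B) (inv' g \<circ> b B)"
      unfolding tabloid_action_def p_def inv_image_hook_tabloid[OF g] by (rule e_tab[OF B])
    also have "\<dots> = (\<Sum>q | q permutes insert 1 B. if \<forall>x\<in>B. g (q x) = x then of_int (sign q) else 0)"
      unfolding column_poly_def im[OF B]
    proof (intro sum.cong refl if_cong)
      fix q
      have imB: "b B ` {1..i} = B" using b[OF B] by (simp add: bij_betw_def)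
      have "q (c B k) = (inv' g \<circ> b B) k \<longleftrightarrow> g (q (b B k)) = b B k" if "k \<in> {1..i}" for k
        using that permutes_inv_eq[OF g, of "b B k" "q (b B k)"] by (auto simp: c_def)
      hence "(\<forall>k\<in>{1..i}. q (c B k) = (inv' g \<circ> b B) k) \<longleftrightarrow> (\<forall>k\<in>{1..i}. g (q (b B k)) = b B k)"
        by (rule ball_cong[OF refl])
      also have "\<dots> \<longleftrightarrow> (\<forall>x\<in>b B ` {1..i}. g (q x) = x)" by blast
      finally show "(\<forall>k\<in>{1..i}. q (c B k) = (inv' g \<circ> b B) k) \<longleftrightarrow> (\<forall>x\<in>B. g (q x) = x)"
        unfolding imB .
    qed
    also have "\<dots> = (\<Sum>q | q permutes insert 1 B \<and> (\<forall>x\<in>B. g (q x) = x). of_int (sign q))"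
      by (subst sum.inter_filter[symmetric]) (use fin in \<open>auto simp: finite_permutations\<close>)
    finally show "tabloid_action g (e B) (p B) =
      (\<Sum>q | q permutes insert 1 B \<and> (\<forall>x\<in>B. g (q x) = x). of_int (sign q))" .
  qed
  finally show ?thesis .
qed

end

section \<open>The polynomial det(1 + x g) and the generating polynomial of the hook
  characters\<close>

definition perm_charpoly :: "nat \<Rightarrow> (nat \<Rightarrow> nat) \<Rightarrow> complex poly" where
  "perm_charpoly n g = ldet {1..n} (\<lambda>i j. of_bool (j = i) + [:0, 1:] * of_bool (g j = i))"

text \<open>Conjugation permutes rows and columns simultaneously, and the two signs cancel.\<close>

lemma perm_charpoly_conj:
  assumes x: "x permutes {1..n}"
  shows "perm_charpoly n (x \<circ> h \<circ> inv' x) = perm_charpoly n h"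
proof -
  let ?M = "\<lambda>h i j. of_bool (j = i) + [:0, 1:] * of_bool (h j = i) :: complex poly"
  let ?y = "inv' x"
  have y: "?y permutes {1..n}" by (rule permutes_inv[OF x])
  have "?M (x \<circ> h \<circ> ?y) i j = ?M h (?y i) (?y j)" for i j
  proof -
    have "?y j = ?y i \<longleftrightarrow> j = i" using permutes_inj[OF y] by (auto dest: injD)
    moreover have "h (?y j) = ?y i \<longleftrightarrow> x (h (?y j)) = i"
      using permutes_inv_eq[OF x, of i "h (?y j)"] by auto
    ultimately show ?thesis by simp
  qed
  hence "perm_charpoly n (x \<circ> h \<circ> ?y) = ldet {1..n} (\<lambda>i. (\<lambda>i j. ?M h i (?y j)) (?y i))"
    unfolding perm_charpoly_def by simp
  also have "\<dots> = of_int (sign ?y) * ldet {1..n} (\<lambda>i j. ?M h i (?y j))"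
    by (rule ldet_permute_rows[OF finite_atLeastAtMost y])
  also have "ldet {1..n} (\<lambda>i j. ?M h i (?y j)) = of_int (sign ?y) * perm_charpoly n h"
    unfolding perm_charpoly_def by (rule ldet_permute_columns[OF finite_atLeastAtMost y])
  also have "of_int (sign ?y) * (of_int (sign ?y) * perm_charpoly n h) = of_int (sign ?y * sign ?y) * perm_charpoly n h"
    by (simp only: of_int_mult mult.assoc)
  finally show ?thesis by (simp add: comp_def)
qed

definition hook_char_poly :: "nat \<Rightarrow> (nat \<Rightarrow> nat) \<Rightarrow> complex poly" where
  "hook_char_poly n g = (\<Sum>i<n. monom (irr_char (hook n i) g) i)"

lemma X_power_times_const: "[:0, 1:] ^ k * [:c:] = (monom c k :: complex poly)"
  by (simp add: monom_altdef flip: smult_one)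

text \<open>The rows of \<open>1 + x g\<close> add up to \<open>1 + x\<close> times the all-ones row; expanding the determinant with the
  first row replaced by the all-ones row gives the traces on the hook Specht modules.\<close>

lemma perm_charpoly_eq_hook:
  assumes n: "n \<ge> 1" and g: "g permutes {1..n}"
  shows "perm_charpoly n g = [:1, 1:] * hook_char_poly n g"
proof -
  let ?S = "{1..n}" and ?T = "{2..n}"
  let ?M = "\<lambda>i j. of_bool (j = i) + [:0, 1:] * of_bool (g j = i) :: complex poly"
  let ?row = "\<lambda>u i j. if i = 1 then u j else ?M i j"
  have "ldet ?S (?row (\<lambda>j. \<Sum>m\<in>?S. ?M m j)) = (\<Sum>m\<in>?S. ldet ?S (?row (?M m)))"
    using n by (intro ldet_row_sum) auto
  also have "\<dots> = (\<Sum>m\<in>?S. if m = 1 then ldet ?S ?M else 0)"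
  proof (intro sum.cong refl)
    fix m assume m: "m \<in> ?S"
    show "ldet ?S (?row (?M m)) = (if m = 1 then ldet ?S ?M else 0)"
    proof (cases "m = 1")
      case True
      thus ?thesis by (auto intro!: ldet_cong)
    next
      case False
      thus ?thesis using m n ldet_equal_rows[of ?S 1 m "?row (?M m)"] by simp
    qed
  qed
  finally have "perm_charpoly n g = ldet ?S (?row (\<lambda>j. \<Sum>m\<in>?S. ?M m j))"
    using n by (simp add: perm_charpoly_def)
  also have "\<dots> = ldet ?S (?row (\<lambda>j. [:1, 1:] * 1))"
  proof (rule ldet_cong)
    fix i j assume "j \<in> ?S"
    hence "g j \<in> ?S" using permutes_in_image[OF g] by simp
    have "(\<Sum>m\<in>?S. ?M m j) = (\<Sum>m\<in>?S. if j = m then 1 else 0) + [:0, 1:] * (\<Sum>m\<in>?S. if g j = m then 1 else 0)"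
      unfolding sum_distrib_left sum.distrib[symmetric] by (intro sum.cong) auto
    also have "\<dots> = 1 + [:0, 1:] * 1"
      using \<open>j \<in> ?S\<close> \<open>g j \<in> ?S\<close> by (simp add: sum.delta)
    finally have "(\<Sum>m\<in>?S. ?M m j) = [:1, 1:] * 1" by (simp add: one_pCons)
    thus "?row (\<lambda>j. \<Sum>m\<in>?S. ?M m j) i j = ?row (\<lambda>j. [:1, 1:] * 1) i j" by simp
  qed
  also have "\<dots> = [:1, 1:] * ldet ?S (?row (\<lambda>j. 1))"
    using n by (intro ldet_row_scale) auto
  also have "ldet ?S (?row (\<lambda>j. 1)) = hook_char_poly n g"
  proof -
    \<comment> \<open>\<open>B\<close> collects the rows from 2 on in which the summand x g is
      taken. Row 1 imposes no condition, so the surviving permutations move only elements of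
      \<open>insert 1 B\<close>: exactly the index set found for the trace.\<close>
    let ?C = "\<lambda>B q. (\<forall>k\<in>B. g (q k) = k) \<and> (\<forall>k\<in>?T - B. q k = k)"
    let ?Q = "\<lambda>B. {q. q permutes insert 1 B \<and> (\<forall>x\<in>B. g (q x) = x)}"
    have ST: "?S - {1} = ?T" by auto
    have Q: "{q. q permutes ?S \<and> ?C B q} = ?Q B" if B: "B \<in> Pow ?T" for B
    proof -
      have "q permutes ?S \<and> (\<forall>k\<in>?T - B. q k = k) \<longleftrightarrow> q permutes insert 1 B" for q
      proof
        assume q: "q permutes ?S \<and> (\<forall>k\<in>?T - B. q k = k)"
        show "q permutes insert 1 B"
        proof (rule permutes_superset[OF conjunct1[OF q]])
          fix x assume "x \<in> ?S - insert 1 B"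
          hence "x \<in> ?T - B" by auto
          thus "q x = x" using q by blast
        qed
      next
        assume q: "q permutes insert 1 B"
        have "insert 1 B \<subseteq> ?S" using B n by auto
        hence "q permutes ?S" using q permutes_subset by blast
        moreover have "q k = k" if "k \<in> ?T - B" for k
          using that permutes_not_in[OF q, of k] by auto
        ultimately show "q permutes ?S \<and> (\<forall>k\<in>?T - B. q k = k)" by blast
      qed
      thus ?thesis by blast
    qed
    have pr: "(\<Prod>i\<in>?S. ?row (\<lambda>j. 1) i (q i)) =
       (\<Sum>B\<in>Pow ?T. if ?C B q then [:0, 1:] ^ card B else 0)" for q
    proof -
      have "(\<Prod>i\<in>?S. ?row (\<lambda>j. 1) i (q i)) = (\<Prod>i\<in>?T. ?M i (q i))"
        using n prod_row[of ?S 1 "\<lambda>_. 1" "\<lambda>i. ?M i (q i)"] unfolding ST by simp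
      also have "\<dots> = (\<Prod>i\<in>?T. [:0, 1:] * of_bool (g (q i) = i) + of_bool (q i = i))"
        by (simp add: add.commute)
      also have "\<dots> = (\<Sum>B\<in>Pow ?T. (\<Prod>i\<in>B. [:0, 1:] * of_bool (g (q i) = i)) *
          (\<Prod>i\<in>?T - B. of_bool (q i = i)))"
        by (rule prod_add) simp
      also have "\<dots> = (\<Sum>B\<in>Pow ?T. if ?C B q then [:0, 1:] ^ card B else 0)"
        by (intro sum.cong refl) (auto simp: prod.distrib prod_of_bool finite_subset[of _ ?T] one_pCons)
      finally show ?thesis .
    qed
    have "ldet ?S (?row (\<lambda>j. 1)) = (\<Sum>q | q permutes ?S. \<Sum>B\<in>Pow ?T.
        if ?C B q then of_int (sign q) * [:0, 1:] ^ card B else 0)"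
      unfolding ldet_def pr sum_distrib_left by (intro sum.cong refl) auto
    also have "\<dots> = (\<Sum>B\<in>Pow ?T. \<Sum>q | q permutes ?S \<and> ?C B q. of_int (sign q) * [:0, 1:] ^ card B)"
      by (subst sum.swap, rule sum.cong[OF refl], subst sum.inter_filter[symmetric])
        (auto simp: finite_permutations)
    also have "\<dots> = (\<Sum>B\<in>Pow ?T. monom (\<Sum>q\<in>?Q B. complex_of_int (sign q)) (card B))"
    proof (rule sum.cong[OF refl])
      fix B assume B: "B \<in> Pow ?T"
      have "(\<Sum>q\<in>?Q B. of_int (sign q) * [:0, 1:] ^ card B) =
          [:0, 1:] ^ card B * [:\<Sum>q\<in>?Q B. of_int (sign q) :: complex:]"
        by (simp add: sum_distrib_left mult.commute of_int_poly flip: sum_to_poly)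
      thus "(\<Sum>q | q permutes ?S \<and> ?C B q. of_int (sign q) * [:0, 1:] ^ card B) =
          monom (\<Sum>q\<in>?Q B. complex_of_int (sign q)) (card B)"
        unfolding Q[OF B] X_power_times_const .
    qed
    also have "\<dots> = (\<Sum>i<n. \<Sum>B | B \<in> Pow ?T \<and> card B = i.
        monom (\<Sum>q\<in>?Q B. complex_of_int (sign q)) (card B))"
    proof (rule sum.group[symmetric])
      have "card B < n" if "B \<subseteq> ?T" for B
        using card_mono[OF _ that] n by simp
      thus "card ` Pow ?T \<subseteq> {..<n}" by auto
    qed auto
    also have "\<dots> = hook_char_poly n g"
      unfolding hook_char_poly_def
      by (intro sum.cong refl) (auto simp: irr_char_hook[OF _ g] monom_sum intro!: sum.cong)
    finally show ?thesis .
  qed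
  finally show ?thesis .
qed

lemma irr_char_hook_real:
  assumes "i < n" "g permutes {1..n}"
  shows "cnj (irr_char (hook n i) g) = irr_char (hook n i) g"
  unfolding irr_char_hook[OF assms] by simp

text \<open>Invariance is inherited from the determinant: cancelling 1 + x determines all hook
  characters from det(1 + x g).\<close>

lemma irr_char_hook_conj:
  assumes i: "i < n" and x: "x permutes {1..n}" and h: "h permutes {1..n}"
  shows "irr_char (hook n i) (x \<circ> h \<circ> inv' x) = irr_char (hook n i) h"
proof -
  have c: "coeff (hook_char_poly n g) i = irr_char (hook n i) g" for g
    using i by (simp add: hook_char_poly_def coeff_sum sum.delta)
  have "x \<circ> h \<circ> inv' x permutes {1..n}" by (intro permutes_compose permutes_inv x h)
  moreover have "n \<ge> 1" using i by simp
  ultimately have "[:1, 1:] * hook_char_poly n (x \<circ> h \<circ> inv' x) = [:1, 1:] * hook_char_poly n h"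
    using perm_charpoly_conj[OF x] perm_charpoly_eq_hook h by metis
  hence "hook_char_poly n (x \<circ> h \<circ> inv' x) = hook_char_poly n h"
    by (subst (asm) mult_cancel_left) simp
  thus ?thesis using c by metis
qed

text \<open>Frobenius reciprocity. For fixed \<open>x\<close> the substitution of the conjugate of
  \<open>h\<close> by \<open>x\<close> for \<open>g\<close> turns the sum over \<open>g\<close> into
  the sum over \<open>H\<close>; the number of choices of \<open>x\<close> cancels the order of
  \<open>G\<close>.\<close>

lemma char_inner_induced_character:
  assumes G: "group G" "finite (carrier G)" and H: "H \<subseteq> carrier G"
    and \<chi>: "\<And>x h. x \<in> carrier G \<Longrightarrow> h \<in> carrier G \<Longrightarrow> \<chi> (x \<otimes>\<^bsub>G\<^esub> h \<otimes>\<^bsub>G\<^esub> inv\<^bsub>G\<^esub> x) = \<chi> h"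
  shows "char_inner G (induced_character G H \<phi>) \<chi> = (\<Sum>h\<in>H. \<phi> h * cnj (\<chi> h)) / of_nat (card H)"
proof -
  interpret group G by (rule G)
  let ?c = "\<lambda>x g. inv\<^bsub>G\<^esub> x \<otimes>\<^bsub>G\<^esub> g \<otimes>\<^bsub>G\<^esub> x"
  have "(\<Sum>g\<in>carrier G. (\<Sum>x\<in>{x \<in> carrier G. ?c x g \<in> H}. \<phi> (?c x g)) * cnj (\<chi> g)) =
      (\<Sum>g\<in>carrier G. \<Sum>x\<in>carrier G. if ?c x g \<in> H then \<phi> (?c x g) * cnj (\<chi> g) else 0)"
    unfolding sum_distrib_right
    by (rule sum.cong[OF refl], subst sum.inter_filter) (use G in auto)
  also have "\<dots> = (\<Sum>x\<in>carrier G. \<Sum>g\<in>{g \<in> carrier G. ?c x g \<in> H}. \<phi> (?c x g) * cnj (\<chi> g))"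
    by (subst sum.swap, rule sum.cong[OF refl], subst sum.inter_filter) (use G in auto)
  also have "\<dots> = (\<Sum>x\<in>carrier G. \<Sum>h\<in>H. \<phi> h * cnj (\<chi> h))"
  proof (rule sum.cong[OF refl])
    fix x assume x: "x \<in> carrier G"
    have e1: "x \<otimes>\<^bsub>G\<^esub> ?c x g \<otimes>\<^bsub>G\<^esub> inv\<^bsub>G\<^esub> x = g" if "g \<in> carrier G" for g
      using x that by (metis inv_closed inv_solve_right m_assoc m_closed r_inv l_one)
    have e2: "?c x (x \<otimes>\<^bsub>G\<^esub> h \<otimes>\<^bsub>G\<^esub> inv\<^bsub>G\<^esub> x) = h" if "h \<in> carrier G" for h
      using x that by (metis inv_closed l_inv l_one m_assoc m_closed r_one)
    show "(\<Sum>g\<in>{g \<in> carrier G. ?c x g \<in> H}. \<phi> (?c x g) * cnj (\<chi> g)) = (\<Sum>h\<in>H. \<phi> h * cnj (\<chi> h))"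
    proof (rule sum.reindex_bij_witness[where i="\<lambda>h. x \<otimes>\<^bsub>G\<^esub> h \<otimes>\<^bsub>G\<^esub> inv\<^bsub>G\<^esub> x" and j="?c x"])
      fix g assume g: "g \<in> {g \<in> carrier G. ?c x g \<in> H}"
      show "x \<otimes>\<^bsub>G\<^esub> ?c x g \<otimes>\<^bsub>G\<^esub> inv\<^bsub>G\<^esub> x = g" "?c x g \<in> H" using g e1 by auto
      show "\<phi> (?c x g) * cnj (\<chi> (?c x g)) = \<phi> (?c x g) * cnj (\<chi> g)"
        using \<chi>[OF x, of "?c x g"] g e1 x by auto
    next
      fix h assume h: "h \<in> H"
      show "?c x (x \<otimes>\<^bsub>G\<^esub> h \<otimes>\<^bsub>G\<^esub> inv\<^bsub>G\<^esub> x) = h" using e2 h H by auto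
      thus "x \<otimes>\<^bsub>G\<^esub> h \<otimes>\<^bsub>G\<^esub> inv\<^bsub>G\<^esub> x \<in> {g \<in> carrier G. ?c x g \<in> H}"
        using h H x by auto
    qed
  qed
  also have "\<dots> = of_nat (card (carrier G)) * (\<Sum>h\<in>H. \<phi> h * cnj (\<chi> h))" by simp
  finally have *: "(\<Sum>g\<in>carrier G. (\<Sum>x\<in>{x \<in> carrier G. ?c x g \<in> H}. \<phi> (?c x g)) * cnj (\<chi> g)) =
    of_nat (card (carrier G)) * (\<Sum>h\<in>H. \<phi> h * cnj (\<chi> h))" .
  have "card (carrier G) \<noteq> 0" using G(2) one_closed by (metis card_0_eq empty_iff)
  thus ?thesis unfolding char_inner_def induced_character_def order_def
    using * by (simp add: sum_divide_distrib[symmetric] times_divide_eq_left)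
qed

section \<open>Diagonalising the base group\<close>

lemma smult_sum_right: "smult c (\<Sum>i\<in>S. f i) = (\<Sum>i\<in>S. smult c (f i))"
  by (induction S rule: infinite_finite_induct) (auto simp: smult_add_right)

text \<open>Frobenius reciprocity for all hooks at once. The complex conjugation in the inner
  product disappears because hook characters are real, and multiplication by 1 + x replaces the
  generating polynomial of the hook characters by a determinant.\<close>

lemma hook_poly_eq_sum_charpoly:
  fixes a :: "nat \<Rightarrow> nat \<Rightarrow> nat"
  assumes n: "r * s \<ge> 1"
  defines "C \<equiv> centralizer (sym_group (r * s)) (cycles_perm r s a)"
  shows "[:1, 1:] * hook_poly r s a \<zeta> = smult (1 / of_nat (card C))
    (\<Sum>h\<in>C. smult (wreath_character r s a \<zeta> h) (perm_charpoly (r * s) h))"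
proof -
  let ?n = "r * s" and ?w = "wreath_character r s a \<zeta>"
  have C: "C \<subseteq> carrier (sym_group ?n)" unfolding C_def centralizer_def by blast
  have perm: "h permutes {1..?n}" if "h \<in> C" for h using that C by (auto simp: sym_group_def)
  have fin: "finite (carrier (sym_group ?n))" by (simp add: sym_group_def finite_permutations)
  have mult: "hook_mult r s a \<zeta> i = (\<Sum>h\<in>C. ?w h * irr_char (hook ?n i) h) / of_nat (card C)"
    if i: "i < ?n" for i
  proof -
    have "hook_mult r s a \<zeta> i = (\<Sum>h\<in>C. ?w h * cnj (irr_char (hook ?n i) h)) / of_nat (card C)"
      using i unfolding hook_mult_def higher_lie_character_def C_def[symmetric]
      by (simp, intro char_inner_induced_character sym_group_is_group fin C)
        (auto simp: sym_group_carrier sym_group_mult irr_char_hook_conj)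
    thus ?thesis using irr_char_hook_real[OF i perm] by simp
  qed
  \<comment> \<open>The top coefficient is 0 by the convention in \<open>hook_mult\<close>.\<close>
  have "hook_poly r s a \<zeta> = (\<Sum>i<?n. monom (hook_mult r s a \<zeta> i) i)"
    unfolding hook_poly_def lessThan_Suc_atMost[symmetric] by (simp add: hook_mult_def)
  also have "\<dots> = (\<Sum>i<?n. \<Sum>h\<in>C. smult (1 / of_nat (card C)) (smult (?w h) (monom (irr_char (hook ?n i) h) i)))"
    by (intro sum.cong refl)
      (simp add: mult smult_monom monom_sum sum_divide_distrib)
  also have "\<dots> = smult (1 / of_nat (card C)) (\<Sum>h\<in>C. smult (?w h) (hook_char_poly ?n h))"
    by (subst sum.swap) (simp add: hook_char_poly_def smult_sum_right)
  finally have "[:1, 1:] * hook_poly r s a \<zeta> =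
      smult (1 / of_nat (card C)) (\<Sum>h\<in>C. smult (?w h) ([:1, 1:] * hook_char_poly ?n h))"
    by (simp only: mult_smult_right sum_distrib_left)
  thus ?thesis using perm_charpoly_eq_hook[OF n perm] by simp
qed

text \<open>The value at the generator determines the character; injectivity makes this value a root
  of unity of exact order \<open>r\<close>.\<close>

lemma faithful_linear_character_root:
  assumes r: "r \<ge> 1" and \<zeta>: "faithful_linear_character r \<zeta>"
  obtains w where "\<And>k. w ^ k = 1 \<longleftrightarrow> r dvd k" "\<And>z. z \<in> {0..<int r} \<Longrightarrow> \<zeta> z = w ^ nat z"
proof -
  have car: "carrier (integer_mod_group r) = {0..<int r}"
    using r by (simp add: carrier_integer_mod_group)
  have hom: "\<zeta> ((u + v) mod int r) = \<zeta> u * \<zeta> v" if "u \<in> {0..<int r}" "v \<in> {0..<int r}" for u v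
    using hom_mult[of \<zeta> "integer_mod_group r" complex_units u v] \<zeta> that r
    by (simp add: faithful_linear_character_def complex_units_def mult_integer_mod_group car)
  have "\<zeta> 0 \<noteq> 0"
    using \<zeta> r hom_carrier[of \<zeta> "integer_mod_group r" complex_units]
    by (auto simp: faithful_linear_character_def complex_units_def car image_subset_iff)
  moreover have "\<zeta> 0 = \<zeta> 0 * \<zeta> 0" using hom[of 0 0] r by simp
  ultimately have zero: "\<zeta> 0 = 1" by simp
  \<comment> \<open>The reduction matters for \<open>r = 1\<close>, where the carrier is
    \<open>{0}\<close>.\<close>
  define w where "w = \<zeta> (1 mod int r)"
  have pow: "\<zeta> (int k mod int r) = w ^ k" for k
  proof (induction k)
    case (Suc k)
    have "\<zeta> (int (Suc k) mod int r) = \<zeta> ((int k mod int r + 1 mod int r) mod int r)"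
      by (simp add: mod_add_eq add.commute)
    also have "\<dots> = w ^ Suc k"
      unfolding w_def using r Suc by (subst hom) (auto simp: w_def mult.commute)
    finally show ?case .
  qed (simp add: zero)
  have "w ^ k = 1 \<longleftrightarrow> r dvd k" for k
  proof -
    have "w ^ k = 1 \<longleftrightarrow> \<zeta> (int k mod int r) = \<zeta> 0" by (simp add: pow zero)
    also have "\<dots> \<longleftrightarrow> int k mod int r = 0"
      using \<zeta> r inj_on_eq_iff[of \<zeta> "{0..<int r}" "int k mod int r" 0]
      by (auto simp: faithful_linear_character_def car)
    also have "\<dots> \<longleftrightarrow> r dvd k" by (metis dvd_eq_mod_eq_0 int_dvd_int_iff)
    finally show ?thesis .
  qed
  moreover have "\<zeta> z = w ^ nat z" if "z \<in> {0..<int r}" for z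
    using pow[of "nat z"] that by simp
  ultimately show ?thesis by (rule that)
qed

lemma power_mod_root:
  fixes x :: "'a::monoid_mult"
  assumes "x ^ r = 1"
  shows "x ^ (k mod r) = x ^ k"
proof -
  have "x ^ k = (x ^ r) ^ (k div r) * x ^ (k mod r)"
    by (simp flip: power_mult power_add)
  thus ?thesis using assms by simp
qed

lemma sum_powers_root_of_unity:
  fixes x :: complex
  assumes "x ^ r = 1" "x \<noteq> 1"
  shows "(\<Sum>k<r. x ^ k) = 0"
  using geometric_sum[OF assms(2), of r] assms(1) by simp

text \<open>On a disjoint union of invariant sets the restricted permutation is the composition of
  its restrictions to the pieces.\<close>

lemma sign_restrict_id_Union:
  assumes S: "finite S" "h permutes S" and J: "finite J"
    and A: "\<And>j. j \<in> J \<Longrightarrow> A j \<subseteq> S" "\<And>j. j \<in> J \<Longrightarrow> h ` A j = A j" "disjoint_family_on A J"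
  shows "sign (restrict_id h (\<Union>j\<in>J. A j)) = (\<Prod>j\<in>J. sign (restrict_id h (A j)))"
  using J A
proof (induction J rule: finite_induct)
  case empty
  have "restrict_id h {} = id" by (auto simp: restrict_id_def)
  thus ?case by simp
next
  case (insert j J)
  let ?U = "\<Union>i\<in>J. A i"
  have disj: "A j \<inter> ?U = {}"
    using insert.prems(3) insert.hyps by (auto simp: disjoint_family_on_def)
  have U: "?U \<subseteq> S" "h ` ?U = ?U" using insert.prems(1,2) by (auto simp: image_UN)
  have hx: "h x \<notin> A j" if "x \<in> ?U" for x using U that disj by blast
  have eq: "restrict_id h (\<Union>i\<in>insert j J. A i) = restrict_id h (A j) \<circ> restrict_id h ?U"
  proof
    fix x
    consider "x \<in> A j" "x \<notin> ?U" | "x \<in> ?U" "x \<notin> A j" | "x \<notin> A j" "x \<notin> ?U"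
      using disj by blast
    thus "restrict_id h (\<Union>i\<in>insert j J. A i) x = (restrict_id h (A j) \<circ> restrict_id h ?U) x"
      using hx by cases (auto simp: restrict_id_def)
  qed
  have perm: "permutation (restrict_id h B)" if "B \<subseteq> S" "h ` B = B" for B
    using restrict_id_permutes[OF S(2) that(2)] that(1) S(1)
    by (meson finite_subset permutes_imp_permutation)
  have "sign (restrict_id h ?U) = (\<Prod>i\<in>J. sign (restrict_id h (A i)))"
    using insert by (auto intro!: insert.IH simp: disjoint_family_on_def)
  moreover have "sign (restrict_id h (\<Union>i\<in>insert j J. A i)) =
      sign (restrict_id h (A j)) * sign (restrict_id h ?U)"
    unfolding eq by (intro sign_compose perm U insert.prems(1,2)) auto
  ultimately show ?case using insert.hyps by simp
qed

text \<open>The sign by which a permutation \<open>\<tau>\<close> of the tensor factors with \<open>f \<circ> \<tau> = f\<close> acts on a product of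
  homogeneous elements, the factor in position \<open>l\<close> being \<open>f l\<close>, of degree \<open>d (f l)\<close>.\<close>

definition fiber_sign :: "nat \<Rightarrow> ('k \<Rightarrow> nat) \<Rightarrow> (nat \<Rightarrow> nat) \<Rightarrow> (nat \<Rightarrow> 'k) \<Rightarrow> int" where
  "fiber_sign s d \<tau> f = (\<Prod>K\<in>f ` {..<s}. sign (restrict_id \<tau> {l. l < s \<and> f l = K}) ^ d K)"

lemma fiber_permutes:
  fixes s :: nat
  assumes "\<tau> permutes {..<s}" "\<And>l. l < s \<Longrightarrow> f (\<tau> l) = f l"
  shows "\<tau> ` {l. l < s \<and> f l = K} = {l. l < s \<and> f l = K}"
proof (rule endo_inj_surj)
  have "\<tau> l < s" if "l < s" for l using permutes_in_image[OF assms(1), of l] that by simp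
  thus "\<tau> ` {l. l < s \<and> f l = K} \<subseteq> {l. l < s \<and> f l = K}" using assms(2) by auto
  show "finite {l. l < s \<and> f l = K}" by (rule finite_subset[of _ "{..<s}"]) auto
qed (rule permutes_inj_on[OF assms(1)])

section \<open>Subsets cut along the cycles, and the Fourier transform on each cycle\<close>

context
  fixes r s :: nat and a :: "nat \<Rightarrow> nat \<Rightarrow> nat"
  assumes r: "r \<ge> 1" and a: "cycle_labelling r s a"
begin

lemmas lab_inj = labelling_inj[OF r a] and lab_range = labelling_range[OF r a]
  and lab_surj = labelling_surj[OF r a] and lab_eq = label_of_eq[OF r a]

lemma sum_labelled: "(\<Sum>k\<in>{1..r * s}. g k) = (\<Sum>l<s. \<Sum>t<r. g (a l t))"
proof -
  have "(\<Sum>k\<in>{1..r * s}. g k) = (\<Sum>(l, t)\<in>{..<s} \<times> {..<r}. g (a l t))"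
    using sum.reindex_bij_betw[OF a[unfolded cycle_labelling_def], of g]
    by (simp add: case_prod_unfold)
  thus ?thesis by (simp add: sum.cartesian_product)
qed

text \<open>Block diagonal with one Fourier matrix for each cycle. The entries are constant
  polynomials so that the matrix can be multiplied with that of 1 + x g.\<close>

definition dft :: "complex \<Rightarrow> nat \<Rightarrow> nat \<Rightarrow> complex poly" where
  "dft u i j = (case (label_of r s a i, label_of r s a j) of ((l, t), (l', t')) \<Rightarrow>
     if l = l' then [:u ^ (t * t'):] else 0)"

lemma dft_eq:
  "l < s \<Longrightarrow> t < r \<Longrightarrow> l' < s \<Longrightarrow> t' < r \<Longrightarrow>
    dft u (a l t) (a l' t') = (if l = l' then [:u ^ (t * t'):] else 0)"
  by (simp add: dft_def lab_eq)

lemma wreathing_permutes: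
  assumes \<tau>: "\<tau> permutes {..<s}"
  shows "wreathing_perm r s a \<tau> permutes {1..r * s}"
proof (rule inj_imp_permutes)
  show "wreathing_perm r s a \<tau> x \<in> {1..r * s}" if "x \<in> {1..r * s}" for x
    using lab_surj[OF that] permutes_in_image[OF \<tau>] lab_range
    by (metis lessThan_iff wreathing_perm_eq[OF r a])
  show "inj_on (wreathing_perm r s a \<tau>) {1..r * s}"
  proof
    fix x y assume xy: "x \<in> {1..r * s}" "y \<in> {1..r * s}"
      and eq: "wreathing_perm r s a \<tau> x = wreathing_perm r s a \<tau> y"
    obtain l t where x: "l < s" "t < r" "x = a l t" using xy(1) by (rule lab_surj)
    obtain l' t' where y: "l' < s" "t' < r" "y = a l' t'" using xy(2) by (rule lab_surj)
    have "a (\<tau> l) t = a (\<tau> l') t'" using eq x y by (simp add: wreathing_perm_eq[OF r a])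
    moreover have "\<tau> l < s" "\<tau> l' < s" using x y permutes_in_image[OF \<tau>] by auto
    ultimately have "\<tau> l = \<tau> l'" "t = t'" using lab_inj x y by auto
    thus "x = y" using x y permutes_inj[OF \<tau>] by (auto dest: injD)
  qed
qed (auto simp: wreathing_perm_def)

lemma base_permutes: "base_perm r s a z permutes {1..r * s}"
proof (rule inj_imp_permutes)
  show "base_perm r s a z x \<in> {1..r * s}" if "x \<in> {1..r * s}" for x
    using lab_surj[OF that] lab_range base_perm_eq[OF r a] shift_less[OF r a] by metis
  show "inj_on (base_perm r s a z) {1..r * s}"
  proof
    fix x y assume xy: "x \<in> {1..r * s}" "y \<in> {1..r * s}" and eq: "base_perm r s a z x = base_perm r s a z y"
    obtain l t where x: "l < s" "t < r" "x = a l t" using xy(1) by (rule lab_surj)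
    obtain l' t' where y: "l' < s" "t' < r" "y = a l' t'" using xy(2) by (rule lab_surj)
    have "a l (nat ((int t + z l) mod int r)) = a l' (nat ((int t' + z l') mod int r))"
      using eq x y by (simp add: base_perm_eq[OF r a])
    hence l: "l = l'" and "nat ((int t + z l) mod int r) = nat ((int t' + z l) mod int r)"
      using lab_inj[of l _ l'] x y shift_less[OF r a] by auto
    hence "(int t + z l) mod int r = (int t' + z l) mod int r" using r by (simp add: nat_eq_iff)
    hence "int t mod int r = int t' mod int r"
      by (metis add_diff_cancel_right' mod_diff_left_eq)
    thus "x = y" using l x y by simp
  qed
qed (auto simp: base_perm_def)

text \<open>A subset of \<open>{1..r * s}\<close> becomes a family of residue sets, one for each
  cycle. The restriction to \<open>{..<s}\<close> makes the family extensional, which is what lets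
  \<open>glue\<close> be a two-sided inverse.\<close>

definition slices :: "nat set \<Rightarrow> nat \<Rightarrow> nat set" where
  "slices A = (\<lambda>l\<in>{..<s}. {t. t < r \<and> a l t \<in> A})"

definition glue :: "(nat \<Rightarrow> nat set) \<Rightarrow> nat set" where
  "glue f = (\<lambda>(l, t). a l t) ` (SIGMA l:{..<s}. f l)"

lemma glue_slices: "A \<subseteq> {1..r * s} \<Longrightarrow> glue (slices A) = A"
proof
  show "glue (slices A) \<subseteq> A" by (auto simp: glue_def slices_def)
  assume A: "A \<subseteq> {1..r * s}"
  show "A \<subseteq> glue (slices A)"
  proof
    fix x assume x: "x \<in> A"
    then obtain l t where "l < s" "t < r" "x = a l t" using A lab_surj[of x] by blast
    thus "x \<in> glue (slices A)"
      unfolding glue_def using x by (intro image_eqI[of _ _ "(l, t)"]) (auto simp: slices_def)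
  qed
qed

lemma mem_glue_iff:
  assumes "f \<in> {..<s} \<rightarrow>\<^sub>E Pow {..<r}" "l < s" "t < r"
  shows "a l t \<in> glue f \<longleftrightarrow> t \<in> f l"
proof
  assume "a l t \<in> glue f"
  then obtain l' t' where "l' < s" "t' \<in> f l'" "a l t = a l' t'" by (auto simp: glue_def)
  moreover have "t' < r" using assms calculation by (auto simp: PiE_def Pi_def)
  ultimately show "t \<in> f l" using lab_inj[of l t l' t'] assms by auto
next
  assume "t \<in> f l"
  thus "a l t \<in> glue f" using assms by (force simp: glue_def)
qed

lemma slices_glue:
  assumes f: "f \<in> {..<s} \<rightarrow>\<^sub>E Pow {..<r}"
  shows "slices (glue f) = f"
proof
  fix l
  have "f l \<subseteq> {..<r}" if "l < s" using f that by (auto simp: PiE_def Pi_def)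
  thus "slices (glue f) l = f l"
    using mem_glue_iff[OF f, of l] f by (auto simp: slices_def PiE_def extensional_def)
qed

lemma glue_subset:
  assumes f: "f \<in> {..<s} \<rightarrow>\<^sub>E Pow {..<r}"
  shows "glue f \<subseteq> {1..r * s}"
proof
  fix x assume "x \<in> glue f"
  then obtain l t where "l < s" "t \<in> f l" "x = a l t" by (auto simp: glue_def)
  thus "x \<in> {1..r * s}" using lab_range[of l t] f by (auto simp: PiE_def Pi_def)
qed

lemma glue_invariant_iff:
  assumes \<tau>: "\<tau> permutes {..<s}" and f: "f \<in> {..<s} \<rightarrow>\<^sub>E Pow {..<r}"
  shows "wreathing_perm r s a \<tau> ` glue f = glue f \<longleftrightarrow> (\<forall>l<s. f (\<tau> l) = f l)"
proof -
  let ?t = "wreathing_perm r s a \<tau>"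
  note tp = wreathing_permutes[OF \<tau>]
  have \<tau>s: "\<tau> l < s" if "l < s" for l using permutes_in_image[OF \<tau>, of l] that by simp
  have sub: "f l \<subseteq> {..<r}" if "l < s" for l using f that by (auto simp: PiE_def Pi_def)
  show ?thesis
  proof
    assume inv: "?t ` glue f = glue f"
    show "\<forall>l<s. f (\<tau> l) = f l"
    proof (intro allI impI)
      fix l assume l: "l < s"
      have "t \<in> f (\<tau> l) \<longleftrightarrow> t \<in> f l" if t: "t < r" for t
      proof -
        have "a (\<tau> l) t \<in> ?t ` glue f \<longleftrightarrow> a l t \<in> glue f"
          using wreathing_perm_eq[OF r a l t, of \<tau>] inj_image_mem_iff[OF permutes_inj[OF tp]] by metis
        thus ?thesis unfolding inv mem_glue_iff[OF f l t] mem_glue_iff[OF f \<tau>s[OF l] t] .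
      qed
      thus "f (\<tau> l) = f l" using sub[OF l] sub[OF \<tau>s[OF l]] by blast
    qed
  next
    assume fx: "\<forall>l<s. f (\<tau> l) = f l"
    show "?t ` glue f = glue f"
    proof (rule endo_inj_surj)
      show "finite (glue f)" using glue_subset[OF f] finite_subset by blast
      show "inj_on ?t (glue f)" by (rule permutes_inj_on[OF tp])
      show "?t ` glue f \<subseteq> glue f"
      proof
        fix x assume "x \<in> ?t ` glue f"
        then obtain l t where lt: "l < s" "t \<in> f l" "x = ?t (a l t)" by (auto simp: glue_def)
        hence "t < r" using sub by auto
        thus "x \<in> glue f"
          using lt fx \<tau>s[of l] mem_glue_iff[OF f, of "\<tau> l" t] by (simp add: wreathing_perm_eq[OF r a])
      qed
    qed
  qed
qed

text \<open>For each colour \<open>K\<close> and each residue \<open>t\<close> in \<open>K\<close>,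
  the points \<open>a l t\<close> with \<open>f l = K\<close> form an invariant set on which the
  permutation is a copy of \<tau> on the fibre of \<open>K\<close>. There are \<open>card K\<close>
  such copies, whence the exponent in \<open>fiber_sign\<close>.\<close>

lemma sign_glue:
  assumes \<tau>: "\<tau> permutes {..<s}" and f: "f \<in> {..<s} \<rightarrow>\<^sub>E Pow {..<r}" and fx: "\<forall>l<s. f (\<tau> l) = f l"
  shows "sign (restrict_id (wreathing_perm r s a \<tau>) (glue f)) = fiber_sign s card \<tau> f"
proof -
  let ?t = "wreathing_perm r s a \<tau>"
  let ?L = "\<lambda>K. {l. l < s \<and> f l = K}"
  let ?J = "SIGMA K:f ` {..<s}. K"
  let ?A = "\<lambda>(K, t). (\<lambda>l. a l t) ` ?L K"
  have sub: "K \<subseteq> {..<r}" if "K \<in> f ` {..<s}" for K using f that by (auto simp: PiE_def Pi_def)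
  have fK: "finite K" if "K \<in> f ` {..<s}" for K using sub[OF that] finite_subset by blast
  have tr: "t < r" if "(K, t) \<in> ?J" for K t
    using that sub[of K] by (metis SigmaE2 lessThan_iff subsetD)
  have inv: "\<tau> ` ?L K = ?L K" for K by (rule fiber_permutes[OF \<tau>]) (use fx in blast)
  have tA: "?t ` ?A (K, t) = ?A (K, t)" if "(K, t) \<in> ?J" for K t
  proof -
    have "?t ` ?A (K, t) = (\<lambda>l. ?t (a l t)) ` ?L K" by (simp add: image_image)
    also have "\<dots> = (\<lambda>l. a (\<tau> l) t) ` ?L K"
      using tr[OF that] by (intro image_cong refl) (simp add: wreathing_perm_eq[OF r a])
    also have "\<dots> = (\<lambda>l. a l t) ` \<tau> ` ?L K" by (simp add: image_image)
    finally show ?thesis by (simp add: inv)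
  qed
  have inj: "inj_on (\<lambda>l. a l t) (?L K)" if "(K, t) \<in> ?J" for K t
    using tr[OF that] lab_inj by (auto simp: inj_on_def)
  have glue: "glue f = (\<Union>j\<in>?J. ?A j)" by (force simp: glue_def)
  have "sign (restrict_id ?t (glue f)) = (\<Prod>j\<in>?J. sign (restrict_id ?t (?A j)))"
    unfolding glue
  proof (rule sign_restrict_id_Union[OF finite_atLeastAtMost wreathing_permutes[OF \<tau>]])
    show "finite ?J" using fK by auto
    show "?A j \<subseteq> {1..r * s}" if j: "j \<in> ?J" for j
    proof -
      obtain K t where Kt: "j = (K, t)" by (cases j)
      have "t < r" using tr j unfolding Kt by blast
      thus ?thesis unfolding Kt using lab_range by auto
    qed
    show "?t ` ?A j = ?A j" if j: "j \<in> ?J" for j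
    proof -
      obtain K t where Kt: "j = (K, t)" by (cases j)
      show ?thesis using tA j unfolding Kt by blast
    qed
    show "disjoint_family_on ?A ?J"
      unfolding disjoint_family_on_def
    proof (intro ballI impI)
      fix j j' assume jj: "j \<in> ?J" "j' \<in> ?J" "j \<noteq> j'"
      obtain K t K' t' where j: "j = (K, t)" "j' = (K', t')" by (meson surj_pair)
      have t: "t < r" "t' < r" using tr[of K t] tr[of K' t'] jj unfolding j by blast+
      show "?A j \<inter> ?A j' = {}"
      proof (rule ccontr)
        assume "?A j \<inter> ?A j' \<noteq> {}"
        then obtain l l' where l: "l < s" "f l = K" "l' < s" "f l' = K'" "a l t = a l' t'"
          unfolding j by auto
        hence "l = l'" "t = t'" using lab_inj[of l t l' t'] t by auto
        thus False using l jj(3) j by simp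
      qed
    qed
  qed
  also have "\<dots> = (\<Prod>(K, t)\<in>?J. sign (restrict_id \<tau> (?L K)))"
  proof (rule prod.cong[OF refl])
    fix j assume j: "j \<in> ?J"
    obtain K t where Kt: "j = (K, t)" by (cases j)
    have perm: "restrict_id \<tau> (?L K) permutes ?L K" by (rule restrict_id_permutes[OF \<tau> inv])
    have "restrict_id ?t (?A (K, t)) = map_permutation (?L K) (\<lambda>l. a l t) (restrict_id \<tau> (?L K))"
    proof
      fix x
      show "restrict_id ?t (?A (K, t)) x = map_permutation (?L K) (\<lambda>l. a l t) (restrict_id \<tau> (?L K)) x"
      proof (cases "x \<in> ?A (K, t)")
        case True
        then obtain l where l: "l \<in> ?L K" "x = a l t" by auto
        have "map_permutation (?L K) (\<lambda>l. a l t) (restrict_id \<tau> (?L K)) (a l t) = a (\<tau> l) t"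
          using map_permutation_apply[OF inj, of K t l] j Kt l by simp
        moreover have "restrict_id ?t (?A (K, t)) x = ?t x" using True by simp
        ultimately show ?thesis using l tr[of K t] j Kt by (simp add: wreathing_perm_eq[OF r a])
      next
        case False
        thus ?thesis by (simp add: map_permutation_def)
      qed
    qed
    moreover have "finite (?L K)" by (rule finite_subset[of _ "{..<s}"]) auto
    ultimately have "sign (restrict_id ?t (?A (K, t))) = sign (restrict_id \<tau> (?L K))"
      using sign_map_permutation[OF inj perm, of t] j Kt by simp
    thus "sign (restrict_id ?t (?A j)) = (case j of (K, t) \<Rightarrow> sign (restrict_id \<tau> (?L K)))"
      by (simp add: Kt)
  qed
  also have "\<dots> = (\<Prod>K\<in>f ` {..<s}. \<Prod>t\<in>K. sign (restrict_id \<tau> (?L K)))"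
    using fK by (intro prod.Sigma[symmetric]) auto
  finally show ?thesis by (simp add: fiber_sign_def)
qed

context
  fixes w :: complex
  assumes w: "\<And>k. w ^ k = 1 \<longleftrightarrow> r dvd k"
begin

lemma root_nonzero: "w \<noteq> 0"
  using w[of r] r by (auto simp: power_0_left)

lemma root_power_eq_iff: "t < r \<Longrightarrow> t' < r \<Longrightarrow> w ^ t = w ^ t' \<longleftrightarrow> t = t'"
proof (induction t t' rule: linorder_wlog)
  case (le t t')
  have "w ^ t' = w ^ t * w ^ (t' - t)" using le by (simp flip: power_add)
  hence "w ^ t = w ^ t' \<longleftrightarrow> r dvd (t' - t)" using root_nonzero w by simp
  thus ?case using le by (auto dest: dvd_imp_le)
qed auto

text \<open>Within a block the entry is a geometric sum of powers of w^(t' - t), which vanishes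
  unless \<open>t = t'\<close>.\<close>

lemma dft_orthogonal:
  assumes "i \<in> {1..r * s}" "j \<in> {1..r * s}"
  shows "(\<Sum>k\<in>{1..r * s}. dft (inverse w) i k * dft w k j) = (if i = j then of_nat r else 0)"
proof -
  obtain l t where i: "l < s" "t < r" "i = a l t" using assms(1) by (rule lab_surj)
  obtain l' t' where j: "l' < s" "t' < r" "j = a l' t'" using assms(2) by (rule lab_surj)
  have "(\<Sum>k\<in>{1..r * s}. dft (inverse w) i k * dft w k j) =
      (\<Sum>m<s. if m = l then (\<Sum>k<r. if l = l' then [:(inverse w ^ t * w ^ t') ^ k:] else 0) else 0)"
    unfolding sum_labelled
    by (intro sum.cong refl) (use i j in \<open>auto simp: dft_eq power_mult power_mult_distrib
      mult.commute[of _ t'] intro!: sum.cong\<close>)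
  also have "\<dots> = (if l = l' then [:\<Sum>k<r. (inverse w ^ t * w ^ t') ^ k:] else 0)"
    using i by (simp add: sum.delta sum_to_poly)
  also have "\<dots> = (if i = j then of_nat r else 0)"
  proof (cases "t = t'")
    case True
    thus ?thesis using i j lab_inj root_nonzero by (simp add: of_nat_poly flip: power_mult_distrib)
  next
    case False
    let ?x = "inverse w ^ t * w ^ t'"
    have "w ^ t * ?x = w ^ t'" using root_nonzero by (simp add: power_inverse)
    hence "?x \<noteq> 1" using False root_power_eq_iff[of t t'] i j by (metis mult.right_neutral)
    moreover have "?x ^ r = (inverse (w ^ r)) ^ t * (w ^ r) ^ t'"
      by (simp add: power_mult_distrib power_inverse mult.commute flip: power_mult)
    hence "?x ^ r = 1" using w[of r] by simp
    ultimately show ?thesis using sum_powers_root_of_unity[of ?x r] False i j lab_inj by simp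
  qed
  finally show ?thesis .
qed

lemma ldet_dft_nonzero: "ldet {1..r * s} (dft (inverse w)) \<noteq> 0"
proof -
  have "ldet {1..r * s} (dft (inverse w)) * ldet {1..r * s} (dft w) =
      ldet {1..r * s} (\<lambda>i j. if i = j then of_nat r else 0)"
    unfolding ldet_mult[OF finite_atLeastAtMost, symmetric] by (rule ldet_cong) (rule dft_orthogonal)
  also have "\<dots> = of_nat r ^ (r * s)" by (simp add: ldet_scalar)
  finally show ?thesis using r by auto
qed

text \<open>The Fourier matrix intertwines the two matrices, \<open>?M\<close> times
  \<open>?U\<close> being \<open>?U\<close> times \<open>?N\<close>: it turns the shift by
  \<open>z l\<close> on a cycle into multiplication by w^(z l * k) and commutes with the wreathing
  permutation. Its determinant is non-zero and can be cancelled.\<close>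

lemma perm_charpoly_diagonalised:
  assumes z: "\<forall>l<s. z l \<in> {0..<int r}" and \<tau>: "\<tau> permutes {..<s}"
  defines "\<tau>' \<equiv> wreathing_perm r s a \<tau>"
  shows "perm_charpoly (r * s) (base_perm r s a z \<circ> \<tau>') =
    ldet {1..r * s} (\<lambda>i j. of_bool (j = i) +
      [:0, case label_of r s a i of (l, k) \<Rightarrow> w ^ (nat (z l) * k):] * of_bool (\<tau>' j = i))"
    (is "_ = ldet ?S ?N")
proof -
  let ?h = "base_perm r s a z \<circ> \<tau>'"
  let ?M = "\<lambda>i j. of_bool (j = i) + [:0, 1:] * of_bool (?h j = i) :: complex poly"
  let ?U = "dft (inverse w)"
  have hp: "?h permutes ?S" unfolding \<tau>'_def
    by (intro permutes_compose wreathing_permutes base_permutes \<tau>)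
  have "(\<Sum>k\<in>?S. ?M i k * ?U k j) = (\<Sum>k\<in>?S. ?U i k * ?N k j)"
    if i: "i \<in> ?S" and j: "j \<in> ?S" for i j
  proof -
    \<comment> \<open>Row \<open>i\<close> of \<open>?M\<close> has non-zero entries only in column
      \<open>i\<close> and in column \<open>i0\<close>, the preimage of \<open>i\<close>.\<close>
    obtain i0 where i0: "i0 \<in> ?S" "i = ?h i0" using i permutes_image[OF hp] by (metis imageE)
    obtain l t where lt: "l < s" "t < r" "i0 = a l t" using i0(1) by (rule lab_surj)
    obtain l' t' where lt': "l' < s" "t' < r" "j = a l' t'" using j by (rule lab_surj)
    have l\<tau>: "\<tau> l < s" "\<tau> l' < s" using lt lt' permutes_in_image[OF \<tau>] by auto
    have \<tau>j: "\<tau>' j = a (\<tau> l') t'" using lt' by (simp add: \<tau>'_def wreathing_perm_eq[OF r a])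
    have \<tau>j_in: "\<tau>' j \<in> ?S" using \<tau>j lab_range l\<tau> lt' by simp
    define u where "u = nat (z (\<tau> l))"
    have zu: "z (\<tau> l) = int u" using z l\<tau> by (simp add: u_def)
    have i_eq: "i = a (\<tau> l) ((t + u) mod r)"
    proof -
      have "nat ((int t + z (\<tau> l)) mod int r) = (t + u) mod r"
        unfolding zu by (metis nat_int of_nat_add of_nat_mod)
      thus ?thesis using base_wreathing_eq[OF r a \<tau> lt(1,2), of z] i0 lt by (simp add: \<tau>'_def)
    qed
    have "(\<Sum>k\<in>?S. ?M i k * ?U k j) =
        (\<Sum>k\<in>?S. if k = i then ?U k j else 0) + [:0, 1:] * (\<Sum>k\<in>?S. if k = i0 then ?U k j else 0)"
    proof -
      have "?h k = i \<longleftrightarrow> k = i0" for k using i0 permutes_inj[OF hp] by (metis injD)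
      thus ?thesis unfolding sum_distrib_left sum.distrib[symmetric]
        by (intro sum.cong) (auto simp: distrib_right)
    qed
    also have "\<dots> = ?U i j + [:0, 1:] * ?U i0 j" using i i0 by (simp add: sum.delta)
    also have "[:0, 1:] * ?U i0 j = ?U i (\<tau>' j) * [:0, w ^ (nat (z (\<tau> l')) * t'):]"
    proof (cases "l = l'")
      case True
      \<comment> \<open>Shifting the row index by \<open>u\<close> multiplies the Fourier entry in
        column \<open>t'\<close> by w^(-u t'), which the diagonal entry undoes; reduction modulo
        \<open>r\<close> is harmless since w^r = 1.\<close>
      have "inverse w ^ ((t + u) mod r * t') * w ^ (u * t') = inverse w ^ (t * t')"
      proof -
        have "inverse w ^ ((t + u) mod r * t') = inverse ((w ^ (t + u)) ^ t')"
          by (simp add: power_mult power_inverse power_mod_root w)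
        also have "\<dots> = inverse (w ^ (t * t')) * inverse (w ^ (u * t'))"
          by (simp add: power_mult power_add power_mult_distrib)
        finally show ?thesis using root_nonzero by (simp add: power_inverse)
      qed
      thus ?thesis using True lt lt' l\<tau> r i_eq \<tau>j by (simp add: dft_eq u_def mult.commute)
    next
      case False
      hence "\<tau> l \<noteq> \<tau> l'" using permutes_inj[OF \<tau>] by (auto dest: injD)
      thus ?thesis using False lt lt' l\<tau> r i_eq \<tau>j by (simp add: dft_eq)
    qed
    also have "?U i j + ?U i (\<tau>' j) * [:0, w ^ (nat (z (\<tau> l')) * t'):] =
        (\<Sum>k\<in>?S. if k = j then ?U i k else 0) +
        (\<Sum>k\<in>?S. if k = \<tau>' j then ?U i k * [:0, case label_of r s a k of (l, k) \<Rightarrow> w ^ (nat (z l) * k):] else 0)"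
    proof -
      have "label_of r s a (\<tau>' j) = (\<tau> l', t')" using \<tau>j l\<tau> lt' by (simp add: lab_eq)
      thus ?thesis using j \<tau>j_in by (simp add: sum.delta)
    qed
    also have "\<dots> = (\<Sum>k\<in>?S. ?U i k * ?N k j)"
      unfolding sum.distrib[symmetric] by (intro sum.cong) (auto simp: algebra_simps)
    finally show ?thesis .
  qed
  hence "ldet ?S (\<lambda>i j. \<Sum>k\<in>?S. ?M i k * ?U k j) = ldet ?S (\<lambda>i j. \<Sum>k\<in>?S. ?U i k * ?N k j)"
    by (intro ldet_cong)
  hence "ldet ?S ?M * ldet ?S ?U = ldet ?S ?U * ldet ?S ?N"
    by (simp only: ldet_mult[OF finite_atLeastAtMost])
  thus ?thesis using ldet_dft_nonzero unfolding perm_charpoly_def by simp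
qed

lemma prod_monomials:
  "finite K \<Longrightarrow> (\<Prod>t\<in>K. [:0, w ^ (u * t):]) = [:w ^ (u * \<Sum>K):] * [:0, 1:] ^ card K"
  by (induction K rule: finite_induct) (auto simp: power_add algebra_simps)

text \<open>In the Fourier coordinates the exterior algebra has a basis indexed by colourings
  \<open>f\<close> of the cycles by subsets of Z/r. The base group scales each basis element, \<tau>
  permutes them up to sign, and only the colourings fixed by \<tau> contribute to the trace.\<close>

lemma perm_charpoly_expand:
  assumes z: "\<forall>l<s. z l \<in> {0..<int r}" and \<tau>: "\<tau> permutes {..<s}"
  shows "perm_charpoly (r * s) (base_perm r s a z \<circ> wreathing_perm r s a \<tau>) =
    (\<Sum>f | f \<in> {..<s} \<rightarrow>\<^sub>E Pow {..<r} \<and> (\<forall>l<s. f (\<tau> l) = f l).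
       of_int (fiber_sign s card \<tau> f) *
       ([:\<Prod>l<s. w ^ (nat (z l) * \<Sum>(f l)):] * [:0, 1:] ^ (\<Sum>l<s. card (f l))))"
proof -
  let ?t = "wreathing_perm r s a \<tau>"
  let ?c = "\<lambda>i. [:0, case label_of r s a i of (l, k) \<Rightarrow> w ^ (nat (z l) * k):]"
  have "perm_charpoly (r * s) (base_perm r s a z \<circ> ?t) =
      (\<Sum>A | A \<subseteq> {1..r * s} \<and> ?t ` A = A. of_int (sign (restrict_id ?t A)) * (\<Prod>i\<in>A. ?c i))"
    unfolding perm_charpoly_diagonalised[OF z \<tau>]
    by (rule ldet_one_plus_monomial[OF finite_atLeastAtMost wreathing_permutes[OF \<tau>]])
  also have "\<dots> = (\<Sum>f | f \<in> {..<s} \<rightarrow>\<^sub>E Pow {..<r} \<and> (\<forall>l<s. f (\<tau> l) = f l).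
       of_int (fiber_sign s card \<tau> f) *
       ([:\<Prod>l<s. w ^ (nat (z l) * \<Sum>(f l)):] * [:0, 1:] ^ (\<Sum>l<s. card (f l))))"
  proof (rule sum.reindex_bij_witness[where i=glue and j=slices])
    fix A assume A: "A \<in> {A. A \<subseteq> {1..r * s} \<and> ?t ` A = A}"
    show gs: "glue (slices A) = A" using A glue_slices by auto
    have f: "slices A \<in> {..<s} \<rightarrow>\<^sub>E Pow {..<r}" by (auto simp: slices_def)
    thus mem: "slices A \<in> {f. f \<in> {..<s} \<rightarrow>\<^sub>E Pow {..<r} \<and> (\<forall>l<s. f (\<tau> l) = f l)}"
      using A glue_invariant_iff[OF \<tau> f] gs by auto
    let ?f = "slices A"
    have sub: "?f l \<subseteq> {..<r}" if "l < s" for l using that by (auto simp: slices_def)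
    have fin: "finite (?f l)" if "l < s" for l using sub[OF that] finite_subset by blast
    have "inj_on (\<lambda>(l, t). a l t) (SIGMA l:{..<s}. ?f l)"
      by (rule inj_on_subset[of _ "{..<s} \<times> {..<r}"])
        (use a sub in \<open>auto simp: cycle_labelling_def bij_betw_def\<close>)
    hence "(\<Prod>i\<in>glue ?f. ?c i) = (\<Prod>(l, t)\<in>(SIGMA l:{..<s}. ?f l). ?c (a l t))"
      unfolding glue_def by (subst prod.reindex) (auto simp: case_prod_unfold)
    also have "\<dots> = (\<Prod>l<s. \<Prod>t\<in>?f l. ?c (a l t))"
      using fin by (intro prod.Sigma[symmetric]) auto
    also have "\<dots> = (\<Prod>l<s. \<Prod>t\<in>?f l. [:0, w ^ (nat (z l) * t):])"
      using sub by (intro prod.cong refl) (auto simp: lab_eq subset_iff)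
    also have "\<dots> = (\<Prod>l<s. [:w ^ (nat (z l) * \<Sum>(?f l)):] * [:0, 1:] ^ card (?f l))"
      using fin by (intro prod.cong refl prod_monomials) auto
    also have "\<dots> = [:\<Prod>l<s. w ^ (nat (z l) * \<Sum>(?f l)):] * [:0, 1:] ^ (\<Sum>l<s. card (?f l))"
      by (simp only: prod.distrib prod_to_poly power_sum)
    finally show "of_int (fiber_sign s card \<tau> ?f) *
        ([:\<Prod>l<s. w ^ (nat (z l) * \<Sum>(?f l)):] * [:0, 1:] ^ (\<Sum>l<s. card (?f l))) =
        of_int (sign (restrict_id ?t A)) * (\<Prod>i\<in>A. ?c i)"
      using sign_glue[OF \<tau> f] mem unfolding gs by simp
  next
    fix f assume "f \<in> {f. f \<in> {..<s} \<rightarrow>\<^sub>E Pow {..<r} \<and> (\<forall>l<s. f (\<tau> l) = f l)}"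
    hence f: "f \<in> {..<s} \<rightarrow>\<^sub>E Pow {..<r}" "\<forall>l<s. f (\<tau> l) = f l" by auto
    show "slices (glue f) = f" by (rule slices_glue[OF f(1)])
    show "glue f \<in> {A. A \<subseteq> {1..r * s} \<and> ?t ` A = A}"
      using glue_subset[OF f(1)] glue_invariant_iff[OF \<tau> f(1)] f(2) by auto
  qed
  finally show ?thesis .
qed

end

end

section \<open>Parametrising the centralizer and averaging over the base group\<close>

lemma base_perm_restrict:
  assumes "r \<ge> 1" "cycle_labelling r s a"
  shows "base_perm r s a (restrict z {..<s}) = base_perm r s a z"
proof
  fix x
  show "base_perm r s a (restrict z {..<s}) x = base_perm r s a z x"
  proof (cases "x \<in> {1..r * s}")
    case True
    then obtain l t where "l < s" "t < r" "x = a l t" by (rule labelling_surj[OF assms])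
    thus ?thesis by (simp add: base_perm_eq[OF assms])
  next
    case False
    thus ?thesis by (simp only: base_perm_def False if_False)
  qed
qed

lemma base_wreathing_in_centralizer:
  assumes r: "r \<ge> 1" and a: "cycle_labelling r s a" and \<tau>: "\<tau> permutes {..<s}"
  shows "base_perm r s a z \<circ> wreathing_perm r s a \<tau> \<in>
    centralizer (sym_group (r * s)) (cycles_perm r s a)"
proof -
  let ?g = "base_perm r s a z \<circ> wreathing_perm r s a \<tau>" and ?\<pi> = "cycles_perm r s a"
  have "?g permutes {1..r * s}"
    by (intro permutes_compose base_permutes[OF r a] wreathing_permutes[OF r a] \<tau>)
  moreover have "(?g \<circ> ?\<pi>) x = (?\<pi> \<circ> ?g) x" for x
  proof (cases "x \<in> {1..r * s}")
    case True
    then obtain l t where lt: "l < s" "t < r" "x = a l t" by (rule labelling_surj[OF r a])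
    have l': "\<tau> l < s" using permutes_in_image[OF \<tau>, of l] lt by simp
    have "?\<pi> x = a l (nat ((int t + 1) mod int r))"
      using lt by (simp add: cycles_perm_def base_perm_eq[OF r a])
    hence "(?g \<circ> ?\<pi>) x = a (\<tau> l) (nat ((int t + 1 + z (\<tau> l)) mod int r))"
      using base_wreathing_eq[OF r a \<tau> lt(1) shift_less[OF r a], of z "int t + 1"] r
      by (simp add: mod_simps)
    moreover have "?g x = a (\<tau> l) (nat ((int t + z (\<tau> l)) mod int r))"
      using base_wreathing_eq[OF r a \<tau> lt(1,2), of z] lt by simp
    hence "(?\<pi> \<circ> ?g) x = a (\<tau> l) (nat ((int t + z (\<tau> l) + 1) mod int r))"
      using base_perm_eq[OF r a l' shift_less[OF r a], of "\<lambda>_. 1" "int t + z (\<tau> l)"] r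
      by (simp add: cycles_perm_def mod_simps)
    ultimately show ?thesis by (simp add: add_ac)
  next
    case False
    moreover have "?\<pi> x = x" by (simp only: cycles_perm_def base_perm_def False if_False)
    ultimately show ?thesis using base_wreathing_outside[OF r a False, of z \<tau>] by simp
  qed
  ultimately show ?thesis by (auto simp: centralizer_def sym_group_def fun_eq_iff)
qed

text \<open>The images of the entries \<open>a l 0\<close> recover both \<tau> and \<open>z\<close>,
  once \<open>z\<close> is normalised to residues in \<open>{0..<int r}\<close> and to an
  extensional function.\<close>

lemma bij_betw_centralizer:
  assumes r: "r \<ge> 1" and a: "cycle_labelling r s a"
  shows "bij_betw (\<lambda>(z, \<tau>). base_perm r s a z \<circ> wreathing_perm r s a \<tau>)
    (({..<s} \<rightarrow>\<^sub>E {0..<int r}) \<times> {\<tau>. \<tau> permutes {..<s}})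
    (centralizer (sym_group (r * s)) (cycles_perm r s a))"
proof -
  let ?F = "\<lambda>(z, \<tau>). base_perm r s a z \<circ> wreathing_perm r s a \<tau>"
  let ?D = "({..<s} \<rightarrow>\<^sub>E {0..<int r}) \<times> {\<tau>. \<tau> permutes {..<s}}"
  let ?C = "centralizer (sym_group (r * s)) (cycles_perm r s a)"
  have "inj_on ?F ?D"
  proof (rule inj_onI, clarify)
    fix z \<tau> z' \<tau>'
    assume z: "z \<in> {..<s} \<rightarrow>\<^sub>E {0..<int r}" and z': "z' \<in> {..<s} \<rightarrow>\<^sub>E {0..<int r}"
      and \<tau>: "\<tau> permutes {..<s}" and \<tau>': "\<tau>' permutes {..<s}"
      and eq: "base_perm r s a z \<circ> wreathing_perm r s a \<tau> = base_perm r s a z' \<circ> wreathing_perm r s a \<tau>'"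
    have *: "\<tau> l = \<tau>' l \<and> z (\<tau> l) = z' (\<tau> l)" if l: "l < s" for l
    proof -
      have ls: "\<tau> l < s" "\<tau>' l < s"
        using permutes_in_image[OF \<tau>, of l] permutes_in_image[OF \<tau>', of l] l by auto
      have "a (\<tau> l) (nat (z (\<tau> l) mod int r)) = a (\<tau>' l) (nat (z' (\<tau>' l) mod int r))"
        using base_wreathing_eq[OF r a \<tau>, of l 0 z] base_wreathing_eq[OF r a \<tau>', of l 0 z'] l r eq
        by simp
      hence "\<tau> l = \<tau>' l" "nat (z (\<tau> l) mod int r) = nat (z' (\<tau>' l) mod int r)"
        using labelling_inj[OF r a, of "\<tau> l" _ "\<tau>' l"] shift_less[OF r a] ls by auto
      moreover have "z (\<tau> l) \<in> {0..<int r}" "z' (\<tau> l) \<in> {0..<int r}"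
        using z z' ls by (auto simp: PiE_def Pi_def)
      ultimately show ?thesis by (auto simp: eq_nat_nat_iff)
    qed
    have "\<tau> l = \<tau>' l" for l
      using * permutes_not_in[OF \<tau>, of l] permutes_not_in[OF \<tau>', of l] by (cases "l < s") auto
    moreover have "z m = z' m" for m
    proof (cases "m < s")
      case True
      then obtain l where "l < s" "m = \<tau> l"
        using permutes_image[OF \<tau>] by (metis imageE lessThan_iff)
      thus ?thesis using * by blast
    next
      case False
      thus ?thesis using z z' by (auto simp: PiE_def extensional_def)
    qed
    ultimately show "z = z' \<and> \<tau> = \<tau>'" by blast
  qed
  moreover have "?F ` ?D = ?C"
  proof
    show "?F ` ?D \<subseteq> ?C" using base_wreathing_in_centralizer[OF r a] by auto
    show "?C \<subseteq> ?F ` ?D"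
    proof
      fix g assume "g \<in> ?C"
      then obtain z \<tau> where z: "\<forall>l<s. z l \<in> carrier (integer_mod_group r)" and \<tau>: "\<tau> permutes {..<s}"
        and g: "g = base_perm r s a z \<circ> wreathing_perm r s a \<tau>"
        by (rule centralizer_decompose[OF r a])
      have "(restrict z {..<s}, \<tau>) \<in> ?D" using z \<tau> by (auto simp: carrier_cyclic[OF r a])
      moreover have "g = ?F (restrict z {..<s}, \<tau>)" using g base_perm_restrict[OF r a] by simp
      ultimately show "g \<in> ?F ` ?D" by blast
    qed
  qed
  ultimately show ?thesis by (simp add: bij_betw_def)
qed

lemma sum_root_powers:
  fixes w :: complex
  assumes w: "\<And>k. w ^ k = 1 \<longleftrightarrow> r dvd k"
  shows "(\<Sum>u\<in>{0..<int r}. w ^ (nat u * m)) = (if r dvd m then of_nat r else 0)"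
proof -
  have "(\<Sum>u\<in>{0..<int r}. w ^ (nat u * m)) = (\<Sum>k<r. (w ^ m) ^ k)"
    by (rule sum.reindex_bij_witness[where i=int and j=nat]) (auto simp: power_mult mult.commute simp flip: power_mult)
  also have "\<dots> = (if r dvd m then of_nat r else 0)"
  proof (cases "r dvd m")
    case True
    thus ?thesis using w[of m] by simp
  next
    case False
    have "(w ^ m) ^ r = 1" using w[of "m * r"] by (simp add: power_mult)
    thus ?thesis using False w[of m] sum_powers_root_of_unity[of "w ^ m" r] by simp
  qed
  finally show ?thesis .
qed

text \<open>The sets \<open>K\<close> for which w^(z sum K) is inverse to the value w^z of the
  linear character, for every z. The \<open>Suc\<close> is the contribution of that
  character.\<close>

definition residue_sets :: "nat \<Rightarrow> nat set set" where
  "residue_sets r = {K. K \<subseteq> {..<r} \<and> r dvd Suc (\<Sum>K)}"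

text \<open>The sum over the base group factorises over the cycles and equals r^s if every
  \<open>f l\<close> is a residue set, and 0 otherwise. Since the centralizer has order r^s s!, only
  the normalisation 1/s! of the average over \<tau> remains.\<close>

lemma hook_poly_eq_sum_colourings:
  assumes r: "r \<ge> 1" and s: "s \<ge> 1" and a: "cycle_labelling r s a"
    and \<zeta>: "faithful_linear_character r \<zeta>"
  shows "[:1, 1:] * hook_poly r s a \<zeta> = smult (1 / fact s)
    (\<Sum>\<tau> | \<tau> permutes {..<s}. \<Sum>f | f \<in> {..<s} \<rightarrow>\<^sub>E residue_sets r \<and> (\<forall>l<s. f (\<tau> l) = f l).
       of_int (fiber_sign s card \<tau> f) * [:0, 1:] ^ (\<Sum>l<s. card (f l)))"
proof -
  obtain w where w: "\<And>k. w ^ k = 1 \<longleftrightarrow> r dvd k" and \<zeta>w: "\<And>z. z \<in> {0..<int r} \<Longrightarrow> \<zeta> z = w ^ nat z"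
    by (rule faithful_linear_character_root[OF r \<zeta>]) blast
  let ?Z = "{..<s} \<rightarrow>\<^sub>E {0..<int r}" and ?T = "{\<tau>. \<tau> permutes {..<s}}"
  let ?C = "centralizer (sym_group (r * s)) (cycles_perm r s a)"
  let ?F = "\<lambda>z \<tau>. base_perm r s a z \<circ> wreathing_perm r s a \<tau>"
  let ?P = "\<lambda>\<tau>. {f. f \<in> {..<s} \<rightarrow>\<^sub>E Pow {..<r} \<and> (\<forall>l<s. f (\<tau> l) = f l)}"
  let ?R = "\<lambda>\<tau>. {f. f \<in> {..<s} \<rightarrow>\<^sub>E residue_sets r \<and> (\<forall>l<s. f (\<tau> l) = f l)}"
  let ?X = "\<lambda>\<tau> f. of_int (fiber_sign s card \<tau> f) * [:0, 1:] ^ (\<Sum>l<s. card (f l)) :: complex poly"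
  have fP: "finite (?P \<tau>)" for \<tau>
    by (rule finite_subset[of _ "{..<s} \<rightarrow>\<^sub>E Pow {..<r}"]) (auto intro: finite_PiE)
  have zsum: "(\<Sum>z\<in>?Z. [:\<Prod>l<s. w ^ nat (z l):] * [:\<Prod>l<s. w ^ (nat (z l) * \<Sum>(f l)):]) =
      (if f \<in> {..<s} \<rightarrow>\<^sub>E residue_sets r then of_nat (r ^ s) else 0 :: complex poly)"
    if f: "f \<in> {..<s} \<rightarrow>\<^sub>E Pow {..<r}" for f
  proof -
    have "(\<Sum>z\<in>?Z. [:\<Prod>l<s. w ^ nat (z l):] * [:\<Prod>l<s. w ^ (nat (z l) * \<Sum>(f l)):]) =
        [:\<Sum>z\<in>?Z. \<Prod>l<s. w ^ (nat (z l) * Suc (\<Sum>(f l))):]"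
      by (simp add: power_add prod.distrib mult.commute flip: sum_to_poly)
    also have "(\<Sum>z\<in>?Z. \<Prod>l<s. w ^ (nat (z l) * Suc (\<Sum>(f l)))) =
        (\<Prod>l<s. \<Sum>u\<in>{0..<int r}. w ^ (nat u * Suc (\<Sum>(f l))))"
      by (rule prod_sum_PiE[symmetric]) auto
    also have "\<dots> = (\<Prod>l<s. if r dvd Suc (\<Sum>(f l)) then of_nat r else 0)"
      by (intro prod.cong refl sum_root_powers w)
    also have "\<dots> = (if f \<in> {..<s} \<rightarrow>\<^sub>E residue_sets r then of_nat (r ^ s) else 0)"
    proof (cases "f \<in> {..<s} \<rightarrow>\<^sub>E residue_sets r")
      case True
      hence "r dvd Suc (\<Sum>(f l))" if "l < s" for l
        using that by (auto simp: residue_sets_def PiE_def Pi_def)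
      thus ?thesis using True by simp
    next
      case False
      then obtain l where "l < s" "\<not> r dvd Suc (\<Sum>(f l))"
        using f by (auto simp: residue_sets_def PiE_def Pi_def)
      thus ?thesis using False by (auto intro!: prod_zero bexI[of _ l])
    qed
    finally show ?thesis by (simp add: of_nat_poly)
  qed
  have "(\<Sum>h\<in>?C. smult (wreath_character r s a \<zeta> h) (perm_charpoly (r * s) h)) =
      (\<Sum>(z, \<tau>)\<in>?Z \<times> ?T. smult (wreath_character r s a \<zeta> (?F z \<tau>)) (perm_charpoly (r * s) (?F z \<tau>)))"
    using sum.reindex_bij_betw[OF bij_betw_centralizer[OF r a], symmetric] by (simp add: case_prod_unfold)
  also have "\<dots> = (\<Sum>z\<in>?Z. \<Sum>\<tau>\<in>?T. smult (wreath_character r s a \<zeta> (?F z \<tau>)) (perm_charpoly (r * s) (?F z \<tau>)))"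
    by (rule sum.cartesian_product[symmetric])
  also have "\<dots> = (\<Sum>z\<in>?Z. \<Sum>\<tau>\<in>?T. \<Sum>f\<in>?P \<tau>.
      ([:\<Prod>l<s. w ^ nat (z l):] * [:\<Prod>l<s. w ^ (nat (z l) * \<Sum>(f l)):]) * ?X \<tau> f)"
  proof (intro sum.cong refl)
    fix z \<tau> assume z: "z \<in> ?Z" and \<tau>: "\<tau> \<in> ?T"
    have zl: "\<forall>l<s. z l \<in> {0..<int r}" using z by (auto simp: PiE_def Pi_def)
    have "wreath_character r s a \<zeta> (?F z \<tau>) = (\<Prod>l<s. \<zeta> (z l))"
      using zl \<tau> by (intro wreath_character_eq[OF r a]) (auto simp: carrier_cyclic[OF r a])
    also have "\<dots> = (\<Prod>l<s. w ^ nat (z l))" using zl \<zeta>w by (intro prod.cong) auto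
    finally have "smult (wreath_character r s a \<zeta> (?F z \<tau>)) (perm_charpoly (r * s) (?F z \<tau>)) =
        [:\<Prod>l<s. w ^ nat (z l):] * perm_charpoly (r * s) (?F z \<tau>)" by simp
    also have "\<dots> = (\<Sum>f\<in>?P \<tau>.
        ([:\<Prod>l<s. w ^ nat (z l):] * [:\<Prod>l<s. w ^ (nat (z l) * \<Sum>(f l)):]) * ?X \<tau> f)"
      unfolding perm_charpoly_expand[OF r a w zl \<tau>[unfolded mem_Collect_eq]]
      by (rule trans[OF sum_distrib_left], intro sum.cong refl, simp only: mult_ac)
    finally show "smult (wreath_character r s a \<zeta> (?F z \<tau>)) (perm_charpoly (r * s) (?F z \<tau>)) =
       (\<Sum>f\<in>?P \<tau>. ([:\<Prod>l<s. w ^ nat (z l):] * [:\<Prod>l<s. w ^ (nat (z l) * \<Sum>(f l)):]) * ?X \<tau> f)" .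
  qed
  also have "\<dots> = (\<Sum>\<tau>\<in>?T. \<Sum>f\<in>?P \<tau>. (\<Sum>z\<in>?Z.
      [:\<Prod>l<s. w ^ nat (z l):] * [:\<Prod>l<s. w ^ (nat (z l) * \<Sum>(f l)):]) * ?X \<tau> f)"
    by (subst sum.swap, rule sum.cong[OF refl], subst sum.swap) (simp only: sum_distrib_right)
  also have "\<dots> = (\<Sum>\<tau>\<in>?T. \<Sum>f\<in>?P \<tau>. if f \<in> {..<s} \<rightarrow>\<^sub>E residue_sets r then of_nat (r ^ s) * ?X \<tau> f else 0)"
    by (intro sum.cong refl) (subst zsum, auto)
  also have "\<dots> = (\<Sum>\<tau>\<in>?T. \<Sum>f\<in>?R \<tau>. of_nat (r ^ s) * ?X \<tau> f)"
  proof (rule sum.cong[OF refl])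
    fix \<tau>
    have "?R \<tau> = {f \<in> ?P \<tau>. f \<in> {..<s} \<rightarrow>\<^sub>E residue_sets r}"
      by (auto simp: residue_sets_def PiE_def Pi_def)
    thus "(\<Sum>f\<in>?P \<tau>. if f \<in> {..<s} \<rightarrow>\<^sub>E residue_sets r then of_nat (r ^ s) * ?X \<tau> f else 0) =
        (\<Sum>f\<in>?R \<tau>. of_nat (r ^ s) * ?X \<tau> f)"
      using sum.inter_filter[OF fP[of \<tau>], of "\<lambda>f. of_nat (r ^ s) * ?X \<tau> f"
          "\<lambda>f. f \<in> {..<s} \<rightarrow>\<^sub>E residue_sets r"] by simp
  qed
  also have "\<dots> = smult (of_nat (r ^ s)) (\<Sum>\<tau>\<in>?T. \<Sum>f\<in>?R \<tau>. ?X \<tau> f)"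
    by (simp only: sum_distrib_left[symmetric] of_nat_poly) simp
  finally have sum: "(\<Sum>h\<in>?C. smult (wreath_character r s a \<zeta> h) (perm_charpoly (r * s) h)) =
      smult (of_nat (r ^ s)) (\<Sum>\<tau>\<in>?T. \<Sum>f\<in>?R \<tau>. ?X \<tau> f)" .
  have "card ?C = r ^ s * fact s"
    using bij_betw_same_card[OF bij_betw_centralizer[OF r a]]
    by (simp add: card_cartesian_product card_PiE card_permutations)
  hence "smult (1 / of_nat (card ?C)) (smult (of_nat (r ^ s)) Q) = smult (1 / fact s) Q" for Q :: "complex poly"
    using r by (simp add: field_simps)
  moreover have "r * s \<ge> 1" using r s by simp
  ultimately show ?thesis
    using hook_poly_eq_sum_charpoly[of r s a \<zeta>] unfolding sum by simp
qed

section \<open>Symmetric powers of graded sets\<close>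

text \<open>Monomials of degree \<open>s\<close> in generators \<open>K \<in> G\<close> of degree \<open>d K\<close>, the odd ones anticommuting.\<close>

definition super_multisets :: "('k \<Rightarrow> nat) \<Rightarrow> 'k set \<Rightarrow> nat \<Rightarrow> 'k multiset set" where
  "super_multisets d G s =
     {c. set_mset c \<subseteq> G \<and> size c = s \<and> (\<forall>K\<in>G. odd (d K) \<longrightarrow> count c K \<le> 1)}"

lemma finite_super_multisets: "finite G \<Longrightarrow> finite (super_multisets d G s)"
  unfolding super_multisets_def
  by (rule finite_subset[OF _ finite_multisets_of_size[of G s]]) (auto simp: multisets_of_size_def)

definition colour_stabilizer :: "nat \<Rightarrow> (nat \<Rightarrow> 'k) \<Rightarrow> (nat \<Rightarrow> nat) set" where
  "colour_stabilizer s f = {\<tau>. \<tau> permutes {..<s} \<and> (\<forall>l<s. f (\<tau> l) = f l)}"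

definition colour_mset :: "nat \<Rightarrow> (nat \<Rightarrow> 'k) \<Rightarrow> 'k multiset" where
  "colour_mset s f = image_mset f (mset_set {..<s})"

lemma count_colour_mset: "count (colour_mset s f) K = card {l. l < s \<and> f l = K}"
proof -
  have "{l. l < s \<and> f l = K} = f -` {K} \<inter> {..<s}" by auto
  thus ?thesis by (simp add: colour_mset_def count_image_mset)
qed

text \<open>An even degree squares the sign away, and a colour of odd degree occurs only once, so
  \<tau> is trivial on its fibre.\<close>

lemma fiber_sign_eq_1:
  assumes "\<And>K. K \<in> f ` {..<s} \<Longrightarrow> odd (d K) \<Longrightarrow> count (colour_mset s f) K \<le> 1"
    and \<tau>: "\<tau> \<in> colour_stabilizer s f"
  shows "fiber_sign s d \<tau> f = 1"
  unfolding fiber_sign_def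
proof (rule prod.neutral, rule ballI)
  fix K assume K: "K \<in> f ` {..<s}"
  let ?L = "{l. l < s \<and> f l = K}"
  show "sign (restrict_id \<tau> ?L) ^ d K = 1"
  proof (cases "even (d K)")
    case True
    have "sign (restrict_id \<tau> ?L) = 1 \<or> sign (restrict_id \<tau> ?L) = -1" by (simp add: sign_def)
    thus ?thesis using True by auto
  next
    case False
    hence "card ?L \<le> 1" using assms(1)[OF K] by (simp add: count_colour_mset)
    have perm: "restrict_id \<tau> ?L permutes ?L"
      using \<tau> by (intro restrict_id_permutes[of _ "{..<s}"] fiber_permutes) (auto simp: colour_stabilizer_def)
    obtain l where "l < s" "f l = K" using K by auto
    moreover have "finite ?L" by (rule finite_subset[of _ "{..<s}"]) auto
    ultimately have "?L = {l}" using \<open>card ?L \<le> 1\<close> by (auto simp: card_le_Suc0_iff_eq)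
    hence "restrict_id \<tau> ?L = id" using perm by simp
    thus ?thesis by simp
  qed
qed

text \<open>Composition with the transposition of two positions of the odd colour \<open>K\<close>
  is an involution of the stabilizer. It changes the sign on the fibre of \<open>K\<close> only, and
  the odd exponent retains this change, so the terms cancel.\<close>

lemma sum_fiber_sign_eq_0:
  assumes K: "odd (d K)" "count (colour_mset s f) K > 1"
  shows "(\<Sum>\<tau>\<in>colour_stabilizer s f. fiber_sign s d \<tau> f) = 0"
proof -
  let ?L = "\<lambda>K. {l. l < s \<and> f l = K}"
  have "\<not> card (?L K) \<le> Suc 0" using K(2) by (simp add: count_colour_mset)
  moreover have "finite (?L K)" by (rule finite_subset[of _ "{..<s}"]) auto
  ultimately obtain l l' where l: "l \<in> ?L K" "l' \<in> ?L K" "l \<noteq> l'"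
    by (auto simp: card_le_Suc0_iff_eq)
  let ?t = "transpose l l'"
  have ft: "f (?t m) = f m" for m using l by (auto simp: transpose_def)
  have tp: "?t permutes {..<s}" using l by (intro permutes_swap_id) auto
  have ts: "?t m < s \<longleftrightarrow> m < s" for m using permutes_in_image[OF tp] by simp
  have stab: "\<tau> \<circ> ?t \<in> colour_stabilizer s f" if "\<tau> \<in> colour_stabilizer s f" for \<tau>
    using that permutes_compose[OF tp] ft ts by (auto simp: colour_stabilizer_def)
  have "(\<Sum>\<tau>\<in>colour_stabilizer s f. fiber_sign s d \<tau> f) =
      (\<Sum>\<tau>\<in>colour_stabilizer s f. fiber_sign s d (\<tau> \<circ> ?t) f)"
    by (rule sum.reindex_bij_witness[where i="\<lambda>\<tau>. \<tau> \<circ> ?t" and j="\<lambda>\<tau>. \<tau> \<circ> ?t"])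
      (auto simp: stab comp_assoc)
  also have "\<dots> = (\<Sum>\<tau>\<in>colour_stabilizer s f. - fiber_sign s d \<tau> f)"
  proof (rule sum.cong[OF refl])
    fix \<tau> assume \<tau>: "\<tau> \<in> colour_stabilizer s f"
    have other: "restrict_id (\<tau> \<circ> ?t) (?L K') = restrict_id \<tau> (?L K')" if "K' \<noteq> K" for K'
    proof
      fix m
      have "?t m = m" if "m \<in> ?L K'" using that \<open>K' \<noteq> K\<close> l by (auto simp: transpose_def)
      thus "restrict_id (\<tau> \<circ> ?t) (?L K') m = restrict_id \<tau> (?L K') m"
        by (cases "m \<in> ?L K'") simp_all
    qed
    have e: "restrict_id (\<tau> \<circ> ?t) (?L K) = restrict_id \<tau> (?L K) \<circ> ?t"
    proof
      fix m
      have "?t m \<in> ?L K \<longleftrightarrow> m \<in> ?L K" using ft ts by simp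
      moreover have "?t m = m" if "m \<notin> ?L K" using that l by (auto simp: transpose_def)
      ultimately show "restrict_id (\<tau> \<circ> ?t) (?L K) m = (restrict_id \<tau> (?L K) \<circ> ?t) m"
        by (cases "m \<in> ?L K") simp_all
    qed
    have perm: "permutation (restrict_id \<tau> (?L K))"
      using \<tau> \<open>finite (?L K)\<close>
      by (intro permutes_imp_permutation[of "?L K"] restrict_id_permutes[of _ "{..<s}"] fiber_permutes)
        (auto simp: colour_stabilizer_def)
    have sgn: "sign (restrict_id (\<tau> \<circ> ?t) (?L K)) = - sign (restrict_id \<tau> (?L K))"
      unfolding e sign_compose[OF perm permutation_swap_id] sign_swap_id using l(3) by simp
    have Kf: "K \<in> f ` {..<s}" using l by auto
    have "fiber_sign s d (\<tau> \<circ> ?t) f = sign (restrict_id (\<tau> \<circ> ?t) (?L K)) ^ d K *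
        (\<Prod>K'\<in>f ` {..<s} - {K}. sign (restrict_id (\<tau> \<circ> ?t) (?L K')) ^ d K')"
      unfolding fiber_sign_def using Kf by (intro prod.remove) auto
    also have "(\<Prod>K'\<in>f ` {..<s} - {K}. sign (restrict_id (\<tau> \<circ> ?t) (?L K')) ^ d K') =
        (\<Prod>K'\<in>f ` {..<s} - {K}. sign (restrict_id \<tau> (?L K')) ^ d K')"
    proof (rule prod.cong[OF refl])
      fix K' assume "K' \<in> f ` {..<s} - {K}"
      hence "K' \<noteq> K" by auto
      from other[OF this]
      show "sign (restrict_id (\<tau> \<circ> ?t) (?L K')) ^ d K' = sign (restrict_id \<tau> (?L K')) ^ d K'"
        by (simp only:)
    qed
    also have "sign (restrict_id (\<tau> \<circ> ?t) (?L K)) ^ d K * \<dots> = - fiber_sign s d \<tau> f"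
      unfolding fiber_sign_def sgn prod.remove[OF finite_imageI[OF finite_lessThan] Kf] using K(1) by simp
    finally show "fiber_sign s d (\<tau> \<circ> ?t) f = - fiber_sign s d \<tau> f" .
  qed
  also have "\<dots> = - (\<Sum>\<tau>\<in>colour_stabilizer s f. fiber_sign s d \<tau> f)" by (rule sum_negf)
  finally show ?thesis by simp
qed

text \<open>Orbit-stabilizer in summed form: the colourings with a given multiset of colours are a
  single orbit of the symmetric group, that of \<open>f0\<close>.\<close>

lemma sum_card_stabilizers:
  assumes c: "set_mset c \<subseteq> G" "size c = s"
  shows "(\<Sum>f | f \<in> {..<s} \<rightarrow>\<^sub>E G \<and> colour_mset s f = c. card (colour_stabilizer s f)) = fact s"
proof -
  let ?F = "{f. f \<in> {..<s} \<rightarrow>\<^sub>E G \<and> colour_mset s f = c}" and ?P = "{\<tau>. \<tau> permutes {..<s}}"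
  obtain xs where xs: "mset xs = c" using ex_mset by blast
  define f0 where "f0 = (\<lambda>l\<in>{..<s}. xs ! l)"
  have len: "length xs = s" using xs c by auto
  have f0: "f0 \<in> {..<s} \<rightarrow>\<^sub>E G" using c xs len by (auto simp: f0_def)
  have "colour_mset s f0 = mset (map ((!) xs) [0..<s])"
    by (auto simp: colour_mset_def f0_def atLeast_upt intro!: image_mset_cong
      simp flip: mset_set_set)
  hence m0: "colour_mset s f0 = c" using xs len by (metis map_nth)
  let ?g = "\<lambda>\<tau>. restrict (f0 \<circ> \<tau>) {..<s}"
  have finF: "finite ?F"
  proof (rule finite_subset)
    show "?F \<subseteq> {..<s} \<rightarrow>\<^sub>E set_mset c"
      by (auto simp: PiE_def Pi_def colour_mset_def)
  qed (auto intro: finite_PiE)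
  have gF: "?g \<tau> \<in> ?F" if \<tau>: "\<tau> permutes {..<s}" for \<tau>
  proof -
    have "?g \<tau> \<in> {..<s} \<rightarrow>\<^sub>E G" using f0 permutes_in_image[OF \<tau>] by (auto simp: PiE_def Pi_def)
    moreover have "colour_mset s (?g \<tau>) = colour_mset s f0"
      unfolding colour_mset_def
      by (rule permutes_implies_image_mset_eq[OF \<tau>, symmetric]) simp
    ultimately show ?thesis using m0 by simp
  qed
  have "card (colour_stabilizer s f) = card {\<tau> \<in> ?P. ?g \<tau> = f}" if f: "f \<in> ?F" for f
  proof -
    have "image_mset f (mset_set {..<s}) = image_mset f0 (mset_set {..<s})"
      using f m0 by (simp add: colour_mset_def)
    then obtain p where p: "p permutes {..<s}" "\<forall>x\<in>{..<s}. f x = f0 (p x)"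
      using image_mset_eq_implies_permutes[of "{..<s}" f f0] by auto
    \<comment> \<open>The permutations that carry \<open>f0\<close> to \<open>f\<close> form the
      coset through \<open>p\<close> of the stabilizer of \<open>f\<close>.\<close>
    have "bij_betw (\<lambda>\<sigma>. p \<circ> \<sigma>) (colour_stabilizer s f) {\<tau> \<in> ?P. ?g \<tau> = f}"
    proof (rule bij_betw_byWitness[where f'="\<lambda>\<tau>. inv' p \<circ> \<tau>"])
      show "\<forall>\<sigma>\<in>colour_stabilizer s f. inv' p \<circ> (p \<circ> \<sigma>) = \<sigma>"
        using permutes_inv_o(2)[OF p(1)] by (simp add: comp_assoc[symmetric])
      show "\<forall>\<tau>\<in>{\<tau> \<in> ?P. ?g \<tau> = f}. p \<circ> (inv' p \<circ> \<tau>) = \<tau>"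
        using permutes_inv_o(1)[OF p(1)] by (simp add: comp_assoc[symmetric])
      show "(\<lambda>\<sigma>. p \<circ> \<sigma>) ` colour_stabilizer s f \<subseteq> {\<tau> \<in> ?P. ?g \<tau> = f}"
      proof
        fix \<tau> assume "\<tau> \<in> (\<lambda>\<sigma>. p \<circ> \<sigma>) ` colour_stabilizer s f"
        then obtain \<sigma> where \<sigma>: "\<sigma> permutes {..<s}" "\<forall>l<s. f (\<sigma> l) = f l" "\<tau> = p \<circ> \<sigma>"
          by (auto simp: colour_stabilizer_def)
        have "?g \<tau> l = f l" for l
        proof (cases "l < s")
          case True
          moreover have "\<sigma> l < s" using True permutes_in_image[OF \<sigma>(1), of l] by simp
          ultimately show ?thesis using \<sigma> p(2) by auto
        next
          case False
          thus ?thesis using f by (auto simp: PiE_def extensional_def)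
        qed
        thus "\<tau> \<in> {\<tau> \<in> ?P. ?g \<tau> = f}" using \<sigma> permutes_compose[OF \<sigma>(1) p(1)] by auto
      qed
      show "(\<lambda>\<tau>. inv' p \<circ> \<tau>) ` {\<tau> \<in> ?P. ?g \<tau> = f} \<subseteq> colour_stabilizer s f"
      proof
        fix \<sigma> assume "\<sigma> \<in> (\<lambda>\<tau>. inv' p \<circ> \<tau>) ` {\<tau> \<in> ?P. ?g \<tau> = f}"
        then obtain \<tau> where \<tau>: "\<tau> permutes {..<s}" "?g \<tau> = f" "\<sigma> = inv' p \<circ> \<tau>" by auto
        have "f (\<sigma> l) = f l" if l: "l < s" for l
        proof -
          have "\<tau> l < s" using l permutes_in_image[OF \<tau>(1), of l] by simp
          hence "\<sigma> l < s" using \<tau>(3) permutes_in_image[OF permutes_inv[OF p(1)], of "\<tau> l"] by simp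
          hence "f (\<sigma> l) = f0 (p (\<sigma> l))" using p(2) by simp
          also have "p (\<sigma> l) = \<tau> l" using \<tau>(3) permutes_inverses(1)[OF p(1)] by simp
          also have "f0 (\<tau> l) = f l" using fun_cong[OF \<tau>(2), of l] l by simp
          finally show ?thesis .
        qed
        thus "\<sigma> \<in> colour_stabilizer s f"
          using \<tau> permutes_compose[OF \<tau>(1) permutes_inv[OF p(1)]] by (simp add: colour_stabilizer_def)
      qed
    qed
    thus ?thesis by (rule bij_betw_same_card)
  qed
  hence "(\<Sum>f\<in>?F. card (colour_stabilizer s f)) = (\<Sum>f\<in>?F. \<Sum>\<tau> | \<tau> \<in> ?P \<and> ?g \<tau> = f. 1)"
    by (intro sum.cong) auto
  also have "\<dots> = (\<Sum>\<tau>\<in>?P. 1)"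
  proof (rule sum.group)
    show "finite ?P" by (simp add: finite_permutations)
    show "finite ?F" by (rule finF)
    show "?g ` ?P \<subseteq> ?F" using gF by blast
  qed
  also have "\<dots> = fact s" by (simp add: card_permutations)
  finally show ?thesis .
qed

text \<open>The Hilbert polynomial, in x, of the component with \<open>s\<close> factors in the free
  graded-commutative algebra on \<open>G\<close>.\<close>

definition super_poly :: "('k \<Rightarrow> nat) \<Rightarrow> 'k set \<Rightarrow> nat \<Rightarrow> complex poly" where
  "super_poly d G s = (\<Sum>c\<in>super_multisets d G s. [:0, 1:] ^ (\<Sum>K\<in>#c. d K))"

text \<open>After exchanging the sums, each colouring carries the signed sum over its stabilizer.
  This is 0 when an odd colour repeats and the order of the stabilizer otherwise; collecting the
  colourings by their multiset gives s! each time.\<close>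

lemma sum_colourings:
  assumes G: "finite G"
  shows "(\<Sum>\<tau> | \<tau> permutes {..<s}. \<Sum>f | f \<in> {..<s} \<rightarrow>\<^sub>E G \<and> (\<forall>l<s. f (\<tau> l) = f l).
       of_int (fiber_sign s d \<tau> f) * [:0, 1:] ^ (\<Sum>l<s. d (f l))) = of_nat (fact s) * super_poly d G s"
proof -
  let ?F = "{..<s} \<rightarrow>\<^sub>E G" and ?P = "{\<tau>. \<tau> permutes {..<s}}"
  let ?X = "\<lambda>f. [:0, 1:] ^ (\<Sum>l<s. d (f l)) :: complex poly"
  have finF: "finite ?F" using G by (intro finite_PiE) auto
  have mem: "set_mset (colour_mset s f) \<subseteq> G" "size (colour_mset s f) = s" if "f \<in> ?F" for f
    using that by (auto simp: colour_mset_def)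
  have stab: "(\<Sum>\<tau>\<in>colour_stabilizer s f. fiber_sign s d \<tau> f) =
      (if colour_mset s f \<in> super_multisets d G s then int (card (colour_stabilizer s f)) else 0)"
    if f: "f \<in> ?F" for f
  proof (cases "colour_mset s f \<in> super_multisets d G s")
    case True
    have "f ` {..<s} \<subseteq> G" using f by auto
    hence "fiber_sign s d \<tau> f = 1" if "\<tau> \<in> colour_stabilizer s f" for \<tau>
      using True that by (intro fiber_sign_eq_1) (auto simp: super_multisets_def)
    thus ?thesis using True by simp
  next
    case False
    then obtain K where "odd (d K)" "count (colour_mset s f) K > 1"
      using mem[OF f] by (auto simp: super_multisets_def not_le)
    thus ?thesis using False sum_fiber_sign_eq_0 by simp
  qed
  have "(\<Sum>\<tau> | \<tau> permutes {..<s}. \<Sum>f | f \<in> ?F \<and> (\<forall>l<s. f (\<tau> l) = f l). of_int (fiber_sign s d \<tau> f) * ?X f) =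
      (\<Sum>\<tau>\<in>?P. \<Sum>f\<in>?F. if \<forall>l<s. f (\<tau> l) = f l then of_int (fiber_sign s d \<tau> f) * ?X f else 0)"
    by (rule sum.cong[OF refl], rule sum.inter_filter[OF finF])
  also have "\<dots> = (\<Sum>f\<in>?F. \<Sum>\<tau> | \<tau> \<in> ?P \<and> (\<forall>l<s. f (\<tau> l) = f l). of_int (fiber_sign s d \<tau> f) * ?X f)"
    by (subst sum.swap, rule sum.cong[OF refl], rule sum.inter_filter[symmetric]) (simp add: finite_permutations)
  also have "\<dots> = (\<Sum>f\<in>?F. of_int (\<Sum>\<tau>\<in>colour_stabilizer s f. fiber_sign s d \<tau> f) * ?X f)"
    by (rule sum.cong[OF refl]) (simp add: colour_stabilizer_def sum_distrib_right)
  also have "\<dots> = (\<Sum>f\<in>?F. if colour_mset s f \<in> super_multisets d G s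
      then of_nat (card (colour_stabilizer s f)) * ?X f else 0)"
    by (rule sum.cong[OF refl]) (simp add: stab)
  also have "\<dots> = (\<Sum>f | f \<in> ?F \<and> colour_mset s f \<in> super_multisets d G s.
      of_nat (card (colour_stabilizer s f)) * ?X f)"
    by (rule sum.inter_filter[OF finF, symmetric])
  also have "\<dots> = (\<Sum>c\<in>super_multisets d G s. \<Sum>f | f \<in> {f. f \<in> ?F \<and> colour_mset s f \<in> super_multisets d G s} \<and>
      colour_mset s f = c. of_nat (card (colour_stabilizer s f)) * ?X f)"
    using finF finite_super_multisets[OF G] by (intro sum.group[symmetric]) auto
  also have "\<dots> = (\<Sum>c\<in>super_multisets d G s. of_nat (fact s) * [:0, 1:] ^ (\<Sum>K\<in>#c. d K))"
  proof (rule sum.cong[OF refl])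
    fix c assume c: "c \<in> super_multisets d G s"
    have "(\<Sum>f | f \<in> {f. f \<in> ?F \<and> colour_mset s f \<in> super_multisets d G s} \<and> colour_mset s f = c.
        of_nat (card (colour_stabilizer s f)) * ?X f) =
        (\<Sum>f | f \<in> ?F \<and> colour_mset s f = c. of_nat (card (colour_stabilizer s f)) * [:0, 1:] ^ (\<Sum>K\<in>#c. d K))"
    proof (rule sum.cong)
      fix f assume "f \<in> {f. f \<in> ?F \<and> colour_mset s f = c}"
      hence "c = colour_mset s f" by simp
      hence "(\<Sum>K\<in>#c. d K) = (\<Sum>l<s. d (f l))"
        by (simp add: colour_mset_def image_mset.compositionality comp_def sum_unfold_sum_mset)
      thus "of_nat (card (colour_stabilizer s f)) * ?X f =
        of_nat (card (colour_stabilizer s f)) * [:0, 1:] ^ (\<Sum>K\<in>#c. d K)" by simp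
    qed (use c in auto)
    also have "\<dots> = of_nat (\<Sum>f | f \<in> ?F \<and> colour_mset s f = c. card (colour_stabilizer s f)) *
        [:0, 1:] ^ (\<Sum>K\<in>#c. d K)"
      by (simp add: sum_distrib_right)
    also have "(\<Sum>f | f \<in> ?F \<and> colour_mset s f = c. card (colour_stabilizer s f)) = fact s"
      using c by (intro sum_card_stabilizers) (auto simp: super_multisets_def)
    finally show "(\<Sum>f | f \<in> {f. f \<in> ?F \<and> colour_mset s f \<in> super_multisets d G s} \<and> colour_mset s f = c.
        of_nat (card (colour_stabilizer s f)) * ?X f) = of_nat (fact s) * [:0, 1:] ^ (\<Sum>K\<in>#c. d K)" .
  qed
  finally show ?thesis by (simp only: super_poly_def sum_distrib_left)
qed

text \<open>The Hilbert series, in y over the polynomials in x, of the algebra on one generator of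
  degree \<open>j\<close>, whose square vanishes for odd \<open>j\<close>.\<close>

definition super_factor :: "nat \<Rightarrow> complex poly fps" where
  "super_factor j = Abs_fps (\<lambda>k. if even j \<or> k \<le> 1 then [:0, 1:] ^ (j * k) else 0)"

text \<open>Splitting off the multiplicity of one generator turns multisets over
  \<open>insert K G\<close> into pairs, which is the convolution of coefficients in the product of
  series.\<close>

lemma super_poly_eq_prod:
  assumes "finite G"
  shows "fps_nth (\<Prod>K\<in>G. super_factor (d K)) s = super_poly d G s"
  using assms
proof (induction G arbitrary: s rule: finite_induct)
  case empty
  have "super_multisets d {} s = (if s = 0 then {{#}} else {})"
    by (auto simp: super_multisets_def)
  thus ?case by (simp add: super_poly_def)
next
  case (insert K G)
  let ?A = "SIGMA k:{k. k \<le> s \<and> (even (d K) \<or> k \<le> 1)}. super_multisets d G (s - k)"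
  have fin: "finite {k. k \<le> s \<and> (even (d K) \<or> k \<le> 1)}"
    by (rule finite_subset[of _ "{..s}"]) auto
  have notin: "count c K = 0" if "c \<in> super_multisets d G k" for c k
    using that insert.hyps by (auto simp: super_multisets_def count_eq_zero_iff)
  have "super_poly d (insert K G) s =
      (\<Sum>(k, c)\<in>?A. [:0, 1:] ^ (d K * k) * [:0, 1:] ^ (\<Sum>K\<in>#c. d K))"
    unfolding super_poly_def
  proof (rule sum.reindex_bij_witness[where i="\<lambda>(k, c). c + replicate_mset k K"
        and j="\<lambda>c. (count c K, filter_mset (\<lambda>x. x \<noteq> K) c)"])
    fix c assume c: "c \<in> super_multisets d (insert K G) s"
    have split: "filter_mset (\<lambda>x. x \<noteq> K) c + replicate_mset (count c K) K = c"
      by (rule multiset_eqI) auto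
    show "(case (count c K, filter_mset (\<lambda>x. x \<noteq> K) c) of (k, c) \<Rightarrow> c + replicate_mset k K) = c"
      using split by simp
    have "size c = size (filter_mset (\<lambda>x. x \<noteq> K) c) + count c K"
      using arg_cong[OF split, of size] by simp
    thus "(count c K, filter_mset (\<lambda>x. x \<noteq> K) c) \<in> ?A"
      using c by (auto simp: super_multisets_def)
    have "(\<Sum>K\<in>#c. d K) = (\<Sum>K\<in>#filter_mset (\<lambda>x. x \<noteq> K) c. d K) + d K * count c K"
      by (subst split[symmetric]) simp
    thus "(case (count c K, filter_mset (\<lambda>x. x \<noteq> K) c) of (k, c) \<Rightarrow>
        [:0, 1:] ^ (d K * k) * [:0, 1:] ^ (\<Sum>K\<in>#c. d K)) = ([:0, 1:] ^ (\<Sum>K\<in>#c. d K) :: complex poly)"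
      by (simp add: power_add mult.commute)
  next
    fix kc assume kc: "kc \<in> ?A"
    obtain k c where kc': "kc = (k, c)" by (cases kc)
    have c: "c \<in> super_multisets d G (s - k)" "k \<le> s" "even (d K) \<or> k \<le> 1" using kc kc' by auto
    have "filter_mset (\<lambda>x. x \<noteq> K) c = c"
      using notin[OF c(1)] by (auto simp: filter_mset_eq_conv count_eq_zero_iff)
    thus "(\<lambda>c. (count c K, filter_mset (\<lambda>x. x \<noteq> K) c)) (case kc of (k, c) \<Rightarrow> c + replicate_mset k K) = kc"
      using notin[OF c(1)] by (simp add: kc')
    have "count (c + replicate_mset k K) K' = count c K'" if "K' \<in> G" for K'
      using that insert.hyps by auto
    moreover have "set_mset (c + replicate_mset k K) \<subseteq> insert K G" "size (c + replicate_mset k K) = s"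
      using c by (auto simp: super_multisets_def split: if_splits)
    ultimately show "(case kc of (k, c) \<Rightarrow> c + replicate_mset k K) \<in> super_multisets d (insert K G) s"
      using c notin[OF c(1)] by (auto simp: super_multisets_def kc')
  qed
  also have "\<dots> = (\<Sum>k | k \<le> s \<and> (even (d K) \<or> k \<le> 1).
      [:0, 1:] ^ (d K * k) * super_poly d G (s - k))"
    unfolding super_poly_def sum_distrib_left using fin finite_super_multisets[OF insert.hyps(1)]
    by (intro sum.Sigma[symmetric]) auto
  also have "\<dots> = (\<Sum>k=0..s. fps_nth (super_factor (d K)) k * super_poly d G (s - k))"
    by (intro sum.mono_neutral_cong_left) (auto simp: super_factor_def)
  finally show ?case using insert.hyps insert.IH by (simp add: fps_mult_nth)
qed

section \<open>Polynomials and series with non-negative integer coefficients\<close>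

lemma Nats_sum: "(\<And>x. x \<in> A \<Longrightarrow> f x \<in> \<nat>) \<Longrightarrow> sum f A \<in> \<nat>" for f :: "'b \<Rightarrow> 'a :: semiring_1"
  by (induction A rule: infinite_finite_induct) auto

definition nat_coeffs :: "'a::comm_semiring_1 poly \<Rightarrow> bool" where
  "nat_coeffs p \<longleftrightarrow> (\<forall>i. coeff p i \<in> \<nat>)"

lemma nat_coeffs_0: "nat_coeffs 0"
  by (simp add: nat_coeffs_def)

lemma nat_coeffs_add: "nat_coeffs p \<Longrightarrow> nat_coeffs q \<Longrightarrow> nat_coeffs (p + q)"
  by (simp add: nat_coeffs_def)

lemma nat_coeffs_mult: "nat_coeffs p \<Longrightarrow> nat_coeffs q \<Longrightarrow> nat_coeffs (p * q)"
  by (auto simp: nat_coeffs_def coeff_mult intro!: Nats_sum)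

lemma nat_coeffs_sum: "(\<And>x. x \<in> A \<Longrightarrow> nat_coeffs (f x)) \<Longrightarrow> nat_coeffs (sum f A)"
  by (induction A rule: infinite_finite_induct) (auto simp: nat_coeffs_0 nat_coeffs_add)

lemma nat_coeffs_linear: "a \<in> \<nat> \<Longrightarrow> b \<in> \<nat> \<Longrightarrow> nat_coeffs [:a, b:]"
  by (auto simp: nat_coeffs_def coeff_pCons split: nat.split)

lemma nat_coeffs_power: "nat_coeffs p \<Longrightarrow> nat_coeffs (p ^ k)"
  by (induction k) (auto simp: nat_coeffs_mult nat_coeffs_def[of 1])

definition nat_series :: "'a::comm_ring_1 poly fps \<Rightarrow> bool" where
  "nat_series f \<longleftrightarrow> (\<forall>k. nat_coeffs (fps_nth f k))"

lemma nat_series_add: "nat_series f \<Longrightarrow> nat_series g \<Longrightarrow> nat_series (f + g)"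
  by (simp add: nat_series_def nat_coeffs_add)

lemma nat_series_mult: "nat_series f \<Longrightarrow> nat_series g \<Longrightarrow> nat_series (f * g)"
  by (auto simp: nat_series_def fps_mult_nth intro!: nat_coeffs_sum nat_coeffs_mult)

lemma nat_series_const: "nat_coeffs p \<Longrightarrow> nat_series (fps_const p)"
  by (auto simp: nat_series_def nat_coeffs_0)

lemma nat_series_X: "nat_series fps_X"
  by (auto simp: nat_series_def nat_coeffs_0 fps_X_def nat_coeffs_def[of 1])

lemma nat_series_super_factor: "nat_series (super_factor j)"
  by (auto simp: nat_series_def super_factor_def nat_coeffs_0 intro!: nat_coeffs_power nat_coeffs_linear)

lemma super_factor_odd:
  assumes "odd j"
  shows "super_factor j = 1 + fps_const ([:0, 1:] ^ j) * fps_X"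
proof (rule fps_ext)
  fix k :: nat
  consider "k = 0" | "k = 1" | "k \<ge> 2" by linarith
  thus "fps_nth (super_factor j) k = fps_nth (1 + fps_const ([:0, 1:] ^ j) * fps_X) k"
    using assms by cases (auto simp: super_factor_def)
qed

lemma super_factor_even:
  assumes "even j"
  shows "(1 - fps_const ([:0, 1:] ^ j) * fps_X) * super_factor j = 1"
proof (rule fps_ext)
  fix k
  have nth: "fps_nth (super_factor j) k = [:0, 1:] ^ (j * k)" for k
    using assms by (simp add: super_factor_def)
  have "fps_nth (fps_const ([:0, 1:] ^ j) * fps_X * super_factor j) k =
      (if k = 0 then 0 else [:0, 1:] ^ j * [:0, 1:] ^ (j * (k - 1)))"
    by (simp add: mult.assoc nth)
  also have "\<dots> = (if k = 0 then 0 else [:0, 1:] ^ (j * k))"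
    by (cases k) (auto simp: power_add)
  finally have "fps_nth (fps_const ([:0, 1:] ^ j) * fps_X * super_factor j) k =
      (if k = 0 then 0 else [:0, 1:] ^ (j * k))" .
  thus "fps_nth ((1 - fps_const ([:0, 1:] ^ j) * fps_X) * super_factor j) k = fps_nth 1 k"
    by (simp add: left_diff_distrib nth)
qed

text \<open>The witness \<open>h\<close> records two facts about each coefficient of y^s with s >=
  1: it is divisible by (1 + x)^2, and the quotient has non-negative integer coefficients.\<close>

definition unital_series :: "complex poly fps \<Rightarrow> bool" where
  "unital_series f \<longleftrightarrow> (\<exists>h. nat_series h \<and> f = 1 + fps_const ([:1, 1:]\<^sup>2) * h)"

lemma unital_series_prod:
  assumes "\<And>x. x \<in> A \<Longrightarrow> unital_series (f x)"
  shows "unital_series (prod f A)"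
proof -
  let ?c = "fps_const ([:1, 1:]\<^sup>2) :: complex poly fps"
  have c: "nat_series ?c" by (intro nat_series_const nat_coeffs_power nat_coeffs_linear) auto
  have one: "unital_series 1"
    unfolding unital_series_def by (rule exI[of _ 0]) (simp add: nat_series_def nat_coeffs_0)
  have mult: "unital_series (g * g')" if g: "unital_series g" "unital_series g'" for g g'
  proof -
    obtain h h' where "nat_series h" "nat_series h'" "g = 1 + ?c * h" "g' = 1 + ?c * h'"
      using g unfolding unital_series_def by blast
    \<comment> \<open>The new witness is built from the old ones and (1 + x)^2 by sums and products
      only, so non-negativity persists.\<close>
    moreover have "(1 + ?c * h) * (1 + ?c * h') = 1 + ?c * (h + h' + ?c * (h * h'))"
      by (simp add: algebra_simps)
    ultimately show ?thesis unfolding unital_series_def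
      using c by (metis nat_series_add nat_series_mult)
  qed
  show ?thesis using assms
    by (induction A rule: infinite_finite_induct) (auto simp: one mult)
qed

text \<open>With \<open>Y = x\<^sup>j y\<close>, the factor is \<open>(1 + x Y)\<^sup>2 / ((1 - Y) (1 - x\<^sup>2 Y))\<close> or
  \<open>(1 + Y) (1 + x\<^sup>2 Y) / (1 - x Y)\<^sup>2\<close>; in both cases numerator minus denominator is \<open>(1 + x)\<^sup>2 Y\<close>.\<close>

lemma unital_series_quadruple:
  "unital_series (super_factor j * super_factor (Suc j) * (super_factor (Suc j) * super_factor (Suc (Suc j))))"
proof -
  let ?x = "fps_const [:0, 1:] :: complex poly fps"
  let ?Y = "fps_const ([:0, 1:] ^ j) * fps_X :: complex poly fps"
  have ring1: "(1 + x * Y) * (1 + x * Y) = (1 - Y) * (1 - x * (x * Y)) + (1 + x) * (1 + x) * Y"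
    and ring2: "(1 + Y) * (1 + x * (x * Y)) = (1 - x * Y) * (1 - x * Y) + (1 + x) * (1 + x) * Y"
    and ring3: "(D * E + C * C * Y) * (A * B) = D * A * (E * B) + C * C * (Y * (A * B))"
    for x Y A B C D E :: "complex poly fps" by (simp_all add: algebra_simps)
  have Y1: "fps_const ([:0, 1:] ^ Suc j) * fps_X = ?x * ?Y"
    by (simp only: power_Suc fps_const_mult[symmetric] mult.assoc)
  have Y2: "fps_const ([:0, 1:] ^ Suc (Suc j)) * fps_X = ?x * (?x * ?Y)"
    by (simp only: power_Suc fps_const_mult[symmetric] mult.assoc)
  have "[:1, 1:] = 1 + [:0, 1 :: complex:]" by (simp add: one_pCons)
  hence c: "fps_const ([:1, 1:]\<^sup>2) = (1 + ?x) * (1 + ?x)"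
    by (simp only: power2_eq_square fps_const_mult[symmetric] fps_const_add[symmetric] fps_const_1_eq_1)
  have nY: "nat_series ?Y"
    by (intro nat_series_mult nat_series_const nat_coeffs_power nat_coeffs_linear nat_series_X) auto
  show ?thesis
  proof (cases "even j")
    case True
    let ?A = "super_factor j" and ?B = "super_factor (Suc (Suc j))"
    have A: "(1 - ?Y) * ?A = 1" using super_factor_even[of j] True by simp
    have B: "(1 - ?x * (?x * ?Y)) * ?B = 1"
      using super_factor_even[of "Suc (Suc j)"] True unfolding Y2 by simp
    have O: "super_factor (Suc j) = 1 + ?x * ?Y"
      unfolding Y1[symmetric] by (rule super_factor_odd) (use True in simp)
    have "?A * super_factor (Suc j) * (super_factor (Suc j) * ?B) =
        (1 + ?x * ?Y) * (1 + ?x * ?Y) * (?A * ?B)"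
      unfolding O by (simp only: mult_ac)
    also have "(1 + ?x * ?Y) * (1 + ?x * ?Y) =
        (1 - ?Y) * (1 - ?x * (?x * ?Y)) + (1 + ?x) * (1 + ?x) * ?Y"
      by (rule ring1)
    also have "\<dots> * (?A * ?B) = ((1 - ?Y) * ?A) * ((1 - ?x * (?x * ?Y)) * ?B) +
        (1 + ?x) * (1 + ?x) * (?Y * (?A * ?B))"
      by (rule ring3)
    also have "\<dots> = 1 + fps_const ([:1, 1:]\<^sup>2) * (?Y * (?A * ?B))" unfolding A B c by simp
    finally show ?thesis unfolding unital_series_def
      using nY nat_series_mult nat_series_super_factor by blast
  next
    case False
    let ?A = "super_factor (Suc j)"
    have A: "(1 - ?x * ?Y) * ?A = 1" using super_factor_even[of "Suc j"] False unfolding Y1 by simp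
    have O: "super_factor j = 1 + ?Y" by (rule super_factor_odd[OF False])
    have O': "super_factor (Suc (Suc j)) = 1 + ?x * (?x * ?Y)"
      unfolding Y2[symmetric] by (rule super_factor_odd) (use False in simp)
    have "super_factor j * ?A * (?A * super_factor (Suc (Suc j))) =
        (1 + ?Y) * (1 + ?x * (?x * ?Y)) * (?A * ?A)"
      unfolding O O' by (simp only: mult_ac)
    also have "(1 + ?Y) * (1 + ?x * (?x * ?Y)) =
        (1 - ?x * ?Y) * (1 - ?x * ?Y) + (1 + ?x) * (1 + ?x) * ?Y"
      by (rule ring2)
    also have "\<dots> * (?A * ?A) = ((1 - ?x * ?Y) * ?A) * ((1 - ?x * ?Y) * ?A) +
        (1 + ?x) * (1 + ?x) * (?Y * (?A * ?A))"
      by (rule ring3)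
    also have "\<dots> = 1 + fps_const ([:1, 1:]\<^sup>2) * (?Y * (?A * ?A))" unfolding A c by simp
    finally show ?thesis unfolding unital_series_def
      using nY nat_series_mult nat_series_super_factor by blast
  qed
qed

section \<open>Subsets of the cyclic group with prescribed sum\<close>

text \<open>Leaving out 0 prepares the first pairing: adding 0 changes the size of a set but not its
  sum.\<close>

definition nonzero_residue_sets :: "nat \<Rightarrow> nat set set" where
  "nonzero_residue_sets r = {K. K \<subseteq> {1..<r} \<and> r dvd Suc (\<Sum>K)}"

lemma finite_nonzero_residue_sets: "finite (nonzero_residue_sets r)"
  by (rule finite_subset[of _ "Pow {1..<r}"]) (auto simp: nonzero_residue_sets_def)

text \<open>Pairs each set with the one obtained by adding \<open>x\<close>. The product form serves
  both pairings of the factors, with \<open>x\<close> equal to 0 and to \<open>r - b\<close>; the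
  sum form serves the case \<open>s = 1\<close>.\<close>

lemma big_op_insert_split:
  assumes Q: "finite Q" "\<And>B. B \<in> Q \<Longrightarrow> finite B \<and> x \<notin> B"
  shows "(\<Prod>K\<in>Q \<union> insert x ` Q. g (card K)) = (\<Prod>B\<in>Q. g (card B) * g (Suc (card B)))"
    and "(\<Sum>K\<in>Q \<union> insert x ` Q. h (card K)) = (\<Sum>B\<in>Q. h (card B) + h (Suc (card B)))"
proof -
  have disj: "Q \<inter> insert x ` Q = {}" using Q by blast
  have inj: "inj_on (insert x) Q" using Q by (metis inj_onI insert_ident)
  have "(\<Prod>K\<in>insert x ` Q. g (card K)) = (\<Prod>B\<in>Q. g (Suc (card B)))"
    unfolding prod.reindex[OF inj] using Q by (intro prod.cong) auto
  thus "(\<Prod>K\<in>Q \<union> insert x ` Q. g (card K)) = (\<Prod>B\<in>Q. g (card B) * g (Suc (card B)))"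
    using Q disj by (subst prod.union_disjoint) (auto simp: prod.distrib)
  have "(\<Sum>K\<in>insert x ` Q. h (card K)) = (\<Sum>B\<in>Q. h (Suc (card B)))"
    unfolding sum.reindex[OF inj] using Q by (intro sum.cong) auto
  thus "(\<Sum>K\<in>Q \<union> insert x ` Q. h (card K)) = (\<Sum>B\<in>Q. h (card B) + h (Suc (card B)))"
    using Q disj by (subst sum.union_disjoint) (auto simp: sum.distrib)
qed

lemma residue_sets_split:
  assumes "r \<ge> 1"
  shows "residue_sets r = nonzero_residue_sets r \<union> insert 0 ` nonzero_residue_sets r"
proof
  show "residue_sets r \<subseteq> nonzero_residue_sets r \<union> insert 0 ` nonzero_residue_sets r"
  proof
    fix K assume K: "K \<in> residue_sets r"
    hence fin: "finite K" unfolding residue_sets_def using finite_subset by blast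
    have "\<Sum>K = \<Sum>(K - {0})" using fin by (intro sum.mono_neutral_right) auto
    hence "K - {0} \<in> nonzero_residue_sets r"
      using K by (auto simp: residue_sets_def nonzero_residue_sets_def)
    moreover have "K = K - {0} \<or> K = insert 0 (K - {0})" by auto
    ultimately show "K \<in> nonzero_residue_sets r \<union> insert 0 ` nonzero_residue_sets r"
      by (metis UnI1 UnI2 image_eqI)
  qed
  have "\<Sum>(insert 0 K) = \<Sum>K" if "K \<subseteq> {1..<r}" for K
  proof -
    have "finite K" using that finite_subset by blast
    thus ?thesis by (cases "0 \<in> K") (auto simp: insert_absorb)
  qed
  thus "nonzero_residue_sets r \<union> insert 0 ` nonzero_residue_sets r \<subseteq> residue_sets r"
    using assms by (auto simp: residue_sets_def nonzero_residue_sets_def)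
qed

lemma nonzero_residue_sets_0: "K \<in> nonzero_residue_sets r \<Longrightarrow> finite K \<and> 0 \<notin> K"
  using finite_subset by (auto simp: nonzero_residue_sets_def)

lemma bij_betw_mult_mod:
  fixes u r :: nat
  assumes "coprime u r"
  shows "bij_betw (\<lambda>t. u * t mod r) {1..<r} {1..<r}"
proof -
  have inj: "inj_on (\<lambda>t. u * t mod r) {..<r}"
  proof (rule linorder_inj_onI)
    fix t t' assume t: "t < t'" "t \<in> {..<r}" "t' \<in> {..<r}"
    show "u * t mod r \<noteq> u * t' mod r"
    proof
      assume "u * t mod r = u * t' mod r"
      hence "r dvd u * t' - u * t" using t by (metis mod_eq_dvd_iff_nat mult_le_mono2 nless_le)
      hence "r dvd u * (t' - t)" by (simp add: diff_mult_distrib2)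
      hence "r dvd t' - t" using assms by (simp add: coprime_commute coprime_dvd_mult_right_iff)
      thus False using t by (auto dest: dvd_imp_le)
    qed
  qed auto
  have inj': "inj_on (\<lambda>t. u * t mod r) {1..<r}" by (rule inj_on_subset[OF inj]) auto
  have "u * t mod r \<in> {1..<r}" if t: "t \<in> {1..<r}" for t
    using inj_onD[OF inj, of t 0] t by (auto simp: Suc_le_eq)
  hence "(\<lambda>t. u * t mod r) ` {1..<r} \<subseteq> {1..<r}" by (rule image_subsetI)
  hence "(\<lambda>t. u * t mod r) ` {1..<r} = {1..<r}" using inj' by (intro endo_inj_surj) auto
  thus ?thesis using inj' by (simp add: bij_betw_def)
qed

text \<open>Multiplication by the unit \<open>u\<close> moves the target sum from -1 to
  \<open>-u\<close>, and by injectivity the sum over the image is the sum of the multiplied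
  elements.\<close>

lemma dvd_sum_mult_mod:
  fixes u r :: nat
  assumes u: "coprime u r" and K: "K \<subseteq> {1..<r}"
  shows "r dvd \<Sum>((\<lambda>t. u * t mod r) ` K) + u \<longleftrightarrow> r dvd Suc (\<Sum>K)"
proof -
  have "inj_on (\<lambda>t. u * t mod r) K"
    using bij_betw_mult_mod[OF u] K by (meson bij_betw_imp_inj_on inj_on_subset)
  hence "(\<Sum>((\<lambda>t. u * t mod r) ` K) + u) mod r = ((\<Sum>t\<in>K. u * t mod r) + u) mod r"
    by (simp add: sum.reindex)
  also have "\<dots> = ((\<Sum>t\<in>K. u * t) + u) mod r"
    by (metis mod_add_left_eq mod_sum_eq)
  also have "(\<Sum>t\<in>K. u * t) + u = u * Suc (\<Sum>K)" by (simp add: sum_distrib_left)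
  finally have "r dvd \<Sum>((\<lambda>t. u * t mod r) ` K) + u \<longleftrightarrow> r dvd u * Suc (\<Sum>K)"
    by (metis dvd_eq_mod_eq_0)
  thus ?thesis using u by (metis coprime_commute coprime_dvd_mult_right_iff)
qed

text \<open>If every prime divisor of \<open>r\<close> divides \<open>b\<close>, then \<open>1 + i b\<close> is a unit modulo \<open>r\<close>, and multiplication by
  it turns the condition that the sum be \<open>-1\<close> on sets of size \<open>i\<close> into one that is compatible with
  removing the element \<open>r - b\<close>.\<close>

lemma prod_nonzero_residue_sets:
  fixes g :: "nat \<Rightarrow> 'a::comm_monoid_mult"
  assumes b: "0 < b" "b < r" and rad: "\<And>q. prime q \<Longrightarrow> q dvd r \<Longrightarrow> q dvd b"
  defines "Q \<equiv> {B. B \<subseteq> {1..<r} - {r - b} \<and> r dvd \<Sum>B + (1 + card B * b)}"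
  shows "(\<Prod>K\<in>nonzero_residue_sets r. g (card K)) = (\<Prod>B\<in>Q. g (card B) * g (Suc (card B)))"
proof -
  define u where "u i = 1 + i * b" for i
  have cop: "coprime (u i) r" for i
  proof (rule ccontr)
    assume "\<not> coprime (u i) r"
    then obtain q where q: "prime q" "q dvd u i" "q dvd r"
      using b by (metis coprime_iff_gcd_eq_1 gcd_greatest_iff prime_factor_nat)
    hence "q dvd b" using rad by blast
    hence "q dvd 1" using q(2) unfolding u_def by (metis dvd_add_left_iff dvd_mult)
    thus False using q(1) by simp
  qed
  let ?m = "\<lambda>i K. (\<lambda>t. u i * t mod r) ` K"
  let ?S = "{K. K \<subseteq> {1..<r} \<and> r dvd \<Sum>K + u (card K)}"
  note bij = bij_betw_mult_mod[OF cop]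
  have inj: "inj_on (\<lambda>t. u i * t mod r) {1..<r}" for i using bij by (simp add: bij_betw_def)
  have sub: "?m i K \<subseteq> {1..<r}" "card (?m i K) = card K" if "K \<subseteq> {1..<r}" for i K
  proof -
    show "?m i K \<subseteq> {1..<r}" using bij[of i] that by (auto simp: bij_betw_def)
    show "card (?m i K) = card K" using inj_on_subset[OF inj that] by (rule card_image)
  qed
  \<comment> \<open>Multiplication by a unit preserves the size, so the size-dependent multiplier
    can be read off from the image and the map is injective across different sizes.\<close>
  have "bij_betw (\<lambda>K. ?m (card K) K) (nonzero_residue_sets r) ?S"
    unfolding bij_betw_def
  proof
    show "inj_on (\<lambda>K. ?m (card K) K) (nonzero_residue_sets r)"
    proof
      fix K L assume KL: "K \<in> nonzero_residue_sets r" "L \<in> nonzero_residue_sets r"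
        and eq: "?m (card K) K = ?m (card L) L"
      have K: "K \<subseteq> {1..<r}" and L: "L \<subseteq> {1..<r}" using KL by (auto simp: nonzero_residue_sets_def)
      have "card K = card L" using sub(2)[OF K, of "card K"] sub(2)[OF L, of "card L"] eq by simp
      thus "K = L" using eq inj_on_image_eq_iff[OF inj K L] by simp
    qed
    show "(\<lambda>K. ?m (card K) K) ` nonzero_residue_sets r = ?S"
    proof (intro equalityI subsetI)
      fix L assume "L \<in> (\<lambda>K. ?m (card K) K) ` nonzero_residue_sets r"
      then obtain K where K: "K \<subseteq> {1..<r}" "r dvd Suc (\<Sum>K)" "L = ?m (card K) K"
        by (auto simp: nonzero_residue_sets_def)
      thus "L \<in> ?S" using sub[OF K(1), of "card K"] dvd_sum_mult_mod[OF cop K(1), of "card K"] by simp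
    next
      fix L assume L: "L \<in> ?S"
      hence "L \<subseteq> (\<lambda>t. u (card L) * t mod r) ` {1..<r}"
        using bij[of "card L"] by (simp add: bij_betw_def)
      then obtain K where K: "K \<subseteq> {1..<r}" "L = ?m (card L) K" by (auto simp: subset_image_iff)
      have "card K = card L" using sub(2)[OF K(1), of "card L"] K(2) by simp
      moreover have "r dvd Suc (\<Sum>K)" using L dvd_sum_mult_mod[OF cop K(1), of "card L"] K(2) by simp
      ultimately show "L \<in> (\<lambda>K. ?m (card K) K) ` nonzero_residue_sets r"
        using K by (intro image_eqI[of _ _ K]) (auto simp: nonzero_residue_sets_def)
    qed
  qed
  hence "(\<Prod>L\<in>?S. g (card L)) = (\<Prod>K\<in>nonzero_residue_sets r. g (card (?m (card K) K)))"
    by (rule prod.reindex_bij_betw[symmetric])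
  also have "\<dots> = (\<Prod>K\<in>nonzero_residue_sets r. g (card K))"
    by (intro prod.cong refl) (use sub(2) in \<open>simp add: nonzero_residue_sets_def\<close>)
  finally have "(\<Prod>K\<in>nonzero_residue_sets r. g (card K)) = (\<Prod>L\<in>?S. g (card L))" by simp
  also have "?S = Q \<union> insert (r - b) ` Q"
  proof -
    \<comment> \<open>The new element adds \<open>r - b\<close> to the sum and the larger size adds
      \<open>b\<close> to the target, together exactly \<open>r\<close>.\<close>
    have ins: "r dvd \<Sum>(insert (r - b) B) + u (card (insert (r - b) B)) \<longleftrightarrow> r dvd \<Sum>B + u (card B)"
      if "B \<subseteq> {1..<r} - {r - b}" for B
    proof -
      have "finite B" "r - b \<notin> B" using that finite_subset by auto
      hence "\<Sum>(insert (r - b) B) + u (card (insert (r - b) B)) = (\<Sum>B + u (card B)) + r"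
        using b by (simp add: u_def)
      thus ?thesis by simp
    qed
    show ?thesis
    proof (intro equalityI subsetI)
      fix K assume K: "K \<in> ?S"
      show "K \<in> Q \<union> insert (r - b) ` Q"
      proof (cases "r - b \<in> K")
        case True
        have B: "K - {r - b} \<subseteq> {1..<r} - {r - b}" using K by auto
        have "K = insert (r - b) (K - {r - b})" using True by auto
        moreover from this have "K - {r - b} \<in> Q" using ins[OF B] K B unfolding Q_def u_def by auto
        ultimately show ?thesis by blast
      next
        case False
        thus ?thesis using K by (auto simp: Q_def u_def)
      qed
    next
      fix K assume "K \<in> Q \<union> insert (r - b) ` Q"
      thus "K \<in> ?S"
      proof
        assume "K \<in> Q"
        thus ?thesis by (auto simp: Q_def u_def)
      next
        assume "K \<in> insert (r - b) ` Q"
        then obtain B where B: "B \<in> Q" "K = insert (r - b) B" by blast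
        hence "B \<subseteq> {1..<r} - {r - b}" "r dvd \<Sum>B + u (card B)" by (auto simp: Q_def u_def)
        thus ?thesis using ins[of B] B(2) b by auto
      qed
    qed
  qed
  also have "(\<Prod>K\<in>Q \<union> insert (r - b) ` Q. g (card K)) = (\<Prod>B\<in>Q. g (card B) * g (Suc (card B)))"
  proof (rule big_op_insert_split(1))
    show "finite Q" by (rule finite_subset[of _ "Pow {1..<r}"]) (auto simp: Q_def)
    show "finite B \<and> r - b \<notin> B" if "B \<in> Q" for B
      using that finite_subset[of B "{1..<r} - {r - b}"] by (auto simp: Q_def)
  qed
  finally show ?thesis .
qed

text \<open>If r = x^2 c with x >= 2, then b = x c works: r is the product of x and b, so a prime
  dividing r divides x or b, and x divides b.\<close>

lemma not_squarefree_radical: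
  fixes r :: nat
  assumes "r \<ge> 1" "\<not> squarefree r"
  obtains b where "0 < b" "b < r" "\<And>q. prime q \<Longrightarrow> q dvd r \<Longrightarrow> q dvd b"
proof -
  obtain x where x: "x\<^sup>2 dvd r" "x \<noteq> 1" using assms(2) by (auto simp: squarefree_def)
  from x(1) obtain c where "r = x\<^sup>2 * c" by (rule dvdE)
  hence c: "r = x * (x * c)" by (simp add: power2_eq_square mult.assoc)
  have "x \<noteq> 0" "c \<noteq> 0" using c assms(1) by auto
  hence "x \<ge> 2" using x(2) by linarith
  show ?thesis
  proof (rule that[of "x * c"])
    show "0 < x * c" using \<open>x \<noteq> 0\<close> \<open>c \<noteq> 0\<close> by simp
    thus "x * c < r" unfolding c using \<open>x \<ge> 2\<close> by simp
    show "q dvd x * c" if "prime q" "q dvd r" for q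
      using that unfolding c by (metis dvd_mult2 prime_dvd_mult_iff)
  qed
qed

text \<open>The pairings by 0 and by \<open>r - b\<close> combine: a set \<open>B\<close> in the
  final index set stands for sizes j, j + 1, j + 1, j + 2 with \<open>j = card B\<close>.\<close>

lemma unital_series_residue_sets:
  assumes r: "r \<ge> 1" "\<not> squarefree r"
  shows "unital_series (\<Prod>K\<in>residue_sets r. super_factor (card K))"
proof -
  obtain b where b: "0 < b" "b < r" "\<And>q. prime q \<Longrightarrow> q dvd r \<Longrightarrow> q dvd b"
    using not_squarefree_radical[OF r] by blast
  have "(\<Prod>K\<in>residue_sets r. super_factor (card K)) =
      (\<Prod>K\<in>nonzero_residue_sets r. super_factor (card K) * super_factor (Suc (card K)))"
    unfolding residue_sets_split[OF r(1)]
    by (rule big_op_insert_split(1)) (auto simp: finite_nonzero_residue_sets nonzero_residue_sets_0)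
  also have "unital_series \<dots>"
    using prod_nonzero_residue_sets[OF b, of "\<lambda>j. super_factor j * super_factor (Suc j)"]
    by (simp only:) (intro unital_series_prod unital_series_quadruple)
  finally show ?thesis .
qed

text \<open>Write r = p m with p prime. The sum over all j < r coprime to m vanishes, since it
  contains the full sum of the powers of w^m, a root of order p. Its terms are those coprime to r
  and the multiples of p; the latter give the sum for m and w^p. Hence each prime only flips the
  sign.\<close>

lemma sum_primitive_roots:
  fixes w :: complex
  assumes "squarefree r" "\<And>k. w ^ k = 1 \<longleftrightarrow> r dvd k"
  shows "(\<Sum>j | j < r \<and> coprime j r. w ^ j) \<in> {1, -1}"
  using assms
proof (induction r arbitrary: w rule: less_induct)
  case (less r)
  have "r \<noteq> 0" using less.prems(1) by (metis not_squarefree_0)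
  show ?case
  proof (cases "r = 1")
    case True
    have "{j. j < (1::nat) \<and> coprime j 1} = {0}" by auto
    thus ?thesis unfolding True by simp
  next
    case False
    then obtain p where p: "prime p" "p dvd r" using prime_factor_nat by blast
    then obtain m where m: "r = p * m" by auto
    have m0: "m > 0" using m \<open>r \<noteq> 0\<close> by auto
    have p2: "p \<ge> 2" using p(1) by (rule prime_ge_2_nat)
    have cop: "coprime p m"
    proof (rule ccontr)
      assume "\<not> coprime p m"
      hence "p dvd m" using p(1) by (meson prime_imp_coprime)
      hence "p\<^sup>2 dvd r" using m by (simp add: power2_eq_square)
      thus False using less.prems(1) p(1) by (meson not_prime_unit squarefreeD)
    qed
    have "m < r" using m m0 p2 by simp
    moreover have "squarefree m" using less.prems(1) m by (metis dvd_triv_right squarefree_mono)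
    moreover have "(w ^ p) ^ k = 1 \<longleftrightarrow> m dvd k" for k
      using less.prems(2)[of "p * k"] p2 by (simp add: m power_mult)
    ultimately have IH: "(\<Sum>j | j < m \<and> coprime j m. (w ^ p) ^ j) \<in> {1, -1}"
      by (rule less.IH)
    let ?M = "{j. j < r \<and> coprime j m}"
    have fin: "finite ?M" by (rule finite_subset[of _ "{..<r}"]) auto
    have "(\<Sum>j\<in>?M. w ^ j) = (\<Sum>(j, i)\<in>{j. j < m \<and> coprime j m} \<times> {..<p}. w ^ (j + m * i))"
    proof (rule sum.reindex_bij_witness[where i="\<lambda>(j, i). j + m * i" and j="\<lambda>j. (j mod m, j div m)"])
      fix j assume j: "j \<in> ?M"
      have "coprime (j mod m) m" using j m0 by (simp add: coprime_mod_left_iff)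
      moreover have "j div m < p" using j m0 by (simp add: m less_mult_imp_div_less)
      ultimately show "(j mod m, j div m) \<in> {j. j < m \<and> coprime j m} \<times> {..<p}" using m0 by simp
    next
      fix x assume "x \<in> {j. j < m \<and> coprime j m} \<times> {..<p}"
      then obtain j i where x: "x = (j, i)" "j < m" "coprime j m" "i < p" by auto
      have "j + m * i < r"
      proof -
        have "j + m * i < m * Suc i" using x by simp
        also have "\<dots> \<le> m * p" using x by (intro mult_le_mono2) simp
        finally show ?thesis by (simp add: m mult.commute)
      qed
      moreover have "coprime (j + m * i) m"
        using x(3) by (metis coprime_iff_gcd_eq_1 gcd_add_mult gcd.commute mult.commute add.commute)
      ultimately show "(case x of (j, i) \<Rightarrow> j + m * i) \<in> ?M" using x by simp
      show "(\<lambda>j. (j mod m, j div m)) (case x of (j, i) \<Rightarrow> j + m * i) = x" using x by simp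
    qed auto
    also have "\<dots> = (\<Sum>j | j < m \<and> coprime j m. w ^ j * (\<Sum>i<p. (w ^ m) ^ i))"
      by (simp add: sum.cartesian_product[symmetric] power_add power_mult sum_distrib_left)
    also have "(\<Sum>i<p. (w ^ m) ^ i) = 0"
    proof (rule sum_powers_root_of_unity)
      show "(w ^ m) ^ p = 1" using less.prems(2)[of r] by (simp add: m mult.commute flip: power_mult)
      show "w ^ m \<noteq> 1" using less.prems(2)[of m] \<open>m < r\<close> m0 by (auto dest: dvd_imp_le)
    qed
    finally have zero: "(\<Sum>j\<in>?M. w ^ j) = 0" by simp
    have split: "?M = {j. j < r \<and> coprime j r} \<union> {j \<in> ?M. p dvd j}"
    proof -
      have "coprime j r \<longleftrightarrow> \<not> p dvd j \<and> coprime j m" for j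
        using p(1) unfolding m by (metis coprime_commute coprime_mult_right_iff not_prime_unit
          prime_imp_coprime coprime_absorb_left)
      thus ?thesis by blast
    qed
    have "(\<Sum>j\<in>?M. w ^ j) = (\<Sum>j | j < r \<and> coprime j r. w ^ j) + (\<Sum>j\<in>{j \<in> ?M. p dvd j}. w ^ j)"
    proof (subst split, rule sum.union_disjoint)
      show "{j. j < r \<and> coprime j r} \<inter> {j \<in> ?M. p dvd j} = {}"
        using p by (auto dest: coprime_common_divisor)
    qed (use fin in \<open>auto intro: finite_subset[of _ "{..<r}"]\<close>)
    also have "(\<Sum>j\<in>{j \<in> ?M. p dvd j}. w ^ j) = (\<Sum>j | j < m \<and> coprime j m. (w ^ p) ^ j)"
    proof (rule sum.reindex_bij_witness[where i="\<lambda>j. p * j" and j="\<lambda>j. j div p"])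
      fix j assume "j \<in> {j \<in> ?M. p dvd j}"
      hence j: "j < r" "coprime j m" "p dvd j" by auto
      from j(3) obtain k where "j = p * k" by (rule dvdE)
      note k = this j(1,2)
      have kd: "j div p = k" using k p2 by simp
      show "p * (j div p) = j" using kd k by simp
      show "j div p \<in> {j. j < m \<and> coprime j m}" unfolding kd using k p2 m by auto
      show "(w ^ p) ^ (j div p) = w ^ j" unfolding kd k(1) by (simp add: power_mult)
    next
      fix j assume "j \<in> {j. j < m \<and> coprime j m}"
      thus "p * j \<in> {j \<in> ?M. p dvd j}" "p * j div p = j" using p2 cop m by auto
    qed
    finally have "(\<Sum>j | j < r \<and> coprime j r. w ^ j) = - (\<Sum>j | j < m \<and> coprime j m. (w ^ p) ^ j)"
      using zero by (simp add: eq_neg_iff_add_eq_0)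
    thus ?thesis using IH by auto
  qed
qed

text \<open>A root of unity filter for the condition on the sum writes r times the alternating sum
  as the sum over j < r of w^j times the product of 1 - w^(j t) over 0 < t < r. For j coprime to r
  the product is \<open>D\<close>, its factors being merely permuted; otherwise it vanishes. What
  remains is \<open>D\<close> times the sum of primitive roots, both non-zero.\<close>

lemma alternating_sum_residue_sets:
  fixes w :: complex
  assumes r: "r \<ge> 1" "squarefree r" and w: "\<And>k. w ^ k = 1 \<longleftrightarrow> r dvd k"
  shows "(\<Sum>K\<in>nonzero_residue_sets r. (-1) ^ card K) \<noteq> (0 :: complex)"
proof -
  let ?T = "\<Sum>K\<in>nonzero_residue_sets r. (-1) ^ card K :: complex"
  define D where "D = (\<Prod>t\<in>{1..<r}. 1 - w ^ t)"
  have prod: "(\<Prod>t\<in>{1..<r}. 1 - w ^ (j * t)) = (if coprime j r then D else 0)" for j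
  proof (cases "coprime j r")
    case True
    have "D = (\<Prod>t\<in>{1..<r}. 1 - w ^ (j * t mod r))"
      unfolding D_def by (rule prod.reindex_bij_betw[OF bij_betw_mult_mod[OF True], symmetric])
    also have "\<dots> = (\<Prod>t\<in>{1..<r}. 1 - w ^ (j * t))"
      by (intro prod.cong refl) (simp add: power_mod_root w)
    finally show ?thesis using True by simp
  next
    case False
    \<comment> \<open>The index t = r / d lies in \<open>{1..<r}\<close> and satisfies w^(j t) = 1,
      so one factor is 0.\<close>
    let ?d = "gcd j r"
    have d: "?d > 1" using False r by (metis coprime_iff_gcd_eq_1 gcd_pos_nat less_one nat_neq_iff not_one_le_zero)
    have "r div ?d \<in> {1..<r}" using d r
      by (auto simp: Suc_le_eq div_greater_zero_iff intro!: dvd_imp_le)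
    moreover have "r dvd j * (r div ?d)"
      by (metis div_mult_swap dvd_triv_right gcd_dvd1 gcd_dvd2 mult.commute)
    ultimately have "\<exists>t\<in>{1..<r}. 1 - w ^ (j * t) = 0" using w by (metis cancel_comm_monoid_add_class.diff_cancel)
    thus ?thesis using False by (simp add: prod_zero)
  qed
  have "of_nat r * ?T = (\<Sum>K\<in>nonzero_residue_sets r. (-1) ^ card K * of_nat r)"
    by (simp add: sum_distrib_left mult.commute)
  also have "\<dots> = (\<Sum>K\<in>Pow {1..<r}. if r dvd Suc (\<Sum>K) then (-1) ^ card K * of_nat r else 0)"
  proof -
    have "nonzero_residue_sets r = {K \<in> Pow {1..<r}. r dvd Suc (\<Sum>K)}"
      by (auto simp: nonzero_residue_sets_def)
    thus ?thesis by (simp only: sum.inter_filter[OF finite_Pow_iff[THEN iffD2, OF finite_atLeastLessThan]])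
  qed
  also have "\<dots> = (\<Sum>K\<in>Pow {1..<r}. \<Sum>j<r. (-1) ^ card K * w ^ (j * Suc (\<Sum>K)))"
  proof (rule sum.cong[OF refl])
    fix K
    have "(\<Sum>j<r. w ^ (j * Suc (\<Sum>K))) = (\<Sum>u\<in>{0..<int r}. w ^ (nat u * Suc (\<Sum>K)))"
      by (rule sum.reindex_bij_witness[where i=nat and j=int]) auto
    also have "\<dots> = (if r dvd Suc (\<Sum>K) then of_nat r else 0)" by (rule sum_root_powers[OF w])
    finally show "(if r dvd Suc (\<Sum>K) then (-1) ^ card K * of_nat r else 0) =
        (\<Sum>j<r. (-1) ^ card K * w ^ (j * Suc (\<Sum>K)))"
      by (simp add: sum_distrib_left[symmetric])
  qed
  also have "\<dots> = (\<Sum>j<r. w ^ j * (\<Sum>K\<in>Pow {1..<r}. (\<Prod>t\<in>K. - (w ^ (j * t)))))"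
  proof (subst sum.swap, intro sum.cong refl)
    fix j
    have "(-1) ^ card K * w ^ (j * Suc (\<Sum>K)) = w ^ j * (\<Prod>t\<in>K. - (w ^ (j * t)))"
      if "K \<in> Pow {1..<r}" for K
    proof -
      have "finite K" using that finite_subset by blast
      hence "(\<Prod>t\<in>K. - (w ^ (j * t))) = (-1) ^ card K * w ^ (j * \<Sum>K)"
        by (induction K rule: finite_induct) (auto simp: power_add distrib_left)
      thus ?thesis by (simp add: power_add)
    qed
    thus "(\<Sum>K\<in>Pow {1..<r}. (-1) ^ card K * w ^ (j * Suc (\<Sum>K))) =
        w ^ j * (\<Sum>K\<in>Pow {1..<r}. (\<Prod>t\<in>K. - (w ^ (j * t))))"
      by (simp add: sum_distrib_left)
  qed
  also have "\<dots> = (\<Sum>j<r. if coprime j r then w ^ j * D else 0)"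
  proof (intro sum.cong refl)
    fix j
    have "(\<Sum>K\<in>Pow {1..<r}. (\<Prod>t\<in>K. - (w ^ (j * t)))) = (\<Prod>t\<in>{1..<r}. - (w ^ (j * t)) + 1)"
      by (subst prod_add) simp_all
    also have "\<dots> = (if coprime j r then D else 0)" using prod[of j] by (simp add: add.commute)
    finally show "w ^ j * (\<Sum>K\<in>Pow {1..<r}. (\<Prod>t\<in>K. - (w ^ (j * t)))) =
      (if coprime j r then w ^ j * D else 0)" by simp
  qed
  also have "\<dots> = (\<Sum>j | j \<in> {..<r} \<and> coprime j r. w ^ j * D)"
    by (rule sum.inter_filter[symmetric]) simp
  also have "\<dots> = (\<Sum>j | j < r \<and> coprime j r. w ^ j) * D" by (simp add: sum_distrib_right)
  finally have "of_nat r * ?T = (\<Sum>j | j < r \<and> coprime j r. w ^ j) * D" .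
  moreover have "D \<noteq> 0" unfolding D_def using w by (auto dest: dvd_imp_le)
  moreover have "(\<Sum>j | j < r \<and> coprime j r. w ^ j) \<noteq> 0"
    using sum_primitive_roots[OF r(2) w] by auto
  ultimately show ?thesis by auto
qed

section \<open>Divisibility of the hook polynomials by 1 + x\<close>

lemma hook_poly_eq_super_poly:
  assumes "r \<ge> 1" "s \<ge> 1" "cycle_labelling r s a" "faithful_linear_character r \<zeta>"
  shows "[:1, 1:] * hook_poly r s a \<zeta> = super_poly card (residue_sets r) s"
proof -
  have fin: "finite (residue_sets r)"
    by (rule finite_subset[of _ "Pow {..<r}"]) (auto simp: residue_sets_def)
  have "[:1, 1:] * hook_poly r s a \<zeta> =
      smult (1 / fact s) (of_nat (fact s) * super_poly card (residue_sets r) s)"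
    unfolding hook_poly_eq_sum_colourings[OF assms] sum_colourings[OF fin] ..
  also have "of_nat (fact s) * super_poly card (residue_sets r) s =
      smult (fact s) (super_poly card (residue_sets r) s)"
    by (simp add: of_nat_poly)
  finally show ?thesis by simp
qed

lemma hook_poly_not_squarefree:
  assumes r: "r \<ge> 1" "\<not> squarefree r" and s: "s \<ge> 1"
    and a: "cycle_labelling r s a" and \<zeta>: "faithful_linear_character r \<zeta>"
  obtains u where "nat_coeffs u" "hook_poly r s a \<zeta> = [:1, 1:] * u"
proof -
  have fin: "finite (residue_sets r)"
    by (rule finite_subset[of _ "Pow {..<r}"]) (auto simp: residue_sets_def)
  obtain h where h: "nat_series h"
    "(\<Prod>K\<in>residue_sets r. super_factor (card K)) = 1 + fps_const ([:1, 1:]\<^sup>2) * h"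
    using unital_series_residue_sets[OF r] unfolding unital_series_def by blast
  have "[:1, 1:] * hook_poly r s a \<zeta> = fps_nth (1 + fps_const ([:1, 1:]\<^sup>2) * h) s"
    unfolding hook_poly_eq_super_poly[OF r(1) s a \<zeta>] super_poly_eq_prod[OF fin, symmetric] h(2) ..
  \<comment> \<open>The summand 1 only affects the coefficient at \<open>s = 0\<close>.\<close>
  also have "\<dots> = [:1, 1:]\<^sup>2 * fps_nth h s" using s by simp
  also have "\<dots> = [:1, 1:] * ([:1, 1:] * fps_nth h s)"
    by (simp only: power2_eq_square mult.assoc)
  finally have "hook_poly r s a \<zeta> = [:1, 1:] * fps_nth h s"
    by (subst (asm) mult_cancel_left) simp
  thus ?thesis using h(1) by (intro that) (auto simp: nat_series_def)
qed

lemma super_poly_1: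
  "super_poly d G 1 = (\<Sum>K\<in>G. [:0, 1:] ^ d K)"
proof -
  have "super_multisets d G 1 = (\<lambda>K. {#K#}) ` G"
  proof (intro equalityI subsetI)
    fix c assume "c \<in> super_multisets d G 1"
    hence c: "set_mset c \<subseteq> G" "size c = 1" by (auto simp: super_multisets_def)
    then obtain K where "c = {#K#}" using size_1_singleton_mset by blast
    thus "c \<in> (\<lambda>K. {#K#}) ` G" using c(1) by auto
  qed (auto simp: super_multisets_def)
  moreover have "inj_on (\<lambda>K. {#K#}) G" by (auto simp: inj_on_def)
  ultimately show ?thesis by (simp add: super_poly_def sum.reindex)
qed

text \<open>Pairing by the element 0 accounts for the factor 1 + x on the left, so the hook
  polynomial is the sum of x^(card K) over the sets without 0. Its value at -1 is the alternating
  sum, which is non-zero.\<close>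

lemma hook_poly_squarefree:
  assumes r: "r \<ge> 1" "squarefree r" and a: "cycle_labelling r 1 a"
    and \<zeta>: "faithful_linear_character r \<zeta>"
  shows "\<not> [:1, 1:] dvd hook_poly r 1 a \<zeta>"
proof -
  obtain w where w: "\<And>k. w ^ k = 1 \<longleftrightarrow> r dvd k" and "\<And>z. z \<in> {0..<int r} \<Longrightarrow> \<zeta> z = w ^ nat z"
    by (rule faithful_linear_character_root[OF r(1) \<zeta>]) blast
  let ?p = "\<Sum>K\<in>nonzero_residue_sets r. [:0, 1:] ^ card K :: complex poly"
  have "[:1, 1:] * hook_poly r 1 a \<zeta> = (\<Sum>K\<in>residue_sets r. [:0, 1:] ^ card K)"
    using hook_poly_eq_super_poly[OF r(1) _ a \<zeta>] by (simp add: super_poly_1[simplified])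
  also have "\<dots> = (\<Sum>K\<in>nonzero_residue_sets r. [:0, 1:] ^ card K + [:0, 1:] ^ Suc (card K))"
    unfolding residue_sets_split[OF r(1)]
    by (rule big_op_insert_split(2)) (auto simp: finite_nonzero_residue_sets nonzero_residue_sets_0)
  also have "\<dots> = (\<Sum>K\<in>nonzero_residue_sets r. [:1, 1:] * [:0, 1:] ^ card K)"
  proof (rule sum.cong[OF refl])
    fix K
    have "[:1, 1:] = 1 + [:0, 1 :: complex:]" by (simp add: one_pCons)
    thus "[:0, 1:] ^ card K + [:0, 1:] ^ Suc (card K) = [:1, 1 :: complex:] * [:0, 1:] ^ card K"
      by (simp only: distrib_right power_Suc mult_1)
  qed
  also have "\<dots> = [:1, 1:] * ?p" by (simp only: sum_distrib_left)
  finally have "hook_poly r 1 a \<zeta> = ?p"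
    by (subst (asm) mult_cancel_left) simp
  moreover have "poly ?p (-1) \<noteq> 0"
    using alternating_sum_residue_sets[OF r w] by (simp add: poly_sum)
  ultimately show ?thesis using poly_eq_0_iff_dvd[of "hook_poly r 1 a \<zeta>" "-1"] by simp
qed

theorem theorem1p7:
  fixes r :: nat and \<zeta> :: "int \<Rightarrow> complex" and a :: "nat \<Rightarrow> nat \<Rightarrow> nat \<Rightarrow> nat"
  assumes "r \<ge> 1"
    and "faithful_linear_character r \<zeta>"
    and "\<And>s. s \<ge> 1 \<Longrightarrow> cycle_labelling r s (a s)"
  shows "([:1, 1:] dvd hook_poly r 1 (a 1) \<zeta> \<longleftrightarrow> (\<forall>s\<ge>1. [:1, 1:] dvd hook_poly r s (a s) \<zeta>))
    \<and> ((\<forall>s\<ge>1. [:1, 1:] dvd hook_poly r s (a s) \<zeta>) \<longleftrightarrow> \<not> squarefree r)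
    \<and> (\<not> squarefree r \<longrightarrow>
         (\<forall>s i. fps_nth (fps_nth (hook_series r a \<zeta> * fps_const (inverse (1 + fps_X))) s) i \<in> \<nat>))"
proof -
  \<comment> \<open>Both equivalences follow from two facts: for square-free \<open>r\<close>
    divisibility already fails at \<open>s = 1\<close>, and otherwise it holds for every
    \<open>s\<close>.\<close>
  have sqf: "\<not> [:1, 1:] dvd hook_poly r 1 (a 1) \<zeta>" if "squarefree r"
    using hook_poly_squarefree[OF assms(1) that _ assms(2)] assms(3)[of 1] by simp
  have nsqf: "\<exists>u. nat_coeffs u \<and> hook_poly r s (a s) \<zeta> = [:1, 1:] * u"
    if "\<not> squarefree r" "s \<ge> 1" for s
    using hook_poly_not_squarefree[OF assms(1) that assms(3)[OF that(2)] assms(2)] by blast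
  have dvd: "[:1, 1:] dvd hook_poly r s (a s) \<zeta>" if "\<not> squarefree r" "s \<ge> 1" for s
    using nsqf[OF that] by (metis dvd_triv_left)
  have "fps_nth (fps_nth (hook_series r a \<zeta> * fps_const (inverse (1 + fps_X))) s) i \<in> \<nat>"
    if "\<not> squarefree r" for s i
  proof (cases "s \<ge> 1")
    case True
    obtain u where u: "nat_coeffs u" "hook_poly r s (a s) \<zeta> = [:1, 1:] * u"
      using nsqf[OF \<open>\<not> squarefree r\<close> True] by blast
    have X: "fps_of_poly [:1, 1:] = (1 + fps_X :: complex fps)" by (simp add: fps_of_poly_pCons)
    have "fps_nth (hook_series r a \<zeta> * fps_const (inverse (1 + fps_X))) s =
        fps_of_poly (hook_poly r s (a s) \<zeta>) * inverse (1 + fps_X)"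
      using True by (simp add: hook_series_def)
    also have "\<dots> = fps_of_poly u * ((1 + fps_X) * inverse (1 + fps_X))"
      unfolding u(2) fps_of_poly_mult X by (simp only: mult_ac)
    also have "(1 + fps_X) * inverse (1 + fps_X) = (1 :: complex fps)"
      by (rule inverse_mult_eq_1') simp
    finally show ?thesis using u(1) by (simp add: nat_coeffs_def)
  next
    case False
    thus ?thesis by (simp add: hook_series_def)
  qed
  thus ?thesis using sqf dvd by blast
qed

end
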